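(* Let $\mathbf{H}$ be the universal homogeneous 3-uniform hypergraph. Then $\mathbf{H}$ has finite big Ramsey degrees: for every finite 3-uniform hypergraph $\mathbf{A}$ there is $\ell\in\omega$ such that for every $k\in\omega$ and every colouring $\chi$ of $\binom{\mathbf{H}}{\mathbf{A}}$ with $k$ colours there is an embedding $f\colon\mathbf{H}\to\mathbf{H}$ such that $\chi$ takes at most $\ell$ values on $\binom{f[\mathbf{H}]}{\mathbf{A}}$.
   Context: For 3-uniform hypergraphs $\mathbf{A},\mathbf{B}$, $\binom{\mathbf{B}}{\mathbf{A}}$ denotes the set of all embeddings (injective maps preserving both hyperedges and non-hyperedges) from $\mathbf{A}$ into $\mathbf{B}$. A countable hypergraph is (ultra)homogeneous if every isomorphism between finite induced sub-hypergraphs extends to an automorphism. The universal homogeneous 3-uniform hypergraph $\mathbf{H}$ is the unique (up to isomorphism) countable homogeneous 3-uniform hypergraph into which every countable 3-uniform hypergraph embeds. The big Ramsey degree of a finite substructure $\mathbf{A}$ in $\mathbf{H}$ is the least $\ell\in\omega+1$ such that for every $k\in\omega$ and every $k$-colouring of $\binom{\mathbf{H}}{\mathbf{A}}$ there is an embedding $f\colon\mathbf{H}\to\mathbf{H}$ with at most $\ell$ colours on $\binom{f[\mathbf{H}]}{\mathbf{A}}$; $\mathbf{H}$ has finite big Ramsey degrees if this is finite for every finite $\mathbf{A}$ embeddable in $\mathbf{H}$ (equivalently every finite 3-uniform hypergraph). *)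

theory Defs
  imports Main "HOL-Library.FuncSet" "HOL-Library.Countable_Set" "HOL-Library.Extended_Nat"
begin

record 'a hypergraph =
  vertices :: "'a set"
  hyperedges :: "'a set set"

definition three_uniform :: "'a hypergraph \<Rightarrow> bool" where
  "three_uniform G \<longleftrightarrow> (\<forall>e \<in> hyperedges G. e \<subseteq> vertices G \<and> card e = 3)"

definition induced :: "'a hypergraph \<Rightarrow> 'a set \<Rightarrow> 'a hypergraph" where
  "induced G S = \<lparr>vertices = vertices G \<inter> S, hyperedges = {e \<in> hyperedges G. e \<subseteq> S}\<rparr>"

text \<open>Maps between hypergraphs are extensional (\<^term>\<open>undefined\<close> off the vertex set), so that
  they are determined by their values on vertices.\<close>

definition embeddings :: "'a hypergraph \<Rightarrow> 'b hypergraph \<Rightarrow> ('a \<Rightarrow> 'b) set" where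
  "embeddings A B =
    {f \<in> vertices A \<rightarrow>\<^sub>E vertices B. inj_on f (vertices A) \<and>
       (\<forall>e. e \<subseteq> vertices A \<longrightarrow> (e \<in> hyperedges A \<longleftrightarrow> f ` e \<in> hyperedges B))}"

definition isomorphisms :: "'a hypergraph \<Rightarrow> 'b hypergraph \<Rightarrow> ('a \<Rightarrow> 'b) set" where
  "isomorphisms A B = {f \<in> embeddings A B. f ` vertices A = vertices B}"

definition homogeneous :: "'a hypergraph \<Rightarrow> bool" where
  "homogeneous G \<longleftrightarrow>
    (\<forall>S T. \<forall>g \<in> isomorphisms (induced G S) (induced G T).
       S \<subseteq> vertices G \<and> T \<subseteq> vertices G \<and> finite S \<and> finite T \<longrightarrow>
       (\<exists>h \<in> isomorphisms G G. \<forall>x \<in> S. h x = g x))"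

text \<open>Every countable hypergraph is isomorphic to one whose vertex set is a set of natural numbers,
  so quantifying over \<^typ>\<open>nat hypergraph\<close> covers all countable 3-uniform hypergraphs.\<close>

definition universal :: "'a hypergraph \<Rightarrow> bool" where
  "universal H \<longleftrightarrow> (\<forall>G :: nat hypergraph. three_uniform G \<longrightarrow> embeddings G H \<noteq> {})"

definition universal_homogeneous :: "'a hypergraph \<Rightarrow> bool" where
  "universal_homogeneous H \<longleftrightarrow>
     countable (vertices H) \<and> three_uniform H \<and> homogeneous H \<and> universal H"

text \<open>The set $\omega + 1$ is \<^typ>\<open>enat\<close>. The least element exists, since the bound
  \<^term>\<open>\<infinity> :: enat\<close> always qualifies (with the identity as embedding). Colours are counted by
  \<^const>\<open>card\<close>, which is exact because a colouring with \<open>k\<close> colours has a finite image.\<close>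

definition big_Ramsey_degree :: "'h hypergraph \<Rightarrow> 'a hypergraph \<Rightarrow> enat" where
  "big_Ramsey_degree H A =
    (LEAST l :: enat. \<forall>k :: nat. \<forall>\<chi> \<in> embeddings A H \<rightarrow> {..<k}. \<exists>f \<in> embeddings H H.
       enat (card (\<chi> ` embeddings A (induced H (f ` vertices H)))) \<le> l)"

end

theory Submission imports Defs begin

text \<open>A vertex of a countable 3-uniform hypergraph is coded by the triangular 0-1 matrix of the pairs of
  earlier vertices with which it forms a hyperedge, so the universal hypergraph is equivalent to the
  hypergraph of all such matrices, on which infinite parameter matrices act by substitution. Every
  finite set of matrices in a suitable copy is obtained from matrices of bounded size by one such
  substitution (an envelope). It thus suffices that every finite colouring of the initial segments with
  \<open>d\<close> levels of parameter matrices is constant on all \<open>W \<otimes> P\<close> for a suitable \<open>W\<close>, a Carlson--Simpson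
  or Milliken type theorem. A fusion argument reduces this to a pigeonhole principle for one further level,
  that is, for words of rows and columns. The rows that may be inserted at a level have the length reached so
  far, so the alphabet depends on the position; this is handled by an idempotent ultrafilter in a
  minimal set that is invariant under appending words whose distribution depends on the length.\<close>

section \<open>Ultrafilters on words\<close>

text \<open>The alphabet cannot be fixed in advance: a row inserted at position \<open>p\<close> has
  about \<open>p / 2\<close> entries, and where a block starts is known only after an ultrafilter
  has supplied the word before it. For each single alphabet Hales-Jewett yields variable words all
  of whose substitutions are equidistributed; the difficulty is to continue afterwards, by one tail
  for all substitutions, back into the homogeneous set. Minimality supplies the tail: all instances
  have equal length, so an appended word whose distribution depends on the length alone can be
  shared by them. Rows and columns occupy separate positions so that each step introduces a single
  variable: a column level leaves one column entry open, a row level copies the columns already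
  present. A hyperedge on a < b < c is stored in the matrix of c, at the row of b and the column of
  a, which is why a vertex owns both a row and a column. The bound on the degree counts maps of A
  into matrices of bounded size. The number of colours does not enter, since one colouring of
  parameter matrices records the colours for all these maps at once.\<close>

definition ultra :: "'a set set \<Rightarrow> bool" where
  "ultra U \<longleftrightarrow> {} \<notin> U \<and> (\<forall>A B. A \<in> U \<longrightarrow> B \<in> U \<longrightarrow> A \<inter> B \<in> U) \<and>
     (\<forall>A B. A \<in> U \<longrightarrow> A \<subseteq> B \<longrightarrow> B \<in> U) \<and> (\<forall>A. A \<in> U \<or> - A \<in> U)"

lemma ultra_empty: "ultra U \<Longrightarrow> {} \<notin> U"
  and ultra_Int: "ultra U \<Longrightarrow> A \<in> U \<Longrightarrow> B \<in> U \<Longrightarrow> A \<inter> B \<in> U"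
  and ultra_mono: "ultra U \<Longrightarrow> A \<in> U \<Longrightarrow> A \<subseteq> B \<Longrightarrow> B \<in> U"
  and ultra_cases: "ultra U \<Longrightarrow> A \<in> U \<or> - A \<in> U"
  unfolding ultra_def by blast+

lemma ultra_UNIV: "ultra U \<Longrightarrow> UNIV \<in> U"
  by (metis Compl_empty_eq ultra_cases ultra_empty)

lemma ultra_Compl: assumes "ultra U" shows "- A \<in> U \<longleftrightarrow> A \<notin> U"
  using ultra_cases[OF assms] ultra_Int[OF assms] ultra_empty[OF assms]
  by (metis Compl_disjoint)

lemma ultra_Int_iff: "ultra U \<Longrightarrow> A \<inter> B \<in> U \<longleftrightarrow> A \<in> U \<and> B \<in> U"
  by (meson inf_le1 inf_le2 ultra_Int ultra_mono)

lemma ultra_Collect_ball: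
  assumes "ultra U" "finite I" "\<And>i. i \<in> I \<Longrightarrow> {x. R i x} \<in> U"
  shows "{x. \<forall>i\<in>I. R i x} \<in> U"
  using assms(2,3)
proof (induction I rule: finite_induct)
  case empty
  then show ?case using ultra_UNIV[OF assms(1)] by simp
next
  case (insert i I)
  have "{x. R i x} \<inter> {x. \<forall>i\<in>I. R i x} \<in> U"
    using insert by (intro ultra_Int[OF assms(1)]) auto
  then show ?case by (rule ultra_mono[OF assms(1)]) auto
qed

lemma ultra_nonempty: "ultra U \<Longrightarrow> A \<in> U \<Longrightarrow> A \<noteq> {}"
  using ultra_empty by blast

lemma ultra_eqI: assumes "ultra U" "ultra V" "U \<subseteq> V" shows "U = V"
  using assms by (metis subsetD subsetI subset_antisym ultra_Compl)

lemma ultra_finite_partition: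
  assumes "ultra U" "finite C" "{x. f x \<in> C} \<in> U"
  shows "\<exists>c\<in>C. {x. f x = c} \<in> U"
proof (rule ccontr)
  assume "\<not> ?thesis"
  then have "{x. \<forall>c\<in>C. f x \<noteq> c} \<in> U"
    using assms by (intro ultra_Collect_ball) (auto simp: ultra_Compl[symmetric] Collect_neg_eq)
  then have "{x. f x \<in> C} \<inter> {x. \<forall>c\<in>C. f x \<noteq> c} \<in> U"
    using assms ultra_Int by blast
  moreover have "{x. f x \<in> C} \<inter> {x. \<forall>c\<in>C. f x \<noteq> c} = {}" by auto
  ultimately show False using ultra_empty[OF assms(1)] by simp
qed

definition fip :: "'a set set \<Rightarrow> bool" where
  "fip \<F> \<longleftrightarrow> (\<forall>\<G>. finite \<G> \<longrightarrow> \<G> \<subseteq> \<F> \<longrightarrow> \<Inter>\<G> \<noteq> {})"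

text \<open>By Zorn there is a maximal family with the finite intersection property. It contains
  every set that meets all its finite intersections, and this yields the closure axioms.\<close>

lemma fip_extends_to_ultra:
  assumes "fip \<F>" shows "\<exists>U. ultra U \<and> \<F> \<subseteq> U"
proof -
  let ?X = "{\<H>. fip \<H> \<and> \<F> \<subseteq> \<H>}"
  have "\<exists>M\<in>?X. \<forall>X\<in>?X. M \<subseteq> X \<longrightarrow> X = M"
  proof (rule subset_Zorn_nonempty)
    show "?X \<noteq> {}" using assms by blast
  next
    fix \<C> assume ne: "\<C> \<noteq> {}" and ch: "subset.chain ?X \<C>"
    have "fip (\<Union>\<C>)" unfolding fip_def
    proof (intro allI impI)
      fix \<G> assume "finite \<G>" "\<G> \<subseteq> \<Union>\<C>"
      then obtain K where "K \<in> \<C>" "\<G> \<subseteq> K"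
        using finite_subset_Union_chain[of \<G> \<C> ?X] ne ch by blast
      then show "\<Inter>\<G> \<noteq> {}" using ch \<open>finite \<G>\<close> unfolding subset_chain_def fip_def by blast
    qed
    moreover have "\<F> \<subseteq> \<Union>\<C>" using ne ch unfolding subset_chain_def by blast
    ultimately show "\<Union>\<C> \<in> ?X" by simp
  qed
  then obtain U where U: "fip U" "\<F> \<subseteq> U" and max: "\<And>X. fip X \<Longrightarrow> \<F> \<subseteq> X \<Longrightarrow> U \<subseteq> X \<Longrightarrow> X = U"
    by auto
  have add: "A \<in> U" if "\<And>\<G>. finite \<G> \<Longrightarrow> \<G> \<subseteq> U \<Longrightarrow> A \<inter> \<Inter>\<G> \<noteq> {}" for A
  proof -
    have "fip (insert A U)" unfolding fip_def
    proof (intro allI impI)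
      fix \<G> assume g: "finite \<G>" "\<G> \<subseteq> insert A U"
      then have "A \<inter> \<Inter>(\<G> - {A}) \<noteq> {}" by (intro that) auto
      then show "\<Inter>\<G> \<noteq> {}" by blast
    qed
    then have "insert A U = U" using U by (intro max) auto
    then show ?thesis by blast
  qed
  have inter: "\<Inter>\<G> \<in> U" if "finite \<G>" "\<G> \<subseteq> U" for \<G>
  proof (rule add)
    fix \<H> assume "finite \<H>" "\<H> \<subseteq> U"
    then have "\<Inter>(\<G> \<union> \<H>) \<noteq> {}" using that U(1) unfolding fip_def by (meson Un_least finite_UnI)
    then show "\<Inter>\<G> \<inter> \<Inter>\<H> \<noteq> {}" by (simp add: Inf_union_distrib)
  qed
  have "ultra U" unfolding ultra_def
  proof (intro conjI allI impI)
    show "{} \<notin> U" using U(1) unfolding fip_def by (metis Inf_empty Inf_insert empty_subsetI finite.emptyI finite.insertI inf_top_right insert_subset)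
  next
    fix A B assume "A \<in> U" "B \<in> U"
    then show "A \<inter> B \<in> U" using inter[of "{A,B}"] by simp
  next
    fix A B assume A: "A \<in> U" "A \<subseteq> B"
    show "B \<in> U"
    proof (rule add)
      fix \<G> assume "finite \<G>" "\<G> \<subseteq> U"
      then have "\<Inter>(insert A \<G>) \<noteq> {}" using A U(1) unfolding fip_def by (meson finite.insertI insert_subset)
      then show "B \<inter> \<Inter>\<G> \<noteq> {}" using A by blast
    qed
  next
    fix A show "A \<in> U \<or> - A \<in> U"
    proof (rule ccontr)
      assume "\<not> ?thesis"
      then obtain \<G> \<H> where "finite \<G>" "\<G> \<subseteq> U" "A \<inter> \<Inter>\<G> = {}" "finite \<H>" "\<H> \<subseteq> U" "- A \<inter> \<Inter>\<H> = {}"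
        using add by meson
      moreover from this have "\<Inter>(\<G> \<union> \<H>) \<noteq> {}" using U(1) unfolding fip_def by (meson Un_least finite_UnI)
      ultimately show False by blast
    qed
  qed
  with U show ?thesis by blast
qed

section \<open>Closed sets of ultrafilters and compactness\<close>

definition ultras_on :: "'a set \<Rightarrow> 'a set set set" where
  "ultras_on S = {U. ultra U \<and> S \<in> U}"

text \<open>The closed sets of the Stone space in filter form: all ultrafilters extending the filter
  \<open>\<Inter>K\<close>. Topological arguments thus become statements about families of
  sets.\<close>

definition ultra_closed :: "'a set set set \<Rightarrow> bool" where
  "ultra_closed K \<longleftrightarrow> K \<subseteq> {U. ultra U} \<and> (\<forall>U. ultra U \<longrightarrow> \<Inter>K \<subseteq> U \<longrightarrow> U \<in> K)"

text \<open>If a set of \<open>U\<close> lay in no member of \<open>K\<close>, its complement would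
  lie in all of them; so \<open>\<Inter>K \<subseteq> U\<close> says that \<open>U\<close> is a
  limit of \<open>K\<close>.\<close>

lemma ultra_closedI:
  assumes "\<And>U. U \<in> K \<Longrightarrow> ultra U"
    and "\<And>U. ultra U \<Longrightarrow> (\<And>B. B \<in> U \<Longrightarrow> \<exists>W\<in>K. B \<in> W) \<Longrightarrow> U \<in> K"
  shows "ultra_closed K"
proof -
  have "U \<in> K" if "ultra U" "\<Inter>K \<subseteq> U" for U
  proof (rule assms(2)[OF that(1)], rule ccontr)
    fix B assume "B \<in> U" "\<not> (\<exists>W\<in>K. B \<in> W)"
    then have "- B \<in> \<Inter>K" using assms(1) by (auto simp: ultra_Compl)
    then show False using \<open>B \<in> U\<close> that ultra_Compl by blast
  qed
  then show ?thesis using assms(1) unfolding ultra_closed_def by blast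
qed

lemma ultra_closedD: "ultra_closed K \<Longrightarrow> U \<in> K \<Longrightarrow> ultra U"
  unfolding ultra_closed_def by blast

lemma ultra_closed_mem: "ultra_closed K \<Longrightarrow> ultra U \<Longrightarrow> \<Inter>K \<subseteq> U \<Longrightarrow> U \<in> K"
  unfolding ultra_closed_def by blast

lemma ultra_closed_limit:
  assumes "ultra_closed K" "ultra U" "\<And>B. B \<in> U \<Longrightarrow> \<exists>W\<in>K. B \<in> W"
  shows "U \<in> K"
proof -
  have "\<Inter>K \<subseteq> U"
  proof
    fix B assume B: "B \<in> \<Inter>K"
    show "B \<in> U"
    proof (rule ccontr)
      assume "B \<notin> U"
      then obtain W where "W \<in> K" "- B \<in> W" using assms(2,3) ultra_Compl by blast
      then show False using B assms(1) ultra_Compl ultra_closedD by blast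
    qed
  qed
  then show ?thesis using assms(1,2) unfolding ultra_closed_def by blast
qed

text \<open>The hypothesis gives \<open>\<F> \<union> \<Inter>K\<close> the finite intersection
  property, and an ultrafilter extending \<open>\<Inter>K\<close> lies in \<open>K\<close> by
  closedness.\<close>

lemma ultra_closed_compact:
  assumes K: "ultra_closed K"
    and fin: "\<And>\<G>. finite \<G> \<Longrightarrow> \<G> \<subseteq> \<F> \<Longrightarrow> \<exists>W\<in>K. \<G> \<subseteq> W"
  shows "\<exists>U\<in>K. \<F> \<subseteq> U"
proof -
  have "fip (\<F> \<union> \<Inter>K)" unfolding fip_def
  proof (intro allI impI)
    fix \<G> assume g: "finite \<G>" "\<G> \<subseteq> \<F> \<union> \<Inter>K"
    then obtain W where W: "W \<in> K" "\<G> \<inter> \<F> \<subseteq> W" using fin[of "\<G> \<inter> \<F>"] by auto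
    then have "\<G> \<subseteq> W" using g by blast
    then have "{x. \<forall>i\<in>\<G>. x \<in> i} \<in> W"
      using ultra_Collect_ball[of W \<G> "\<lambda>i x. x \<in> i"] W K g ultra_closedD by fastforce
    then show "\<Inter>\<G> \<noteq> {}" using ultra_nonempty ultra_closedD[OF K W(1)] by blast
  qed
  then obtain U where "ultra U" "\<F> \<union> \<Inter>K \<subseteq> U" using fip_extends_to_ultra by blast
  then show ?thesis using K unfolding ultra_closed_def by (intro bexI[of _ U]) auto
qed

lemma ultra_closed_Int_containing:
  assumes "ultra_closed K" shows "ultra_closed {U \<in> K. \<F> \<subseteq> U}"
proof (rule ultra_closedI)
  show "ultra U" if "U \<in> {U \<in> K. \<F> \<subseteq> U}" for U using that assms ultra_closedD by auto
next
  fix U assume U: "ultra U" and lim: "\<And>B. B \<in> U \<Longrightarrow> \<exists>W\<in>{U \<in> K. \<F> \<subseteq> U}. B \<in> W"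
  have "U \<in> K" using lim by (intro ultra_closed_limit[OF assms U]) blast
  moreover have "B \<in> U" if "B \<in> \<F>" for B
  proof (rule ccontr)
    assume "B \<notin> U"
    then obtain W where "W \<in> K" "\<F> \<subseteq> W" "- B \<in> W" using lim U ultra_Compl by blast
    then show False using that assms ultra_Compl ultra_closedD by blast
  qed
  ultimately show "U \<in> {U \<in> K. \<F> \<subseteq> U}" by auto
qed

lemma ultra_closed_ultras_on: "ultra_closed (ultras_on S)"
proof -
  have "ultra_closed {U. ultra U}" unfolding ultra_closed_def by auto
  from ultra_closed_Int_containing[OF this, of "{S}"] show ?thesis
    by (simp add: ultras_on_def)
qed

text \<open>\<open>Q\<close> stands for an invariance property: being a subsemigroup, being a left
  ideal, or being stable under appending words. Compactness keeps the intersection of a chain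
  nonempty.\<close>

lemma minimal_ultra_closed:
  assumes K0: "ultra_closed K0" "K0 \<noteq> {}" "Q K0"
    and Q: "\<And>\<C>. \<C> \<noteq> {} \<Longrightarrow> (\<And>K. K \<in> \<C> \<Longrightarrow> Q K) \<Longrightarrow> Q (\<Inter>\<C>)"
  shows "\<exists>K. ultra_closed K \<and> K \<noteq> {} \<and> Q K \<and> K \<subseteq> K0 \<and>
    (\<forall>K'. ultra_closed K' \<longrightarrow> K' \<noteq> {} \<longrightarrow> Q K' \<longrightarrow> K' \<subseteq> K \<longrightarrow> K' = K)"
proof -
  let ?X = "{K. ultra_closed K \<and> K \<noteq> {} \<and> Q K \<and> K \<subseteq> K0}"
  \<comment> \<open>Complements turn the search for a minimal set into Zorn's lemma for maximal
    ones.\<close>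
  let ?Y = "uminus ` ?X"
  have "\<exists>M\<in>?Y. \<forall>X\<in>?Y. M \<subseteq> X \<longrightarrow> X = M"
  proof (rule subset_Zorn_nonempty)
    show "?Y \<noteq> {}" using K0 by blast
  next
    fix \<D> assume ne: "\<D> \<noteq> {}" and ch: "subset.chain ?Y \<D>"
    define \<C> where "\<C> = uminus ` \<D>"
    have CX: "K \<in> ?X" if "K \<in> \<C>" for K
      using that ch unfolding \<C>_def subset_chain_def by fastforce
    have Cch: "K \<subseteq> K' \<or> K' \<subseteq> K" if "K \<in> \<C>" "K' \<in> \<C>" for K K'
      using that ch unfolding \<C>_def subset_chain_def by auto
    have Cne: "\<C> \<noteq> {}" using ne \<C>_def by simp
    then obtain K1 where K1: "K1 \<in> \<C>" by blast
    have least: "\<exists>K\<in>\<C>. \<forall>K'\<in>\<C>'. K \<subseteq> K'" if "finite \<C>'" "\<C>' \<subseteq> \<C>" for \<C>'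
      using that
    proof (induction \<C>' rule: finite_induct)
      case empty then show ?case using K1 by blast
    next
      case (insert L \<C>')
      then obtain K where "K \<in> \<C>" "\<forall>K'\<in>\<C>'. K \<subseteq> K'" by auto
      moreover have "L \<in> \<C>" using insert.prems by simp
      ultimately consider "K \<subseteq> L" | "L \<subseteq> K" using Cch by blast
      then show ?case
      proof cases
        case 1 then show ?thesis using \<open>K \<in> \<C>\<close> \<open>\<forall>K'\<in>\<C>'. K \<subseteq> K'\<close> by (intro bexI[of _ K]) auto
      next
        case 2 then show ?thesis using \<open>L \<in> \<C>\<close> \<open>\<forall>K'\<in>\<C>'. K \<subseteq> K'\<close> by (intro bexI[of _ L]) auto
      qed
    qed
    \<comment> \<open>Finitely many sets from the union of these filters lie in every member of the
      smallest chain element involved, so compactness of \<open>K1\<close> applies. The resulting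
      \<open>U\<close> extends \<open>\<Inter>K\<close> for each \<open>K\<close> in the chain,
      hence belongs to all of them.\<close>
    have "\<exists>U\<in>K1. (\<Union>K\<in>\<C>. \<Inter>K) \<subseteq> U"
    proof (rule ultra_closed_compact)
      show "ultra_closed K1" using CX K1 by blast
    next
      fix \<G> assume g: "finite \<G>" "\<G> \<subseteq> (\<Union>K\<in>\<C>. \<Inter>K)"
      then have "\<forall>G\<in>\<G>. \<exists>K. K \<in> \<C> \<and> G \<in> \<Inter>K" by blast
      then obtain h where h: "\<And>G. G \<in> \<G> \<Longrightarrow> h G \<in> \<C> \<and> G \<in> \<Inter>(h G)" by metis
      have "finite (insert K1 (h ` \<G>))" "insert K1 (h ` \<G>) \<subseteq> \<C>" using g h K1 by auto
      then obtain K where K: "K \<in> \<C>" "\<forall>K'\<in>insert K1 (h ` \<G>). K \<subseteq> K'" using least by meson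
      then obtain W where W: "W \<in> K" using CX by blast
      have "\<G> \<subseteq> W"
      proof
        fix G assume "G \<in> \<G>"
        then have "W \<in> h G" "G \<in> \<Inter>(h G)" using K W h by auto
        then show "G \<in> W" by blast
      qed
      then show "\<exists>W\<in>K1. \<G> \<subseteq> W" using K W by blast
    qed
    then obtain U where U: "U \<in> K1" "(\<Union>K\<in>\<C>. \<Inter>K) \<subseteq> U" by blast
    have uU: "ultra U" using U(1) CX[OF K1] ultra_closedD[of K1] by auto
    have "U \<in> \<Inter>\<C>"
    proof
      fix K assume "K \<in> \<C>"
      then have "ultra_closed K" "\<Inter>K \<subseteq> U" using U(2) CX by auto
      then show "U \<in> K" by (intro ultra_closed_mem uU)
    qed
    moreover have "ultra_closed (\<Inter>\<C>)"
      unfolding ultra_closed_def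
    proof (intro conjI allI impI)
      show "\<Inter>\<C> \<subseteq> {U. ultra U}" using K1 CX[OF K1] ultra_closedD[of K1] by auto
      fix W assume W: "ultra W" "\<Inter>(\<Inter>\<C>) \<subseteq> W"
      show "W \<in> \<Inter>\<C>"
      proof
        fix K assume "K \<in> \<C>"
        then have "\<Inter>K \<subseteq> \<Inter>(\<Inter>\<C>)" "ultra_closed K" using CX by auto
        then show "W \<in> K" using W by (intro ultra_closed_mem) auto
      qed
    qed
    moreover have "Q (\<Inter>\<C>)" using Q[OF Cne] CX by blast
    moreover have "\<Inter>\<C> \<subseteq> K0" using K1 CX[OF K1] by auto
    ultimately have "\<Inter>\<C> \<in> ?X" by blast
    moreover have "\<Union>\<D> = - \<Inter>\<C>" unfolding \<C>_def by auto
    ultimately show "\<Union>\<D> \<in> ?Y" by blast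
  qed
  then obtain M where M: "M \<in> ?Y" "\<forall>X\<in>?Y. M \<subseteq> X \<longrightarrow> X = M" by (elim bexE)
  then obtain K where K: "K \<in> ?X" "M = - K" by (elim imageE)
  have max: "- K' = - K" if "K' \<in> ?X" "- K \<subseteq> - K'" for K'
  proof -
    have "- K' \<in> ?Y" using that(1) by (rule imageI)
    then show ?thesis using that(2) by (rule M(2)[unfolded K(2), rule_format])
  qed
  have "K' = K" if "ultra_closed K'" "K' \<noteq> {}" "Q K'" "K' \<subseteq> K" for K'
    using max[of K'] that K by auto
  then show ?thesis using K(1) by blast
qed

text \<open>Ultrafilters on words: draw \<open>x\<close> from \<open>W\<close>, then \<open>y\<close> from \<open>N x\<close>, and concatenate.\<close>

definition ubind :: "'a list set set \<Rightarrow> ('a list \<Rightarrow> 'a list set set) \<Rightarrow> 'a list set set" where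
  "ubind W N = {B. {x. {y. x @ y \<in> B} \<in> N x} \<in> W}"

abbreviation uconv :: "'a list set set \<Rightarrow> 'a list set set \<Rightarrow> 'a list set set" (infixl "\<odot>" 70) where
  "W \<odot> V \<equiv> ubind W (\<lambda>_. V)"

definition umap :: "('a \<Rightarrow> 'b) \<Rightarrow> 'a set set \<Rightarrow> 'b set set" where
  "umap h U = {B. h -` B \<in> U}"

lemma ultra_ubind:
  fixes N :: "'a list \<Rightarrow> 'a list set set"
  assumes W: "ultra W" and N: "\<And>x. ultra (N x)" shows "ultra (ubind W N)"
  unfolding ultra_def
proof (intro conjI allI impI)
  show "{} \<notin> ubind W N" using ultra_empty[OF N] ultra_empty[OF W] by (simp add: ubind_def)
next
  fix A B assume "A \<in> ubind W N" "B \<in> ubind W N"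
  then have "{x. {y. x @ y \<in> A} \<in> N x} \<inter> {x. {y. x @ y \<in> B} \<in> N x} \<in> W"
    using ultra_Int[OF W] by (simp add: ubind_def)
  then show "A \<inter> B \<in> ubind W N"
    by (simp add: ubind_def Collect_conj_eq ultra_Int_iff[OF N])
next
  fix A B assume A: "A \<in> ubind W N" "A \<subseteq> B"
  have "{x. {y. x @ y \<in> A} \<in> N x} \<subseteq> {x. {y. x @ y \<in> B} \<in> N x}"
    using A(2) by (auto elim!: ultra_mono[OF N])
  then show "B \<in> ubind W N" using A(1) ultra_mono[OF W] by (auto simp: ubind_def)
next
  fix A :: "'a list set"
  have "{y. x @ y \<in> - A} = - {y. x @ y \<in> A}" for x by auto
  then have "{x. {y. x @ y \<in> - A} \<in> N x} = - {x. {y. x @ y \<in> A} \<in> N x}"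
    using ultra_Compl[OF N] by auto
  then show "A \<in> ubind W N \<or> - A \<in> ubind W N" using ultra_cases[OF W] by (simp add: ubind_def)
qed

lemma ultra_umap: "ultra U \<Longrightarrow> ultra (umap h U)"
  unfolding ultra_def umap_def
  by (auto simp: vimage_Compl) (metis vimage_mono)

section \<open>The convolution semigroup and its idempotents\<close>

lemma uconv_assoc: "(P \<odot> Q) \<odot> R = P \<odot> (Q \<odot> R)"
  by (simp add: ubind_def)

lemma ubind_ultras_on:
  assumes "W \<in> ultras_on X" "\<And>x. N x \<in> ultras_on Y" "\<And>x y. x \<in> X \<Longrightarrow> y \<in> Y \<Longrightarrow> x @ y \<in> Z"
  shows "ubind W N \<in> ultras_on Z"
proof -
  have N: "ultra (N x)" "Y \<in> N x" for x using assms(2) by (auto simp: ultras_on_def)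
  have "{y. x @ y \<in> Z} \<in> N x" if "x \<in> X" for x
    using assms(3)[OF that] by (rule_tac ultra_mono[OF N]) auto
  then have "X \<subseteq> {x. {y. x @ y \<in> Z} \<in> N x}" by blast
  moreover have W: "ultra W" "X \<in> W" using assms(1) by (auto simp: ultras_on_def)
  ultimately have "{x. {y. x @ y \<in> Z} \<in> N x} \<in> W" using ultra_mono by blast
  then show ?thesis using ultra_ubind[of W N] N W by (simp add: ultras_on_def ubind_def)
qed

lemma ultras_on_lists_conv:
  "U \<in> ultras_on (lists A) \<Longrightarrow> V \<in> ultras_on (lists A) \<Longrightarrow> U \<odot> V \<in> ultras_on (lists A)"
  by (rule ubind_ultras_on) auto

lemma ultras_on_nonempty: "X \<noteq> {} \<Longrightarrow> ultras_on X \<noteq> {}"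
  using fip_extends_to_ultra[of "{X}"]
  by (fastforce simp: ultras_on_def fip_def subset_singleton_iff)

text \<open>Convolution is continuous in its left factor: \<open>B \<in> W \<odot> V\<close> means
  that a set depending only on \<open>B\<close> and \<open>V\<close> belongs to \<open>W\<close>.
  Hence the image of a compact set is closed.\<close>

lemma ultra_closed_uconv_right:
  assumes K: "ultra_closed K" and V: "ultra V" shows "ultra_closed ((\<lambda>W. W \<odot> V) ` K)"
proof (rule ultra_closedI)
  fix U assume "U \<in> (\<lambda>W. W \<odot> V) ` K"
  then obtain W where "W \<in> K" "U = W \<odot> V" by blast
  then show "ultra U" using ultra_closedD[OF K] by (simp add: ultra_ubind V)
next
  fix U assume U: "ultra U" and lim: "\<And>B. B \<in> U \<Longrightarrow> \<exists>W\<in>(\<lambda>W. W \<odot> V) ` K. B \<in> W"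
  let ?pre = "\<lambda>B. {x. {y. x @ y \<in> B} \<in> V}"
  have "\<exists>W\<in>K. ?pre ` U \<subseteq> W"
  proof (rule ultra_closed_compact[OF K])
    fix \<G> assume "finite \<G>" "\<G> \<subseteq> ?pre ` U"
    then obtain \<H> where H: "finite \<H>" "\<H> \<subseteq> U" "\<G> = ?pre ` \<H>" by (meson finite_subset_image)
    have "{x. \<forall>i\<in>\<H>. x \<in> i} \<in> U" using H U by (intro ultra_Collect_ball) auto
    then obtain W where W: "W \<in> K" "{x. \<forall>i\<in>\<H>. x \<in> i} \<in> W \<odot> V" using lim by fastforce
    have "ultra (W \<odot> V)" by (intro ultra_ubind V ultra_closedD[OF K W(1)])
    then have "i \<in> W \<odot> V" if "i \<in> \<H>" for i using that W(2) by (rule_tac ultra_mono) auto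
    then have "?pre i \<in> W" if "i \<in> \<H>" for i using that by (simp add: ubind_def)
    then have "\<G> \<subseteq> W" unfolding H(3) by (rule image_subsetI)
    then show "\<exists>W\<in>K. \<G> \<subseteq> W" using W(1) by blast
  qed
  then obtain W where W: "W \<in> K" "?pre ` U \<subseteq> W" by blast
  then have "U \<subseteq> W \<odot> V" by (simp add: ubind_def image_subset_iff subset_iff)
  then have "U = W \<odot> V" by (intro ultra_eqI U ultra_ubind V ultra_closedD[OF K W(1)])
  then show "U \<in> (\<lambda>W. W \<odot> V) ` K" using W by blast
qed

text \<open>In a minimal closed subsemigroup \<open>Z\<close>, both \<open>Z \<odot> V\<close> and
  the stabiliser of \<open>V\<close> are closed subsemigroups, hence equal to \<open>Z\<close>; so
  \<open>V\<close> stabilises itself.\<close>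

lemma Ellis_idempotent:
  assumes "ultra_closed K" "K \<noteq> {}" "\<And>P Q. P \<in> K \<Longrightarrow> Q \<in> K \<Longrightarrow> P \<odot> Q \<in> K"
  shows "\<exists>U\<in>K. U \<odot> U = U"
proof -
  let ?Q = "\<lambda>K. \<forall>P\<in>K. \<forall>Q\<in>K. P \<odot> Q \<in> K"
  obtain Z where Z: "ultra_closed Z" "Z \<noteq> {}" "?Q Z" "Z \<subseteq> K"
    and min: "\<And>K'. ultra_closed K' \<Longrightarrow> K' \<noteq> {} \<Longrightarrow> ?Q K' \<Longrightarrow> K' \<subseteq> Z \<Longrightarrow> K' = Z"
  proof -
    have "?Q (\<Inter>\<C>)" if "\<And>K. K \<in> \<C> \<Longrightarrow> ?Q K" for \<C> using that by simp
    from minimal_ultra_closed[of K ?Q, OF assms(1,2) _ this] assms(3) show thesis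
      by (auto intro: that)
  qed
  obtain V where V: "V \<in> Z" using Z by blast
  have uV: "ultra V" using V Z ultra_closedD by blast
  have "(\<lambda>W. W \<odot> V) ` Z = Z"
  proof (rule min)
    show "ultra_closed ((\<lambda>W. W \<odot> V) ` Z)" by (rule ultra_closed_uconv_right[OF Z(1) uV])
    show "\<forall>P\<in>(\<lambda>W. W \<odot> V) ` Z. \<forall>Q\<in>(\<lambda>W. W \<odot> V) ` Z. P \<odot> Q \<in> (\<lambda>W. W \<odot> V) ` Z"
    proof (intro ballI, elim imageE, hypsubst)
      fix P Q assume "P \<in> Z" "Q \<in> Z"
      then have "P \<odot> V \<odot> Q \<in> Z" using Z(3) V by blast
      then have "P \<odot> V \<odot> Q \<odot> V \<in> (\<lambda>W. W \<odot> V) ` Z" by (rule imageI)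
      then show "(P \<odot> V) \<odot> (Q \<odot> V) \<in> (\<lambda>W. W \<odot> V) ` Z" by (simp add: uconv_assoc)
    qed
  qed (use Z V in auto)
  then have "V \<in> (\<lambda>W. W \<odot> V) ` Z" using V by simp
  then obtain W where W: "W \<in> Z" "W \<odot> V = V" by (elim imageE) simp
  let ?T = "{W \<in> Z. W \<odot> V = V}"
  \<comment> \<open>Inclusion between ultrafilters is equality, so the stabiliser consists of the
    members of \<open>Z\<close> containing a fixed family; in this form it is visibly
    closed.\<close>
  have T: "?T = {W \<in> Z. (\<lambda>B. {x. {y. x @ y \<in> B} \<in> V}) ` V \<subseteq> W}"
  proof (intro Collect_cong conj_cong refl)
    fix W assume "W \<in> Z"
    then have "ultra (W \<odot> V)" by (intro ultra_ubind uV ultra_closedD[OF Z(1)])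
    then have "W \<odot> V = V \<longleftrightarrow> V \<subseteq> W \<odot> V" using ultra_eqI[OF uV] by blast
    then show "W \<odot> V = V \<longleftrightarrow> (\<lambda>B. {x. {y. x @ y \<in> B} \<in> V}) ` V \<subseteq> W"
      by (auto simp: ubind_def)
  qed
  have "?T = Z"
  proof (rule min)
    show "ultra_closed ?T" unfolding T by (rule ultra_closed_Int_containing[OF Z(1)])
    show "\<forall>P\<in>?T. \<forall>Q\<in>?T. P \<odot> Q \<in> ?T"
    proof (intro ballI)
      fix P Q assume "P \<in> ?T" "Q \<in> ?T"
      then have "P \<in> Z" "Q \<in> Z" "P \<odot> V = V" "Q \<odot> V = V" by auto
      then show "P \<odot> Q \<in> ?T" using Z(3) uconv_assoc[of P Q V] by auto
    qed
  qed (use W in auto)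
  then have "V \<odot> V = V" using V by blast
  then show ?thesis using V Z by blast
qed

section \<open>Variable words\<close>

definition sub :: "'l \<Rightarrow> 'l option list \<Rightarrow> 'l list" where
  "sub a x = map (case_option a id) x"

definition varwords :: "'l set \<Rightarrow> 'l option list set" where
  "varwords F = {x. set x \<subseteq> insert None (Some ` F) \<and> None \<in> set x}"

text \<open>A new level sits at the first variable of its block. Of that block only this prefix
  precedes it, so only the prefix enters the colour there.\<close>

definition const_prefix :: "'l option list \<Rightarrow> 'l list" where
  "const_prefix x = map the (takeWhile (\<lambda>l. l \<noteq> None) x)"

lemma umap_uconv:
  assumes "\<And>x y. h (x @ y) = h x @ h y" shows "umap h (P \<odot> Q) = umap h P \<odot> umap h Q"
  by (simp add: umap_def ubind_def assms)

lemma umap_id_on: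
  assumes "ultra U" "X \<in> U" "\<And>x. x \<in> X \<Longrightarrow> h x = x" shows "umap h U = U"
proof (rule ultra_eqI[symmetric])
  show "U \<subseteq> umap h U"
  proof
    fix B assume "B \<in> U"
    then have "X \<inter> B \<in> U" using assms ultra_Int by blast
    then have "h -` B \<in> U" by (rule ultra_mono[OF assms(1)]) (use assms(3) in auto)
    then show "B \<in> umap h U" by (simp add: umap_def)
  qed
qed (use assms ultra_umap in auto)

lemma umap_comp: "umap g (umap h U) = umap (g \<circ> h) U"
  by (simp add: umap_def vimage_comp)

lemma umap_ultras_on: "U \<in> ultras_on X \<Longrightarrow> h ` X \<subseteq> Y \<Longrightarrow> umap h U \<in> ultras_on Y"
  unfolding ultras_on_def using ultra_umap ultra_mono[of U X "h -` Y"]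
  by (auto simp: umap_def image_subset_iff)

text \<open>The ultrafilter form of the Hales--Jewett theorem: \<open>V\<close> is an idempotent below a minimal
  idempotent of the words over \<open>F\<close>, so every substitution maps it to that minimal idempotent.\<close>

lemma Hales_Jewett_ultrafilter:
  assumes "F \<noteq> {}"
  shows "\<exists>V U. V \<in> ultras_on (varwords F) \<and> U \<in> ultras_on (lists F) \<and> (\<forall>a\<in>F. umap (sub a) V = U)"
proof -
  \<comment> \<open>Constant words are kept inside the type of variable words, as words over
    \<open>Some\<close> letters: \<open>?T a\<close> is then an endomorphism of one semigroup that
    fixes them.\<close>
  let ?M = "lists (Some ` F)" and ?S = "varwords F"
  let ?T = "\<lambda>a. map (\<lambda>l. case l of None \<Rightarrow> Some a | Some b \<Rightarrow> Some b)"
  \<comment> \<open>This is the left ideal property, so \<open>J\<close> below is a minimal closed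
    left ideal of the constant words.\<close>
  let ?Q = "\<lambda>K. \<forall>q\<in>ultras_on ?M. \<forall>p\<in>K. q \<odot> p \<in> K"
  have "?M \<noteq> {}" by blast
  then have neM: "ultras_on ?M \<noteq> {}" by (rule ultras_on_nonempty)
  have QM: "?Q (ultras_on ?M)" using ultras_on_lists_conv by blast
  have "?Q (\<Inter>\<C>)" if "\<And>K. K \<in> \<C> \<Longrightarrow> ?Q K" for \<C> using that by simp
  from minimal_ultra_closed[of "ultras_on ?M" ?Q, OF ultra_closed_ultras_on neM QM this]
  obtain J where J: "ultra_closed J" "J \<noteq> {}" "?Q J" "J \<subseteq> ultras_on ?M"
    and Jmin: "\<And>K. ultra_closed K \<Longrightarrow> K \<noteq> {} \<Longrightarrow> ?Q K \<Longrightarrow> K \<subseteq> J \<Longrightarrow> K = J"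
    by auto
  have "\<exists>U\<in>J. U \<odot> U = U" using J by (intro Ellis_idempotent) auto
  then obtain U where U: "U \<in> J" "U \<odot> U = U" by blast
  have UM: "U \<in> ultras_on ?M" using U J by blast
  then have uU: "ultra U" by (simp add: ultras_on_def)
  let ?K = "(\<lambda>W. W \<odot> U) ` ultras_on ?S"
  have SM: "W \<odot> R \<in> ultras_on ?S" if "W \<in> ultras_on ?S" "R \<in> ultras_on ?M" for W R
    using that by (rule ubind_ultras_on) (auto simp: varwords_def)
  have MS: "R \<odot> W \<in> ultras_on ?S" if "W \<in> ultras_on ?S" "R \<in> ultras_on ?M" for W R
    using that(2,1) by (rule ubind_ultras_on) (auto simp: varwords_def)
  have SS: "R \<odot> W \<in> ultras_on ?S" if "W \<in> ultras_on ?S" "R \<in> ultras_on ?S" for W R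
    using that(2,1) by (rule ubind_ultras_on) (auto simp: varwords_def)
  have "[None] \<in> ?S" by (simp add: varwords_def)
  then have "ultras_on ?S \<noteq> {}" using ultras_on_nonempty by blast
  have "\<exists>V\<in>?K. V \<odot> V = V"
  proof (rule Ellis_idempotent)
    show "ultra_closed ?K" by (rule ultra_closed_uconv_right[OF ultra_closed_ultras_on uU])
    show "?K \<noteq> {}" using \<open>ultras_on ?S \<noteq> {}\<close> by simp
    fix P Q assume "P \<in> ?K" "Q \<in> ?K"
    then obtain W R where WR: "W \<in> ultras_on ?S" "R \<in> ultras_on ?S" "P = W \<odot> U" "Q = R \<odot> U" by blast
    then have "W \<odot> U \<odot> R \<in> ultras_on ?S" using SM SS UM by blast
    then have "W \<odot> U \<odot> R \<odot> U \<in> ?K" by (rule imageI)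
    then show "P \<odot> Q \<in> ?K" using WR by (simp add: uconv_assoc)
  qed
  then obtain V0 W where V0: "V0 \<odot> V0 = V0" "W \<in> ultras_on ?S" "V0 = W \<odot> U" by blast
  have V0U: "V0 \<odot> U = V0" using V0 U by (simp add: uconv_assoc)
  \<comment> \<open>\<open>V0\<close> absorbs \<open>U\<close> on the right only. Multiplying by
    \<open>U\<close> on the left gives an idempotent with
    \<open>U \<odot> V = V \<odot> U = V\<close>.\<close>
  define V where "V = U \<odot> V0"
  have V0S: "V0 \<in> ultras_on ?S" using V0 SM UM by blast
  have VS: "V \<in> ultras_on ?S" unfolding V_def using V0S MS UM by blast
  have VV: "V \<odot> V = V"
  proof -
    have "V \<odot> V = U \<odot> ((V0 \<odot> U) \<odot> V0)" unfolding V_def by (simp only: uconv_assoc)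
    then show ?thesis using V0U V0 V_def by simp
  qed
  have VU: "V \<odot> U = V" unfolding V_def using V0U by (simp only: uconv_assoc)
  have UV: "U \<odot> V = V" unfolding V_def using U by (metis uconv_assoc)
  have key: "umap (?T a) V = U" if a: "a \<in> F" for a
  proof -
    have TU: "umap (?T a) U = U"
    proof (rule umap_id_on[OF uU])
      show "?M \<in> U" using UM by (simp add: ultras_on_def)
      show "?T a x = x" if "x \<in> ?M" for x using that by (intro map_idI) auto
    qed
    define P where "P = umap (?T a) V"
    have PM: "P \<in> ultras_on ?M" unfolding P_def
    proof (rule umap_ultras_on[OF VS], rule image_subsetI)
      fix x assume "x \<in> ?S"
      then have "l = None \<or> l \<in> Some ` F" if "l \<in> set x" for l using that by (auto simp: varwords_def)
      then show "?T a x \<in> ?M" using a by (fastforce simp: in_lists_conv_set split: option.splits)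
    qed
    have hom: "umap (?T a) (R \<odot> R') = umap (?T a) R \<odot> umap (?T a) R'" for R R'
      by (rule umap_uconv) simp
    have PP: "P \<odot> P = P" using hom[of V V] unfolding VV P_def[symmetric] ..
    have PU: "P \<odot> U = P" using hom[of V U] unfolding VU P_def[symmetric] TU ..
    have UP: "U \<odot> P = P" using hom[of U V] unfolding UV P_def[symmetric] TU ..
    have "P \<in> J" using J(3) PM U(1) PU by metis
    have uP: "ultra P" using PM by (simp add: ultras_on_def)
    \<comment> \<open>Minimality of \<open>J\<close> writes \<open>U\<close> as some
      \<open>W \<odot> P\<close>, so the idempotent \<open>P\<close> fixes \<open>U\<close> from the
      right; since also \<open>U \<odot> P = P\<close>, the two coincide.\<close>
    have "(\<lambda>W. W \<odot> P) ` ultras_on ?M = J"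
    proof (rule Jmin)
      show "ultra_closed ((\<lambda>W. W \<odot> P) ` ultras_on ?M)"
        by (rule ultra_closed_uconv_right[OF ultra_closed_ultras_on uP])
      show "(\<lambda>W. W \<odot> P) ` ultras_on ?M \<noteq> {}" using neM by simp
      show "?Q ((\<lambda>W. W \<odot> P) ` ultras_on ?M)"
      proof (intro ballI, elim imageE, hypsubst)
        fix q R assume "q \<in> ultras_on ?M" "R \<in> ultras_on ?M"
        then have "q \<odot> R \<in> ultras_on ?M" by (rule ultras_on_lists_conv)
        then have "q \<odot> R \<odot> P \<in> (\<lambda>W. W \<odot> P) ` ultras_on ?M" by (rule imageI)
        then show "q \<odot> (R \<odot> P) \<in> (\<lambda>W. W \<odot> P) ` ultras_on ?M" by (simp add: uconv_assoc)
      qed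
      show "(\<lambda>W. W \<odot> P) ` ultras_on ?M \<subseteq> J" using J(3) \<open>P \<in> J\<close> by auto
    qed
    then have "U \<in> (\<lambda>W. W \<odot> P) ` ultras_on ?M" using U(1) by simp
    then obtain W where "U = W \<odot> P" by blast
    then have "U \<odot> P = U" using PP by (simp add: uconv_assoc)
    then show ?thesis using UP P_def by simp
  qed
  have sub_T: "sub a = map the \<circ> ?T a" for a
    by (auto simp: sub_def fun_eq_iff split: option.splits)
  have "umap (sub a) V = umap (map the) U" if "a \<in> F" for a
    unfolding sub_T umap_comp[symmetric] key[OF that] ..
  moreover have "umap (map the) U \<in> ultras_on (lists F)"
    using UM by (rule umap_ultras_on) (fastforce simp: in_lists_conv_set)
  ultimately show ?thesis using VS by blast
qed

text \<open>The dual of appending a word whose distribution depends on the current length: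
  \<open>B\<close> belongs to \<open>ubind W (\<lambda>x. N (length x))\<close> iff
  \<open>pull N B\<close> belongs to \<open>W\<close>. Folding it over a list describes several such
  appendings in succession.\<close>

definition pull :: "(nat \<Rightarrow> 'a list set set) \<Rightarrow> 'a list set \<Rightarrow> 'a list set" where
  "pull N B = {x. {y. x @ y \<in> B} \<in> N (length x)}"

lemma pull_Compl: assumes "\<And>j. ultra (N j)" shows "pull N (- B) = - pull N B"
proof -
  have "{y. x @ y \<in> - B} = - {y. x @ y \<in> B}" for x by auto
  then show ?thesis unfolding pull_def using ultra_Compl[OF assms] by auto
qed

text \<open>All words of \<open>X\<close> have the same length, so one and the same ultrafilter
  \<open>N p\<close> governs their continuations and finitely many conditions are met by one
  \<open>y\<close>. The extended words again have equal length, which allows the induction.\<close>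

lemma foldr_pull_common_extension:
  assumes "\<forall>N\<in>set Ns. \<forall>j. N j \<in> ultras_on (lists L)"
    and "finite X" "\<And>x. x \<in> X \<Longrightarrow> length x = p" "X \<subseteq> foldr pull Ns B"
  shows "\<exists>r\<in>lists L. \<forall>x\<in>X. x @ r \<in> B"
  using assms
proof (induction Ns arbitrary: X p)
  case Nil
  then show ?case by (intro bexI[of _ "[]"]) auto
next
  case (Cons N Ns)
  have N: "ultra (N p)" "lists L \<in> N p" using Cons.prems(1) by (auto simp: ultras_on_def)
  have "{y. x @ y \<in> foldr pull Ns B} \<in> N p" if "x \<in> X" for x
  proof -
    have "x \<in> pull N (foldr pull Ns B)" using that Cons.prems(4) by auto
    then show ?thesis using Cons.prems(3)[OF that] unfolding pull_def by simp
  qed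
  then have "{y. \<forall>x\<in>X. x @ y \<in> foldr pull Ns B} \<in> N p"
    using Cons.prems(2) N by (intro ultra_Collect_ball) auto
  then have "{y. \<forall>x\<in>X. x @ y \<in> foldr pull Ns B} \<inter> lists L \<in> N p"
    using N ultra_Int by blast
  then obtain y where y: "\<forall>x\<in>X. x @ y \<in> foldr pull Ns B" "y \<in> lists L"
    using ultra_nonempty N by blast
  have "\<exists>r\<in>lists L. \<forall>x\<in>(\<lambda>x. x @ y) ` X. x @ r \<in> B"
    using Cons.prems y by (intro Cons.IH[where p = "p + length y"]) auto
  then obtain r where "r \<in> lists L" "\<forall>x\<in>X. x @ y @ r \<in> B" by auto
  then show ?case using y by (intro bexI[of _ "y @ r"]) auto
qed

text \<open>The idempotent \<open>U\<close> lives in a minimal set \<open>\<Omega>\<close> invariant under appending words whose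
  distribution may depend on the current length. Minimality lets one return to \<open>U\<close> after a
  variable word over the letters \<open>F k p\<close>, although these letters depend on the length \<open>p\<close> reached.\<close>

theorem block_extension:
  fixes F :: "'k \<Rightarrow> nat \<Rightarrow> 'l set" and f :: "'l list \<Rightarrow> 'c"
  assumes F: "\<And>k p. F k p \<noteq> {}" "\<And>k p. finite (F k p)" "\<And>k p. F k p \<subseteq> L"
    and fin: "finite (f ` lists L)"
  shows "\<exists>c \<A>. \<A> \<noteq> {} \<and> \<A> \<subseteq> lists L \<and>
    (\<forall>P k p. finite P \<longrightarrow> P \<subseteq> \<A> \<longrightarrow> (\<forall>s\<in>P. length s = p) \<longrightarrow>
      (\<exists>y x r. y \<in> lists L \<and> r \<in> lists L \<and> x \<in> varwords (F k (p + length y)) \<and>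
         (\<forall>s\<in>P. \<forall>a\<in>F k (p + length y). s @ y @ sub a x @ r \<in> \<A>) \<and>
         (k = k0 \<longrightarrow> (\<forall>s\<in>P. f (s @ y @ const_prefix x) = c))))"
proof -
  have "\<forall>k p. \<exists>V U. V \<in> ultras_on (varwords (F k p)) \<and> U \<in> ultras_on (lists (F k p)) \<and>
      (\<forall>a\<in>F k p. umap (sub a) V = U)"
    by (intro allI Hales_Jewett_ultrafilter F(1))
  then obtain Vf Uf where Vf: "\<And>k p. Vf k p \<in> ultras_on (varwords (F k p))"
    and Uf: "\<And>k p. Uf k p \<in> ultras_on (lists (F k p))"
    and VU: "\<And>k p a. a \<in> F k p \<Longrightarrow> umap (sub a) (Vf k p) = Uf k p"
    by metis
  have uV: "ultra (Vf k p)" for k p using Vf by (simp add: ultras_on_def)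
  let ?S = "lists L"
  have UfL: "Uf k p \<in> ultras_on ?S" for k p
    using Uf[of k p] ultra_mono[OF _ _ lists_mono[OF F(3)[of k p]]] by (auto simp: ultras_on_def)
  let ?ok = "\<lambda>N :: nat \<Rightarrow> 'l list set set. \<forall>j. N j \<in> ultras_on ?S"
  \<comment> \<open>The appended word may depend on the length of the word before it and on nothing
    else; this restriction is what later permits a continuation common to several words.\<close>
  let ?Q = "\<lambda>K. \<forall>N. ?ok N \<longrightarrow> (\<forall>W\<in>K. ubind W (\<lambda>x. N (length x)) \<in> K)"
  have "?S \<noteq> {}" by blast
  then have ne: "ultras_on ?S \<noteq> {}" by (rule ultras_on_nonempty)
  have QS: "?Q (ultras_on ?S)"
  proof (intro allI impI ballI)
    fix N :: "nat \<Rightarrow> 'l list set set" and W assume "?ok N" "W \<in> ultras_on ?S"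
    then show "ubind W (\<lambda>x. N (length x)) \<in> ultras_on ?S" by (rule_tac ubind_ultras_on) auto
  qed
  have "?Q (\<Inter>\<C>)" if "\<And>K. K \<in> \<C> \<Longrightarrow> ?Q K" for \<C> using that by simp
  from minimal_ultra_closed[of "ultras_on ?S" ?Q, OF ultra_closed_ultras_on ne QS this]
  obtain \<Omega> where \<Omega>: "ultra_closed \<Omega>" "\<Omega> \<noteq> {}" "?Q \<Omega>" "\<Omega> \<subseteq> ultras_on ?S"
    and min: "\<And>K. ultra_closed K \<Longrightarrow> K \<noteq> {} \<Longrightarrow> ?Q K \<Longrightarrow> K \<subseteq> \<Omega> \<Longrightarrow> K = \<Omega>"
    by auto
  have \<Omega>_inv: "ubind W (\<lambda>x. N (length x)) \<in> \<Omega>" if "\<And>j. N j \<in> ultras_on ?S" "W \<in> \<Omega>" for N W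
    using \<Omega>(3) that by simp
  have "\<exists>U\<in>\<Omega>. U \<odot> U = U"
  proof (rule Ellis_idempotent[OF \<Omega>(1,2)])
    fix P Q assume "P \<in> \<Omega>" "Q \<in> \<Omega>"
    then show "P \<odot> Q \<in> \<Omega>" using \<Omega>_inv[of "\<lambda>_. Q" P] \<Omega>(4) by blast
  qed
  then obtain U where U: "U \<in> \<Omega>" "U \<odot> U = U" by blast
  have uU: "ultra U" and SU: "?S \<in> U" using U \<Omega>(4) by (auto simp: ultras_on_def)
  \<comment> \<open>Otherwise \<open>- B\<close> would belong to \<open>W\<close> after every
    sequence of appendings. The sets with this property form \<open>\<F>\<close>, and the members of
    \<open>\<Omega>\<close> extending \<open>\<F>\<close> are a closed invariant set containing
    \<open>W\<close>. By minimality it is \<open>\<Omega>\<close>, so \<open>- B\<close> would lie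
    in \<open>U\<close>.\<close>
  have recur: "\<exists>Ns. (\<forall>N\<in>set Ns. ?ok N) \<and> foldr pull Ns B \<in> W" if W: "W \<in> \<Omega>" and B: "B \<in> U" for W B
  proof -
    have uW: "ultra W" using W \<Omega> ultra_closedD by blast
    define \<F> where "\<F> = {B. \<forall>Ns. (\<forall>N\<in>set Ns. ?ok N) \<longrightarrow> foldr pull Ns B \<in> W}"
    have "{Z \<in> \<Omega>. \<F> \<subseteq> Z} = \<Omega>"
    proof (rule min)
      show "ultra_closed {Z \<in> \<Omega>. \<F> \<subseteq> Z}" by (rule ultra_closed_Int_containing[OF \<Omega>(1)])
      have "B \<in> W" if "B \<in> \<F>" for B
        using that unfolding \<F>_def by (auto dest!: spec[of _ "[]"])
      then show "{Z \<in> \<Omega>. \<F> \<subseteq> Z} \<noteq> {}" using W by blast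
      show "?Q {Z \<in> \<Omega>. \<F> \<subseteq> Z}"
      proof (intro allI impI ballI)
        fix N Z assume N: "?ok N" and Z: "Z \<in> {Z \<in> \<Omega>. \<F> \<subseteq> Z}"
        have "B \<in> ubind Z (\<lambda>x. N (length x))" if "B \<in> \<F>" for B
        proof -
          have "pull N B \<in> \<F>" unfolding \<F>_def mem_Collect_eq
          proof (intro allI impI)
            fix Ns assume "\<forall>N\<in>set Ns. ?ok N"
            then have "\<forall>N\<in>set (Ns @ [N]). ?ok N" using N by auto
            then have "foldr pull (Ns @ [N]) B \<in> W" using that unfolding \<F>_def by blast
            then show "foldr pull Ns (pull N B) \<in> W" by simp
          qed
          then show ?thesis using Z by (auto simp: ubind_def pull_def)
        qed
        then show "ubind Z (\<lambda>x. N (length x)) \<in> {Z \<in> \<Omega>. \<F> \<subseteq> Z}" using \<Omega>_inv[of N Z] N Z by blast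
      qed
    qed auto
    then have "\<F> \<subseteq> U" using U by blast
    then have "- B \<notin> \<F>" using B ultra_Compl[OF uU] by blast
    then obtain Ns where Ns: "\<forall>N\<in>set Ns. ?ok N" "foldr pull Ns (- B) \<notin> W" unfolding \<F>_def by blast
    have "foldr pull Ns (- B) = - foldr pull Ns B"
      using Ns(1) by (induction Ns) (auto simp: pull_Compl ultras_on_def)
    then show ?thesis using Ns ultra_Compl[OF uW] by auto
  qed
  \<comment> \<open>The distribution of a variable block of kind \<open>k0\<close> after
    \<open>s\<close> depends only on \<open>length s\<close>, so \<open>s\<close> has one almost
    sure colour \<open>g s\<close>; this colour in turn is constant on a set of
    \<open>U\<close>.\<close>
  define E where "E s c = {x. f (s @ const_prefix x) = c}" for s c
  have E_ex: "\<exists>c\<in>f ` ?S. E s c \<in> Vf k0 (length s)" if "s \<in> ?S" for s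
    unfolding E_def
  proof (rule ultra_finite_partition[OF uV fin])
    have "const_prefix x \<in> ?S" if "x \<in> varwords (F k0 (length s))" for x
      using that F(3) by (fastforce simp: varwords_def const_prefix_def dest: set_takeWhileD)
    then have "varwords (F k0 (length s)) \<subseteq> {x. f (s @ const_prefix x) \<in> f ` ?S}"
      using \<open>s \<in> ?S\<close> by (intro subsetI CollectI imageI) (simp del: in_lists_conv_set append_in_lists_conv add: append_in_lists_conv)
    moreover have "varwords (F k0 (length s)) \<in> Vf k0 (length s)" using Vf by (simp add: ultras_on_def)
    ultimately show "{x. f (s @ const_prefix x) \<in> f ` ?S} \<in> Vf k0 (length s)"
      using ultra_mono[OF uV] by blast
  qed
  define g where "g s = (SOME c. c \<in> f ` ?S \<and> E s c \<in> Vf k0 (length s))" for s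
  have g: "g s \<in> f ` ?S" "E s (g s) \<in> Vf k0 (length s)" if "s \<in> ?S" for s
    using someI_ex[of "\<lambda>c. c \<in> f ` ?S \<and> E s c \<in> Vf k0 (length s)"] E_ex[OF that]
    unfolding g_def by blast+
  have "{s. g s \<in> f ` ?S} \<in> U" using g(1) by (rule_tac ultra_mono[OF uU SU]) auto
  then obtain c where c: "{s. g s = c} \<in> U"
    using ultra_finite_partition[OF uU fin] by blast
  define A where "A = {s. g s = c} \<inter> ?S"
  \<comment> \<open>The usual refinement for idempotents: each \<open>s \<in> A'\<close> has
    \<open>U\<close>-almost all continuations again in \<open>A'\<close>, not merely in
    \<open>A\<close>.\<close>
  define A' where "A' = {s \<in> A. {t. s @ t \<in> A} \<in> U}"
  have AU: "A \<in> U" unfolding A_def using c SU ultra_Int[OF uU] by blast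
  have inv: "{x. {y. x @ y \<in> B} \<in> U} \<in> U" if "B \<in> U" for B
  proof -
    have "B \<in> U \<odot> U" using that U(2) by simp
    then show ?thesis by (simp add: ubind_def)
  qed
  have "A \<inter> {s. {t. s @ t \<in> A} \<in> U} \<in> U" using AU inv ultra_Int[OF uU] by blast
  then have A'U: "A' \<in> U" unfolding A'_def by (simp add: Int_def)
  have star: "{t. s @ t \<in> A'} \<in> U" if "s \<in> A'" for s
  proof -
    have "{t. s @ t \<in> A} \<in> U" using that A'_def by simp
    then have "{t. s @ t \<in> A} \<inter> {t. {t'. t @ t' \<in> {t. s @ t \<in> A}} \<in> U} \<in> U"
      using inv ultra_Int[OF uU] by blast
    then show ?thesis by (rule ultra_mono[OF uU]) (auto simp: A'_def)
  qed
  have "\<exists>y x r. y \<in> ?S \<and> r \<in> ?S \<and> x \<in> varwords (F k (p + length y)) \<and>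
         (\<forall>s\<in>P. \<forall>a\<in>F k (p + length y). s @ y @ sub a x @ r \<in> A') \<and>
         (k = k0 \<longrightarrow> (\<forall>s\<in>P. f (s @ y @ const_prefix x) = c))"
    if P: "finite P" "P \<subseteq> A'" "\<forall>s\<in>P. length s = p" for P k p
  proof -
    define B where "B = {t. \<forall>s\<in>P. s @ t \<in> A'}"
    have BU: "B \<in> U" unfolding B_def using P star uU by (intro ultra_Collect_ball) auto
    \<comment> \<open>The alphabet after \<open>y\<close> depends on the length of \<open>y\<close>
      alone, so drawing such a block stays in \<open>\<Omega>\<close>. All substitutions of the
      variable word have the distribution \<open>Uf\<close>, so one list \<open>Ns\<close> leads
      back to \<open>B\<close> from every one of them.\<close>
    let ?N = "\<lambda>j. Uf k (p + j)"
    have "ubind U (\<lambda>x. ?N (length x)) \<in> \<Omega>" by (rule \<Omega>_inv[OF UfL U(1)])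
    from recur[OF this BU] obtain Ns where Ns: "\<forall>N\<in>set Ns. ?ok N"
      and "foldr pull Ns B \<in> ubind U (\<lambda>x. ?N (length x))" by blast
    then have "{y. {w. y @ w \<in> foldr pull Ns B} \<in> Uf k (p + length y)} \<in> U" by (simp add: ubind_def)
    then have "{y. {w. y @ w \<in> foldr pull Ns B} \<in> Uf k (p + length y)} \<inter> B \<inter> ?S \<in> U"
      using BU SU ultra_Int[OF uU] by blast
    \<comment> \<open>Membership of \<open>y\<close> in \<open>B\<close> puts \<open>s @ y\<close>
      into \<open>A\<close> for all \<open>s \<in> P\<close>, which determines the colour after the
      constant prefix that follows.\<close>
    then obtain y where y: "{w. y @ w \<in> foldr pull Ns B} \<in> Uf k (p + length y)" "y \<in> B" "y \<in> ?S"
      using ultra_nonempty[OF uU] by blast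
    let ?F = "F k (p + length y)" and ?V = "Vf k (p + length y)"
    have "{x. y @ sub a x \<in> foldr pull Ns B} \<in> ?V" if "a \<in> ?F" for a
    proof -
      have "{w. y @ w \<in> foldr pull Ns B} \<in> umap (sub a) ?V" using y(1) VU[OF that] by simp
      then show ?thesis by (simp add: umap_def vimage_def)
    qed
    then have 1: "{x. \<forall>a\<in>?F. y @ sub a x \<in> foldr pull Ns B} \<in> ?V"
      using F(2) uV by (intro ultra_Collect_ball) auto
    have "{x. k = k0 \<longrightarrow> f (s @ y @ const_prefix x) = c} \<in> ?V" if "s \<in> P" for s
    proof (cases "k = k0")
      case True
      have sy: "s @ y \<in> A" using y(2) that B_def A'_def by auto
      then have "s @ y \<in> ?S" "g (s @ y) = c" unfolding A_def by auto
      then have "E (s @ y) c \<in> Vf k0 (length (s @ y))" using g(2) by metis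
      then show ?thesis using P(3) that True by (simp add: E_def)
    qed (use ultra_UNIV[OF uV] in simp)
    then have 2: "{x. \<forall>s\<in>P. k = k0 \<longrightarrow> f (s @ y @ const_prefix x) = c} \<in> ?V"
      by (intro ultra_Collect_ball uV P(1))
    have 3: "varwords ?F \<in> ?V" using Vf by (simp add: ultras_on_def)
    have "{x. \<forall>a\<in>?F. y @ sub a x \<in> foldr pull Ns B} \<inter>
        {x. \<forall>s\<in>P. k = k0 \<longrightarrow> f (s @ y @ const_prefix x) = c} \<inter> varwords ?F \<in> ?V"
      using 1 2 3 ultra_Int[OF uV] by blast
    then obtain x where x: "\<forall>a\<in>?F. y @ sub a x \<in> foldr pull Ns B"
      "\<forall>s\<in>P. k = k0 \<longrightarrow> f (s @ y @ const_prefix x) = c" "x \<in> varwords ?F"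
      using ultra_nonempty[OF uV] by blast
    \<comment> \<open>The instances \<open>y @ sub a x\<close> differ in letters but not in length,
      so they share a tail.\<close>
    have "\<exists>r\<in>?S. \<forall>w\<in>(\<lambda>a. y @ sub a x) ` ?F. w @ r \<in> B"
      using Ns x(1) F(2) by (intro foldr_pull_common_extension[where p = "length y + length x"]) (auto simp: sub_def)
    then obtain r where "r \<in> ?S" "\<forall>a\<in>?F. y @ sub a x @ r \<in> B" by auto
    then show ?thesis using x y(3) unfolding B_def by (intro exI[of _ y] exI[of _ x] exI[of _ r]) auto
  qed
  moreover have "A' \<noteq> {}" using A'U ultra_nonempty[OF uU] by blast
  moreover have "A' \<subseteq> ?S" unfolding A'_def A_def by auto
  ultimately show ?thesis by (intro exI[of _ c] exI[of _ A']) blast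
qed

section \<open>Parameter matrices\<close>

text \<open>A parameter matrix: even positions are columns, odd positions are rows. Position \<open>lv i\<close> is
  the \<open>i\<close>-th level. A column entry \<open>Own i\<close> says that a row at a level copies its own \<open>i\<close>-th
  parameter there; \<open>Par j i\<close> is the parameter in row \<open>j\<close> and column \<open>i\<close>. Only the entries
  \<open>co s\<close> with \<open>s\<close> even and \<open>ro t s\<close> with \<open>t\<close> odd and \<open>s < t\<close> even are meaningful.\<close>

datatype centry = CC bool | Own nat
datatype rentry = RC bool | Par nat nat

record pmat =
  lv :: "nat \<Rightarrow> nat"
  co :: "nat \<Rightarrow> centry"
  ro :: "nat \<Rightarrow> nat \<Rightarrow> rentry"

definition own :: "nat \<Rightarrow> centry \<Rightarrow> rentry" where
  "own n c = (case c of CC b \<Rightarrow> RC b | Own i \<Rightarrow> Par n i)"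

lemma own_simps [simp]: "own n (CC b) = RC b" "own n (Own i) = Par n i"
  by (auto simp: own_def)

text \<open>A parameter occurs only from its own level onwards. Below level \<open>d\<close> a
  matrix therefore involves only parameters of index less than \<open>d\<close>, which makes
  composition respect initial segments.\<close>

locale valid =
  fixes P :: pmat
  assumes mono: "strict_mono (lv P)"
    and parity: "even (lv P i) \<longleftrightarrow> even i"
    and co_lv: "even i \<Longrightarrow> co P (lv P i) = Own i"
    and co: "even s \<Longrightarrow> co P s = Own i \<Longrightarrow> even i \<and> lv P i \<le> s"
    and ro_lv: "odd n \<Longrightarrow> even s \<Longrightarrow> s < lv P n \<Longrightarrow> ro P (lv P n) s = own n (co P s)"
    and ro: "odd t \<Longrightarrow> even s \<Longrightarrow> s < t \<Longrightarrow> ro P t s = Par j i \<Longrightarrow>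
      odd j \<and> even i \<and> i < j \<and> lv P j \<le> t"

lemmas validI = valid.intro
lemmas valid_parity = valid.parity and valid_co_lv = valid.co_lv and valid_co = valid.co
  and valid_ro_lv = valid.ro_lv and valid_ro = valid.ro

lemma valid_lv_less: "valid P \<Longrightarrow> lv P i < lv P j \<longleftrightarrow> i < j"
  and valid_lv_le: "valid P \<Longrightarrow> lv P i \<le> lv P j \<longleftrightarrow> i \<le> j"
  and valid_lv_eq: "valid P \<Longrightarrow> lv P i = lv P j \<longleftrightarrow> i = j"
  and valid_lv_ge: "valid P \<Longrightarrow> i \<le> lv P i"
  using valid.mono[of P]
  by (simp_all add: strict_mono_less strict_mono_less_eq strict_mono_eq strict_mono_imp_increasing)

definition pcomp :: "pmat \<Rightarrow> pmat \<Rightarrow> pmat" (infixl "\<otimes>" 70) where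
  "W \<otimes> P = \<lparr>lv = lv W \<circ> lv P,
     co = (\<lambda>s. case co W s of CC b \<Rightarrow> CC b | Own i \<Rightarrow> co P i),
     ro = (\<lambda>t s. case ro W t s of RC b \<Rightarrow> RC b | Par j i \<Rightarrow> ro P j i)\<rparr>"

lemma pcomp_sel:
  "lv (W \<otimes> P) i = lv W (lv P i)"
  "co (W \<otimes> P) s = (case co W s of CC b \<Rightarrow> CC b | Own i \<Rightarrow> co P i)"
  "ro (W \<otimes> P) t s = (case ro W t s of RC b \<Rightarrow> RC b | Par j i \<Rightarrow> ro P j i)"
  by (auto simp: pcomp_def)

lemma pcomp_assoc: "(V \<otimes> W) \<otimes> P = V \<otimes> (W \<otimes> P)"
  by (auto simp: pcomp_def fun_eq_iff split: centry.splits rentry.splits)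

lemma valid_comp:
  assumes W: "valid W" and P: "valid P" shows "valid (W \<otimes> P)"
proof (rule validI)
  show "strict_mono (lv (W \<otimes> P))"
    using valid_lv_less[OF W] valid_lv_less[OF P] by (auto simp: strict_mono_def pcomp_sel)
  show "even (lv (W \<otimes> P) i) = even i" for i
    using valid_parity[OF W] valid_parity[OF P] by (simp add: pcomp_sel)
  show "co (W \<otimes> P) (lv (W \<otimes> P) i) = Own i" if "even i" for i
    using that valid_co_lv[OF W] valid_co_lv[OF P] valid_parity[OF P] by (simp add: pcomp_sel)
  show "even i \<and> lv (W \<otimes> P) i \<le> s" if h: "even s" "co (W \<otimes> P) s = Own i" for s i
  proof -
    obtain j where j: "co W s = Own j" "co P j = Own i" using h by (auto simp: pcomp_sel split: centry.splits)
    then have "even j" "lv W j \<le> s" using valid_co[OF W] h by auto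
    moreover have "even i" "lv P i \<le> j" using valid_co[OF P] j \<open>even j\<close> by auto
    ultimately show ?thesis using valid_lv_le[OF W, of "lv P i" j] by (auto simp: pcomp_sel)
  qed
  show "ro (W \<otimes> P) (lv (W \<otimes> P) n) s = own n (co (W \<otimes> P) s)"
    if "odd n" "even s" "s < lv (W \<otimes> P) n" for n s
  proof -
    have *: "ro W (lv W (lv P n)) s = own (lv P n) (co W s)"
      using that valid_ro_lv[OF W] valid_parity[OF P] by (simp add: pcomp_sel)
    show ?thesis
    proof (cases "co W s")
      case (CC b) then show ?thesis using * by (simp add: pcomp_sel)
    next
      case (Own i)
      then have i: "even i" "lv W i \<le> s" using valid_co[OF W] that by auto
      then have "lv W i < lv W (lv P n)" using that by (simp add: pcomp_sel)
      then have "i < lv P n" using valid_lv_less[OF W] by blast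
      then show ?thesis using * Own valid_ro_lv[OF P that(1) i(1)] by (simp add: pcomp_sel)
    qed
  qed
  show "odd j \<and> even i \<and> i < j \<and> lv (W \<otimes> P) j \<le> t"
    if h: "odd t" "even s" "s < t" "ro (W \<otimes> P) t s = Par j i" for t s j i
  proof -
    obtain j' i' where j: "ro W t s = Par j' i'" "ro P j' i' = Par j i"
      using h by (auto simp: pcomp_sel split: rentry.splits)
    then have 1: "odd j'" "even i'" "i' < j'" "lv W j' \<le> t" using valid_ro[OF W] h by blast+
    then have "odd j" "even i" "i < j" "lv P j \<le> j'" using valid_ro[OF P] j by blast+
    then show ?thesis using 1 valid_lv_le[OF W, of "lv P j" j'] by (auto simp: pcomp_sel)
  qed
qed

section \<open>Initial segments and local colourings\<close>

definition agree :: "nat \<Rightarrow> pmat \<Rightarrow> pmat \<Rightarrow> bool" where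
  "agree d P P' \<longleftrightarrow> (\<forall>i\<le>d. lv P i = lv P' i) \<and> (\<forall>s<lv P d. even s \<longrightarrow> co P s = co P' s) \<and>
     (\<forall>t<lv P d. \<forall>s<t. odd t \<longrightarrow> even s \<longrightarrow> ro P t s = ro P' t s)"

lemma agree_refl: "agree d P P" by (simp add: agree_def)

lemma agree_trans: "agree d P P' \<Longrightarrow> agree d P' P'' \<Longrightarrow> agree d P P''" by (simp add: agree_def)

lemma agree_mono:
  assumes "agree n P P'" "d \<le> n" "valid P" shows "agree d P P'"
proof -
  have "lv P d \<le> lv P n" using assms(2) valid_lv_le[OF assms(3)] by simp
  then show ?thesis using assms by (auto simp: agree_def)
qed

text \<open>A parameter of \<open>W\<close> below level \<open>d\<close> of the product has its
  index below \<open>lv P d\<close>, where \<open>P\<close> and \<open>P'\<close> coincide.\<close>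

lemma agree_comp_right:
  assumes W: "valid W" and P: "valid P" and ag: "agree d P P'"
  shows "agree d (W \<otimes> P) (W \<otimes> P')"
  unfolding agree_def
proof (intro conjI allI impI)
  show "lv (W \<otimes> P) i = lv (W \<otimes> P') i" if "i \<le> d" for i using that ag by (simp add: pcomp_sel agree_def)
next
  fix s assume s: "s < lv (W \<otimes> P) d" "even s"
  show "co (W \<otimes> P) s = co (W \<otimes> P') s"
  proof (cases "co W s")
    case (Own i)
    then have i: "even i" "lv W i \<le> s" using valid_co[OF W] s by auto
    then have "lv W i < lv W (lv P d)" using s by (simp add: pcomp_sel)
    then show ?thesis using Own ag i valid_lv_less[OF W] by (simp add: pcomp_sel agree_def)
  qed (simp add: pcomp_sel)
next
  fix t s assume s: "t < lv (W \<otimes> P) d" "s < t" "odd t" "even s"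
  show "ro (W \<otimes> P) t s = ro (W \<otimes> P') t s"
  proof (cases "ro W t s")
    case (Par j i)
    then have i: "odd j" "even i" "i < j" "lv W j \<le> t" using valid_ro[OF W] s by blast+
    then have "lv W j < lv W (lv P d)" using s by (simp add: pcomp_sel)
    then show ?thesis using Par ag i valid_lv_less[OF W] by (simp add: pcomp_sel agree_def)
  qed (simp add: pcomp_sel)
qed

lemma agree_comp_left:
  assumes "agree (lv P d) W W'" "valid P"
  shows "agree d (W \<otimes> P) (W' \<otimes> P)"
proof -
  have "lv P i \<le> lv P d" if "i \<le> d" for i using that valid_lv_le[OF assms(2)] by simp
  then show ?thesis using assms(1) by (simp add: agree_def pcomp_sel)
qed

text \<open>These are the colourings of initial segments with \<open>d\<close> levels: a segment is
  represented by its infinite extensions. The position of level \<open>d\<close> counts, entries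
  from there on do not.\<close>

definition local :: "nat \<Rightarrow> (pmat \<Rightarrow> 'c) \<Rightarrow> bool" where
  "local d \<chi> \<longleftrightarrow> (\<forall>P P'. valid P \<longrightarrow> valid P' \<longrightarrow> agree d P P' \<longrightarrow> \<chi> P = \<chi> P')"

lemma local_comp: "local d \<chi> \<Longrightarrow> valid W \<Longrightarrow> local d (\<lambda>P. \<chi> (W \<otimes> P))"
  unfolding local_def by (simp add: agree_comp_right valid_comp)

text \<open>Level \<open>m\<close> itself is left free, so these are the continuations over which
  the pigeonhole principle ranges.\<close>

definition fixing :: "nat \<Rightarrow> pmat set" where
  "fixing m = {X. valid X \<and> (\<forall>i<m. lv X i = i)}"

lemma fixing_valid: "X \<in> fixing m \<Longrightarrow> valid X" by (simp add: fixing_def)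

lemma fixing_mono: "m \<le> n \<Longrightarrow> fixing n \<subseteq> fixing m" by (auto simp: fixing_def)

lemma fixing_comp: "X \<in> fixing m \<Longrightarrow> Y \<in> fixing m \<Longrightarrow> X \<otimes> Y \<in> fixing m"
  by (auto simp: fixing_def valid_comp pcomp_sel)

lemma fixing_co: "Z \<in> fixing m \<Longrightarrow> i < m \<Longrightarrow> even i \<Longrightarrow> co Z i = Own i"
  using valid_co_lv[of Z i] by (simp add: fixing_def)

lemma fixing_ro: "Z \<in> fixing m \<Longrightarrow> j < m \<Longrightarrow> odd j \<Longrightarrow> even i \<Longrightarrow> i < j \<Longrightarrow> ro Z j i = Par j i"
  using valid_ro_lv[of Z j i] fixing_co[of Z m i] by (simp add: fixing_def)

lemma fixing_lv_ge: assumes "Z \<in> fixing m" shows "m \<le> lv Z m"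
  using assms valid_lv_ge[of Z m] by (simp add: fixing_def)

text \<open>The entries possible below level \<open>m\<close>. Only parameters with index below
  \<open>m\<close> occur there, which provides the finite alphabets.\<close>

definition cents :: "nat \<Rightarrow> centry set" where
  "cents m = range CC \<union> {Own i |i. even i \<and> i < m}"

definition rents :: "nat \<Rightarrow> rentry set" where
  "rents m = range RC \<union> {Par j i |j i. odd j \<and> even i \<and> i < j \<and> j < m}"

lemma finite_cents: "finite (cents m)"
  by (rule finite_subset[of _ "range CC \<union> Own ` {..<m}"]) (auto simp: cents_def)

lemma finite_rents: "finite (rents m)"
proof -
  have "rents m \<subseteq> range RC \<union> (\<lambda>(j, i). Par j i) ` ({..<m} \<times> {..<m})"
  proof
    fix e assume "e \<in> rents m"
    then consider "e \<in> range RC" | j i where "e = Par j i" "i < j" "j < m" by (auto simp: rents_def)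
    then show "e \<in> range RC \<union> (\<lambda>(j, i). Par j i) ` ({..<m} \<times> {..<m})"
    proof cases
      case 2 then show ?thesis by (intro UnI2 image_eqI[of _ _ "(j, i)"]) auto
    qed simp
  qed
  then show ?thesis by (rule finite_subset) simp
qed

lemma co_in_cents:
  assumes "valid Z" "even s" "s < lv Z m" shows "co Z s \<in> cents m"
proof (cases "co Z s")
  case (Own i)
  then have "even i" "lv Z i \<le> s" using valid_co[OF assms(1,2)] by auto
  then have "lv Z i < lv Z m" using assms by simp
  then show ?thesis using Own \<open>even i\<close> valid_lv_less[OF assms(1)] by (simp add: cents_def)
qed (simp add: cents_def)

lemma ro_in_rents:
  assumes "valid Z" "odd t" "even s" "s < t" "t < lv Z m" shows "ro Z t s \<in> rents m"
proof (cases "ro Z t s")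
  case (Par j i)
  then have j: "odd j" "even i" "i < j" "lv Z j \<le> t" using valid_ro[OF assms(1-4)] by auto
  then have "lv Z j < lv Z m" using assms by simp
  then show ?thesis using Par j valid_lv_less[OF assms(1)] by (simp add: rents_def)
qed (simp add: rents_def)

section \<open>Words with infinitely many variables\<close>

definition sub_tokens :: "(nat \<Rightarrow> 'l) \<Rightarrow> ('l option \<times> nat) list \<Rightarrow> 'l list" where
  "sub_tokens a T = map (\<lambda>(l, i). case_option (a i) id l) T"

lemma sub_tokens_append: "sub_tokens a (T @ T') = sub_tokens a T @ sub_tokens a T'"
  by (simp add: sub_tokens_def)

lemma sub_tokens_Some: "sub_tokens a (map (\<lambda>l. (Some l, j)) y) = y"
  by (simp add: sub_tokens_def o_def)

lemma sub_tokens_sub: "sub_tokens a (map (\<lambda>l. (l, j)) x) = sub (a j) x"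
  by (simp add: sub_tokens_def sub_def o_def)

text \<open>An infinite word of constant letters and variables: \<open>tok k\<close> is \<open>None\<close> when position \<open>k\<close> holds
  the variable of block \<open>blk k\<close>, and \<open>q j\<close> is the first occurrence of the \<open>j\<close>-th variable. Between
  \<open>start j\<close> and \<open>q j\<close> only letters are used that may also be substituted for the \<open>j\<close>-th variable.\<close>

theorem homogeneous_variable_word:
  fixes F :: "'k \<Rightarrow> nat \<Rightarrow> 'l set" and f :: "'l list \<Rightarrow> 'c" and K :: "nat \<Rightarrow> 'k"
  assumes F: "\<And>k p. F k p \<noteq> {}" "\<And>k p. finite (F k p)" "\<And>k p. F k p \<subseteq> L"
    and fin: "finite (f ` lists L)"
  shows "\<exists>c tok blk start q.
    (\<forall>k l. tok k = Some l \<longrightarrow> l \<in> L) \<and>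
    strict_mono q \<and> (\<forall>j. tok (q j) = None \<and> blk (q j) = j) \<and>
    (\<forall>k. tok k = None \<longrightarrow> q (blk k) \<le> k) \<and>
    (\<forall>j. start j \<le> q j \<and> (\<forall>k. start j \<le> k \<longrightarrow> k < q j \<longrightarrow> (\<exists>l\<in>F (K j) (start j). tok k = Some l))) \<and>
    (\<forall>j k. tok k = None \<longrightarrow> k < start j \<longrightarrow> blk k < j) \<and>
    (\<forall>j a. K j = k0 \<longrightarrow> (\<forall>i<j. a i \<in> F (K i) (start i)) \<longrightarrow>
       f (map (\<lambda>k. case_option (a (blk k)) id (tok k)) [0..<q j]) = c)"
proof -
  define good where "good c \<A> P k p t \<longleftrightarrow> (case t of (y, x, r) \<Rightarrow>
      y \<in> lists L \<and> r \<in> lists L \<and> x \<in> varwords (F k (p + length y)) \<and>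
      (\<forall>s\<in>P. \<forall>a\<in>F k (p + length y). s @ y @ sub a x @ r \<in> \<A>) \<and>
      (k = k0 \<longrightarrow> (\<forall>s\<in>P. f (s @ y @ const_prefix x) = c)))" for c \<A> P k p t
  have "\<exists>c \<A>. \<A> \<noteq> {} \<and> \<A> \<subseteq> lists L \<and>
      (\<forall>P k p. finite P \<longrightarrow> P \<subseteq> \<A> \<longrightarrow> (\<forall>s\<in>P. length s = p) \<longrightarrow> (\<exists>t. good c \<A> P k p t))"
    using block_extension[of F L f k0, OF F fin] unfolding good_def by simp
  then obtain c \<A> where A: "\<A> \<noteq> {}" "\<A> \<subseteq> lists L" and ex:
    "\<forall>P k p. finite P \<longrightarrow> P \<subseteq> \<A> \<longrightarrow> (\<forall>s\<in>P. length s = p) \<longrightarrow> (\<exists>t. good c \<A> P k p t)"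
    by (elim exE conjE) (rule that)
  define ch where "ch P k p = (SOME t. good c \<A> P k p t)" for P k p
  define Y X R where "Y P k p = fst (ch P k p)" and "X P k p = fst (snd (ch P k p))"
    and "R P k p = snd (snd (ch P k p))" for P k p
  have YXR: "Y P k p \<in> lists L \<and> R P k p \<in> lists L \<and> X P k p \<in> varwords (F k (p + length (Y P k p))) \<and>
         (\<forall>s\<in>P. \<forall>a\<in>F k (p + length (Y P k p)). s @ Y P k p @ sub a (X P k p) @ R P k p \<in> \<A>) \<and>
         (k = k0 \<longrightarrow> (\<forall>s\<in>P. f (s @ Y P k p @ const_prefix (X P k p)) = c))"
    if "finite P" "P \<subseteq> \<A>" "\<forall>s\<in>P. length s = p" for P k p
  proof -
    have "\<exists>t. good c \<A> P k p t" using ex that by simp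
    then have "good c \<A> P k p (ch P k p)" unfolding ch_def by (rule someI_ex)
    moreover have "ch P k p = (Y P k p, X P k p, R P k p)" by (simp add: Y_def X_def R_def)
    ultimately show ?thesis unfolding good_def by simp
  qed
  obtain s0 where s0: "s0 \<in> \<A>" using A by blast
  \<comment> \<open>The state is a word \<open>T\<close> with block numbers together with the set
    \<open>P\<close> of its admissible instances. \<open>P\<close> stays finite, inside
    \<open>\<A>\<close> and of one length, so the next block serves all earlier substitutions at
    once.\<close>
  define step where "step j TP = (case TP of (T, P) \<Rightarrow>
      let p = length T; y = Y P (K j) p; x = X P (K j) p; r = R P (K j) p in
      (T @ map (\<lambda>l. (Some l, j)) y @ map (\<lambda>l. (l, j)) x @ map (\<lambda>l. (Some l, j)) r,
       (\<lambda>(s, a). s @ y @ sub a x @ r) ` (P \<times> F (K j) (p + length y))))" for j TP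
  define st where "st = rec_nat (map (\<lambda>l. (Some l, 0 :: nat)) s0, {s0}) step"
  define T P where "T j = fst (st j)" and "P j = snd (st j)" for j
  define y x r where "y j = Y (P j) (K j) (length (T j))" and "x j = X (P j) (K j) (length (T j))"
    and "r j = R (P j) (K j) (length (T j))" for j
  define start where "start j = length (T j) + length (y j)" for j
  define q where "q j = start j + length (const_prefix (x j))" for j
  have T0: "T 0 = map (\<lambda>l. (Some l, 0)) s0" and P0: "P 0 = {s0}"
    by (simp_all add: T_def P_def st_def)
  have TS: "T (Suc j) = T j @ map (\<lambda>l. (Some l, j)) (y j) @ map (\<lambda>l. (l, j)) (x j) @ map (\<lambda>l. (Some l, j)) (r j)"
    and PS: "P (Suc j) = (\<lambda>(s, a). s @ y j @ sub a (x j) @ r j) ` (P j \<times> F (K j) (start j))" for j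
    by (simp_all add: T_def P_def st_def step_def y_def x_def r_def start_def Let_def case_prod_beta)
  have inv: "finite (P j) \<and> P j \<subseteq> \<A> \<and> (\<forall>s\<in>P j. length s = length (T j))" for j
  proof (induction j)
    case 0 then show ?case using s0 by (simp add: T0 P0)
  next
    case (Suc j)
    then have h: "\<forall>s\<in>P j. \<forall>a\<in>F (K j) (start j). s @ y j @ sub a (x j) @ r j \<in> \<A>"
      using YXR[of "P j" "length (T j)" "K j"] by (simp add: y_def x_def r_def start_def)
    have "finite (P (Suc j))" using Suc F(2) by (simp add: PS)
    moreover have "P (Suc j) \<subseteq> \<A>" using h by (auto simp: PS)
    moreover have "\<forall>s\<in>P (Suc j). length s = length (T (Suc j))" using Suc by (auto simp: PS TS sub_def)
    ultimately show ?case by blast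
  qed
  have yx: "y j \<in> lists L" "r j \<in> lists L" "x j \<in> varwords (F (K j) (start j))"
    and col: "\<And>s. K j = k0 \<Longrightarrow> s \<in> P j \<Longrightarrow> f (s @ y j @ const_prefix (x j)) = c" for j
    using YXR[of "P j" "length (T j)" "K j"] inv[of j] by (simp_all add: y_def x_def r_def start_def)
  have x_split: "\<exists>z. x j = map Some (const_prefix (x j)) @ None # z" for j
  proof -
    have "None \<in> set (x j)" using yx(3) by (simp add: varwords_def)
    then have ne: "dropWhile (\<lambda>l. l \<noteq> None) (x j) \<noteq> []" by auto
    have "map Some (const_prefix (x j)) = takeWhile (\<lambda>l. l \<noteq> None) (x j)"
      unfolding const_prefix_def map_map by (rule map_idI) (auto dest: set_takeWhileD)
    moreover have "dropWhile (\<lambda>l. l \<noteq> None) (x j) = None # tl (dropWhile (\<lambda>l. l \<noteq> None) (x j))"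
      using hd_dropWhile[OF ne] ne by (metis list.collapse)
    ultimately show ?thesis using takeWhile_dropWhile_id[of "\<lambda>l. l \<noteq> None" "x j"] by metis
  qed
  have adm: "sub_tokens a (T j) \<in> P j" if "\<forall>i<j. a i \<in> F (K i) (start i)" for a j
    using that
  proof (induction j)
    case 0 then show ?case by (simp add: T0 P0 sub_tokens_Some)
  next
    case (Suc j)
    then have "sub_tokens a (T j) \<in> P j" "a j \<in> F (K j) (start j)" by auto
    then show ?case unfolding TS PS sub_tokens_append sub_tokens_Some sub_tokens_sub by force
  qed
  have Tlen: "j \<le> length (T j)" for j
  proof (induction j)
    case (Suc j)
    moreover obtain z where "x j = map Some (const_prefix (x j)) @ None # z" using x_split by blast
    then have "1 \<le> length (x j)" by (cases "x j") auto
    ultimately show ?case unfolding TS length_append length_map by linarith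
  qed simp
  have Tpre: "\<exists>T'. T j' = T j @ T'" if "j \<le> j'" for j j'
    using that
  proof (induction j')
    case (Suc j') then show ?case by (cases "j = Suc j'") (auto simp: TS le_Suc_eq)
  qed simp
  have Tnth: "T j' ! k = T j ! k" if "k < length (T j)" "k < length (T j')" for j j' k
    using that Tpre[of j j'] Tpre[of j' j] by (cases "j \<le> j'") (auto simp: nth_append)
  \<comment> \<open>\<open>T (Suc k)\<close> has more than \<open>k\<close> entries and later stages
    only append, so position \<open>k\<close> is settled there.\<close>
  define tk where "tk k = T (Suc k) ! k" for k
  have tk: "tk k = T j ! k" if "k < length (T j)" for j k
    unfolding tk_def using that Tlen[of "Suc k"] by (intro Tnth) auto
  define tok blk where "tok k = fst (tk k)" and "blk k = snd (tk k)" for k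
  have take_tok: "map (\<lambda>k. case_option (a (blk k)) id (tok k)) [0..<n] = sub_tokens a (take n (T j))"
    if "n \<le> length (T j)" for n a j
  proof (rule nth_equalityI)
    show "length (map (\<lambda>k. case_option (a (blk k)) id (tok k)) [0..<n]) = length (sub_tokens a (take n (T j)))"
      using that by (simp add: sub_tokens_def)
    fix i assume "i < length (map (\<lambda>k. case_option (a (blk k)) id (tok k)) [0..<n])"
    then have i: "i < n" by simp
    then have "tk i = T j ! i" using that by (intro tk) simp
    then show "map (\<lambda>k. case_option (a (blk k)) id (tok k)) [0..<n] ! i = sub_tokens a (take n (T j)) ! i"
      using i that by (simp add: sub_tokens_def tok_def blk_def case_prod_beta split: option.splits)
  qed
  have Tblk: "i < j" if "(None, i) \<in> set (T j)" for i j
    using that by (induction j) (auto simp: T0 TS less_Suc_eq)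
  have TL: "l \<in> L" if "(Some l, i) \<in> set (T j)" for l i j
    using that
  proof (induction j)
    case 0 then show ?case using s0 A by (auto simp: T0)
  next
    case (Suc j) then show ?case using yx[of j] F(3)[of "K j" "start j"] by (auto simp: TS varwords_def)
  qed
  have tk_in: "tk k \<in> set (T (Suc k))" for k
    unfolding tk_def using Tlen[of "Suc k"] by (intro nth_mem) simp
  have TSq: "\<exists>z. T (Suc j) = (T j @ map (\<lambda>l. (Some l, j)) (y j)) @ map (\<lambda>l. (Some l, j)) (const_prefix (x j)) @ (None, j) # z" for j
  proof -
    obtain z where "x j = map Some (const_prefix (x j)) @ None # z" using x_split by blast
    then have "map (\<lambda>l. (l, j)) (x j) = map (\<lambda>l. (l, j)) (map Some (const_prefix (x j)) @ None # z)"
      by (rule arg_cong)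
    also have "\<dots> = map (\<lambda>l. (Some l, j)) (const_prefix (x j)) @ (None, j) # map (\<lambda>l. (l, j)) z"
      by (simp add: o_def)
    finally show ?thesis unfolding TS by simp
  qed
  have q_less: "q j < length (T (Suc j))" for j
    using TSq[of j] by (auto simp: q_def start_def)
  have q_nth: "tk (q j) = (None, j)" for j
  proof -
    obtain z where "T (Suc j) = (T j @ map (\<lambda>l. (Some l, j)) (y j)) @ map (\<lambda>l. (Some l, j)) (const_prefix (x j)) @ (None, j) # z"
      using TSq by blast
    then show ?thesis using tk[OF q_less[of j]] by (simp add: nth_append q_def start_def)
  qed
  have takeq: "sub_tokens a (take (q j) (T (Suc j))) = sub_tokens a (T j) @ y j @ const_prefix (x j)" for a j
  proof -
    obtain z where z: "T (Suc j) = (T j @ map (\<lambda>l. (Some l, j)) (y j)) @ map (\<lambda>l. (Some l, j)) (const_prefix (x j)) @ (None, j) # z"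
      using TSq by blast
    then have "take (q j) (T (Suc j)) = T j @ map (\<lambda>l. (Some l, j)) (y j) @ map (\<lambda>l. (Some l, j)) (const_prefix (x j))"
      by (simp add: q_def start_def)
    then show ?thesis by (simp add: sub_tokens_append sub_tokens_Some)
  qed
  have len_q: "length (T j) \<le> start j" "start j \<le> q j" for j by (auto simp: q_def start_def)
  have "tok k = Some l \<Longrightarrow> l \<in> L" for k l
    using TL[of l "blk k" "Suc k"] tk_in[of k] by (simp add: tok_def blk_def prod_eq_iff) (metis prod.collapse)
  moreover have "strict_mono q"
    unfolding strict_mono_Suc_iff using q_less len_q by (meson le_trans less_le_trans)
  moreover have "tok (q j) = None \<and> blk (q j) = j" for j by (simp add: q_nth tok_def blk_def)
  moreover have q_first: "q (blk k) \<le> k" if "tok k = None" for k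
  proof (rule ccontr)
    let ?j = "blk k"
    assume "\<not> q ?j \<le> k"
    then have k: "k < q ?j" by simp
    have e: "tk k = (None, ?j)" using that by (simp add: tok_def blk_def prod_eq_iff)
    show False
    proof (cases "k < length (T ?j)")
      case True
      then have "(None, ?j) \<in> set (T ?j)" using e tk[OF True] by (metis nth_mem)
      then show False using Tblk by blast
    next
      case False
      obtain z where z: "T (Suc ?j) = (T ?j @ map (\<lambda>l. (Some l, ?j)) (y ?j)) @ map (\<lambda>l. (Some l, ?j)) (const_prefix (x ?j)) @ (None, ?j) # z"
        using TSq by blast
      have "tk k = T (Suc ?j) ! k" using k q_less[of ?j] by (intro tk) simp
      then show False using e False k unfolding z
        by (auto simp: nth_append q_def start_def split: if_splits)
    qed
  qed
  moreover have "\<exists>l\<in>F (K j) (start j). tok k = Some l" if "start j \<le> k" "k < q j" for j k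
  proof -
    obtain z where z: "T (Suc j) = (T j @ map (\<lambda>l. (Some l, j)) (y j)) @ map (\<lambda>l. (Some l, j)) (const_prefix (x j)) @ (None, j) # z"
      using TSq by blast
    have *: "k - start j < length (const_prefix (x j))" using that by (simp add: q_def)
    have "tk k = T (Suc j) ! k" using that q_less[of j] by (intro tk) simp
    then have "tok k = Some (const_prefix (x j) ! (k - start j))"
      using that * unfolding z by (auto simp: tok_def nth_append q_def start_def)
    moreover have "set (const_prefix (x j)) \<subseteq> F (K j) (start j)"
      using yx(3)[of j] by (fastforce simp: varwords_def const_prefix_def dest: set_takeWhileD)
    ultimately show ?thesis using nth_mem[OF *] by auto
  qed
  moreover have "blk k < j" if "tok k = None" "k < start j" for j k
  proof (rule ccontr)
    assume "\<not> blk k < j"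
    then have "q j \<le> q (blk k)" using \<open>strict_mono q\<close> by (simp add: strict_mono_less_eq)
    then show False using q_first[OF that(1)] that(2) len_q(2)[of j] by simp
  qed
  moreover have "f (map (\<lambda>k. case_option (a (blk k)) id (tok k)) [0..<q j]) = c"
    if "K j = k0" "\<forall>i<j. a i \<in> F (K i) (start i)" for j a
    using col[OF that(1) adm[OF that(2)]] take_tok[of "q j" "Suc j" a] q_less[of j] takeq[of a j] by simp
  ultimately show ?thesis using len_q(2)
    by (intro exI[of _ c] exI[of _ tok] exI[of _ blk] exI[of _ start] exI[of _ q]) blast
qed

section \<open>The pigeonhole principle\<close>

text \<open>Rows are functions on all positions so that one type of letters serves every length. The
  two alphabets below vary only the row or only the column; rows are cut off at \<open>b\<close> to
  keep the alphabet finite.\<close>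

definition letters :: "nat \<Rightarrow> (centry \<times> (nat \<Rightarrow> rentry)) set" where
  "letters m = {(u, \<rho>). u \<in> cents m \<and> (\<forall>s. \<rho> s \<in> rents m)}"

definition row_letters :: "nat \<Rightarrow> nat \<Rightarrow> (centry \<times> (nat \<Rightarrow> rentry)) set" where
  "row_letters m b = {CC False} \<times> {\<rho>. (\<forall>s. \<rho> s \<in> rents m) \<and> (\<forall>s\<ge>b. \<rho> s = RC False)}"

definition column_letters :: "nat \<Rightarrow> (centry \<times> (nat \<Rightarrow> rentry)) set" where
  "column_letters m = cents m \<times> {\<lambda>_. RC False}"

lemma RC_in_rents [simp]: "RC b \<in> rents m" and CC_in_cents [simp]: "CC b \<in> cents m"
  by (auto simp: rents_def cents_def)

lemma Own_in_cents: "Own i \<in> cents m \<longleftrightarrow> even i \<and> i < m"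
  and Par_in_rents: "Par j i \<in> rents m \<longleftrightarrow> odd j \<and> even i \<and> i < j \<and> j < m"
  by (auto simp: rents_def cents_def)

lemma finite_row_letters: "finite (row_letters m b)"
proof -
  have "{\<rho>. (\<forall>s. \<rho> s \<in> rents m) \<and> (\<forall>s\<ge>b. \<rho> s = RC False)} \<subseteq>
      {\<rho>. \<forall>s. (s \<in> {..<b} \<longrightarrow> \<rho> s \<in> rents m) \<and> (s \<notin> {..<b} \<longrightarrow> \<rho> s = RC False)}" by auto
  moreover have "finite {\<rho>. \<forall>s. (s \<in> {..<b} \<longrightarrow> \<rho> s \<in> rents m) \<and> (s \<notin> {..<b} \<longrightarrow> \<rho> s = RC False)}"
    by (rule finite_set_of_finite_funs) (auto simp: finite_rents)
  ultimately show ?thesis unfolding row_letters_def by (auto intro: finite_subset)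
qed

lemma finite_column_letters: "finite (column_letters m)"
  by (simp add: column_letters_def finite_cents)

section \<open>Finite words as parameter matrices\<close>

definition word_co :: "nat \<Rightarrow> (centry \<times> (nat \<Rightarrow> rentry)) list \<Rightarrow> nat \<Rightarrow> centry" where
  "word_co m w s = (if s < m then Own s else if s < m + 2 * length w then fst (w ! ((s - m) div 2))
     else Own (s - 2 * length w))"

text \<open>The canonical completion of a word: positions before and after it are all levels, none
  lies inside. Level \<open>m\<close> comes right after the word, so a local colouring of matrices
  becomes a colouring of words.\<close>

definition word_pmat :: "nat \<Rightarrow> (centry \<times> (nat \<Rightarrow> rentry)) list \<Rightarrow> pmat" where
  "word_pmat m w = \<lparr>lv = (\<lambda>i. if i < m then i else i + 2 * length w), co = word_co m w,
     ro = (\<lambda>t s. if t < m then Par t s else if t < m + 2 * length w then snd (w ! ((t - m) div 2)) s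
       else own (t - 2 * length w) (word_co m w s))\<rparr>"

lemma letters_nth:
  assumes "w \<in> lists (letters m)" "m \<le> s" "s < m + 2 * length w"
  shows "fst (w ! ((s - m) div 2)) \<in> cents m" "snd (w ! ((s - m) div 2)) t \<in> rents m"
proof -
  have "(s - m) div 2 < length w" using assms by auto
  then have "w ! ((s - m) div 2) \<in> letters m" using assms(1) by auto
  then show "fst (w ! ((s - m) div 2)) \<in> cents m" "snd (w ! ((s - m) div 2)) t \<in> rents m"
    by (auto simp: letters_def)
qed

lemma word_co_Own:
  assumes w: "w \<in> lists (letters m)" and s: "even s" "word_co m w s = Own i"
  shows "even i \<and> lv (word_pmat m w) i \<le> s"
proof -
  consider "s < m" | "m \<le> s" "s < m + 2 * length w" | "m + 2 * length w \<le> s" by linarith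
  then show ?thesis
  proof cases
    case 2
    then have "Own i \<in> cents m" using letters_nth(1)[OF w 2] s by (simp add: word_co_def)
    then show ?thesis using 2 by (simp add: Own_in_cents word_pmat_def)
  qed (use s in \<open>auto simp: word_co_def word_pmat_def\<close>)
qed

lemma valid_word_pmat:
  assumes w: "w \<in> lists (letters m)" shows "valid (word_pmat m w)"
proof (rule validI)
  let ?P = "word_pmat m w"
  show "strict_mono (lv ?P)" by (auto simp: strict_mono_def word_pmat_def)
  show "even (lv ?P i) \<longleftrightarrow> even i" for i by (simp add: word_pmat_def)
  show "co ?P (lv ?P i) = Own i" if "even i" for i using that by (auto simp: word_pmat_def word_co_def)
  show "even i \<and> lv ?P i \<le> s" if "even s" "co ?P s = Own i" for s i
    using word_co_Own[OF w that(1)] that(2) by (simp add: word_pmat_def)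
  show "ro ?P (lv ?P n) s = own n (co ?P s)" if "odd n" "even s" "s < lv ?P n" for n s
    using that by (auto simp: word_pmat_def word_co_def)
  show "odd j \<and> even i \<and> i < j \<and> lv ?P j \<le> t"
    if h: "odd t" "even s" "s < t" "ro ?P t s = Par j i" for t s j i
  proof -
    consider "t < m" | "m \<le> t" "t < m + 2 * length w" | "m + 2 * length w \<le> t" by linarith
    then show ?thesis
    proof cases
      case 1 then show ?thesis using h by (auto simp: word_pmat_def)
    next
      case 2
      then have "Par j i \<in> rents m" using letters_nth(2)[OF w 2, of s] h by (simp add: word_pmat_def)
      then show ?thesis using 2 by (simp add: Par_in_rents word_pmat_def)
    next
      case 3
      then have "own (t - 2 * length w) (word_co m w s) = Par j i" using h by (simp add: word_pmat_def)
      then have c: "word_co m w s = Own i" "j = t - 2 * length w" by (cases "word_co m w s"; simp)+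
      then have i: "even i" "lv ?P i \<le> s" using word_co_Own[OF w h(2)] by auto
      then have "i < j" using 3 c h by (auto simp: word_pmat_def split: if_splits)
      then show ?thesis using 3 c h i by (auto simp: word_pmat_def)
    qed
  qed
qed

text \<open>Letter \<open>k\<close> of a word occupies the positions \<open>m + 2 k\<close> and
  \<open>m + 2 k + 1\<close>, one column and one row. A row level is placed at the first variable of a block of
  \<open>row_letters\<close>; as all their columns are \<open>CC False\<close>, its row continues every parameter row by \<open>RC False\<close>.\<close>

theorem pigeonhole:
  fixes \<chi> :: "pmat \<Rightarrow> 'c"
  assumes loc: "local m \<chi>" and fin: "finite (\<chi> ` Collect valid)"
  shows "\<exists>X\<in>fixing m. \<exists>c. \<forall>Z\<in>fixing m. \<chi> (X \<otimes> Z) = c"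
proof -
  let ?L = "letters m"
  define F where "F k p = (if k then row_letters m (m + 2 * p) else column_letters m)" for k p
  \<comment> \<open>Level \<open>m + j\<close> is a row iff \<open>m + j\<close> is odd. Colours are
    tested at blocks of kind \<open>odd m\<close>, that is for even \<open>j\<close>, because the
    position of level \<open>m\<close> of any \<open>Z\<close> has the parity of
    \<open>m\<close>.\<close>
  define K where "K j = odd (m + j)" for j
  define f where "f w = \<chi> (word_pmat m w)" for w
  have F1: "F k p \<noteq> {}" for k p
  proof -
    have "(CC False, \<lambda>_. RC False) \<in> F k p" by (simp add: F_def row_letters_def column_letters_def)
    then show ?thesis by blast
  qed
  have F2: "finite (F k p)" for k p
    by (simp add: F_def finite_row_letters finite_column_letters)
  have F3: "F k p \<subseteq> ?L" for k p
    by (auto simp: F_def row_letters_def column_letters_def letters_def)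
  have "f ` lists ?L \<subseteq> \<chi> ` Collect valid" unfolding f_def using valid_word_pmat by blast
  then have "finite (f ` lists ?L)" using fin finite_subset by blast
  from homogeneous_variable_word[of F ?L f K "odd m", OF F1 F2 F3 this]
  obtain c tok blk start q where
    tokL: "\<forall>k l. tok k = Some l \<longrightarrow> l \<in> ?L" and q: "strict_mono q"
    and tokq: "\<forall>j. tok (q j) = None \<and> blk (q j) = j"
    and first: "\<forall>k. tok k = None \<longrightarrow> q (blk k) \<le> k"
    and gap: "\<forall>j. start j \<le> q j \<and> (\<forall>k. start j \<le> k \<longrightarrow> k < q j \<longrightarrow> (\<exists>l\<in>F (K j) (start j). tok k = Some l))"
    and before: "\<forall>j k. tok k = None \<longrightarrow> k < start j \<longrightarrow> blk k < j"
    and hom: "\<forall>j a. K j = odd m \<longrightarrow> (\<forall>i<j. a i \<in> F (K i) (start i)) \<longrightarrow>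
       f (map (\<lambda>k. case_option (a (blk k)) id (tok k)) [0..<q j]) = c"
    by (elim exE conjE) (rule that)
  define ix where "ix t = (t - m) div 2" for t
  \<comment> \<open>Each letter covers two positions; the summand \<open>(i - m) mod 2\<close>
    selects the one with the parity of the level.\<close>
  define xl where "xl i = (if i < m then i else m + 2 * q (i - m) + (i - m) mod 2)" for i
  define xc where "xc s = (if s < m then Own s else case tok (ix s) of Some l \<Rightarrow> fst l
      | None \<Rightarrow> if K (blk (ix s)) then CC False else Own (m + blk (ix s)))" for s
  \<comment> \<open>The new row copies columns only up to \<open>start\<close>, where the alphabet
    of its block was fixed. From there to the level all columns are \<open>CC False\<close>, so the
    default \<open>RC False\<close> is just what validity demands.\<close>
  define xr where "xr t s = (if t < m then Par t s else case tok (ix t) of Some l \<Rightarrow> snd l s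
      | None \<Rightarrow> if K (blk (ix t)) \<and> s < m + 2 * start (blk (ix t)) then own (m + blk (ix t)) (xc s)
          else RC False)" for t s
  define X where "X = \<lparr>lv = xl, co = xc, ro = xr\<rparr>"
  have X_sel: "lv X = xl" "co X = xc" "ro X = xr" by (simp_all add: X_def)
  have xl_m: "xl (m + j) = m + 2 * q j + j mod 2" for j by (simp add: xl_def)
  have ix_xl: "ix (xl (m + j)) = q j" for j by (simp add: ix_def xl_m)
  have xl_less: "xl i = i" if "i < m" for i using that by (simp add: xl_def)
  have pos_split: "t = m + 2 * ix t + (t - m) mod 2" if "m \<le> t" for t
    using that by (simp add: ix_def)
  have xl_le: "xl (m + blk (ix t)) \<le> t" if "m \<le> t" "tok (ix t) = None" "even (m + blk (ix t)) = even t" for t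
  proof -
    have "even (t - m) = even (blk (ix t))" using that by auto
    then have "(t - m) mod 2 = blk (ix t) mod 2" by (simp add: mod2_eq_if)
    moreover have "q (blk (ix t)) \<le> ix t" using first that by blast
    ultimately show ?thesis using pos_split[OF that(1)] unfolding xl_m by linarith
  qed
  have tok_letters: "fst l \<in> cents m \<and> snd l s \<in> rents m" if "tok k = Some l" for k l s
    using tokL that by (cases l) (auto simp: letters_def)
  have xc_Own: "even i \<and> xl i \<le> s" if "even s" "xc s = Own i" for s i
  proof (cases "s < m")
    case True then show ?thesis using that by (simp add: xc_def xl_less)
  next
    case False
    show ?thesis
    proof (cases "tok (ix s)")
      case None
      then have "\<not> K (blk (ix s))" "i = m + blk (ix s)" using that False by (auto simp: xc_def split: if_splits)
      then show ?thesis using xl_le[of s] None False that by (simp add: K_def)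
    next
      case (Some l)
      then have "Own i \<in> cents m" using tok_letters[OF Some] that False by (simp add: xc_def)
      then show ?thesis using False by (simp add: Own_in_cents xl_less)
    qed
  qed
  have xc_before: "i < m + j" if "s < m + 2 * start j" "xc s = Own i" for s i j
  proof (cases "s < m")
    case True then show ?thesis using that by (simp add: xc_def)
  next
    case False
    then have "ix s < start j" using that by (auto simp: ix_def)
    show ?thesis
    proof (cases "tok (ix s)")
      case None
      then have "i = m + blk (ix s)" using that False by (auto simp: xc_def split: if_splits)
      then show ?thesis using before None \<open>ix s < start j\<close> by simp
    next
      case (Some l)
      then have "Own i \<in> cents m" using tok_letters[OF Some] that False by (simp add: xc_def)
      then show ?thesis by (simp add: Own_in_cents)
    qed
  qed
  have valX: "valid X"
  proof (rule validI, unfold X_sel)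
    have "xl i < xl (Suc i)" for i
    proof -
      consider "Suc i < m" | "Suc i = m" | j where "i = m + j" by (metis le_Suc_ex less_Suc_eq not_less_eq linorder_not_less)
      then show ?thesis
      proof cases
        case 3
        have "q j < q (Suc j)" using q by (simp add: strict_mono_less)
        then have "2 * q j + j mod 2 < 2 * q (Suc j) + Suc j mod 2" by linarith
        then show ?thesis using xl_m[of j] xl_m[of "Suc j"] 3 by simp
      qed (auto simp: xl_def)
    qed
    then show "strict_mono xl" by (simp add: strict_mono_Suc_iff)
    show "even (xl i) \<longleftrightarrow> even i" for i
    proof (cases "i < m")
      case False
      then obtain j where j: "i = m + j" using le_Suc_ex not_less by blast
      have "even (m + 2 * x + j mod 2) \<longleftrightarrow> even (m + j)" for x by presburger
      then show ?thesis unfolding j xl_m .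
    qed (simp add: xl_less)
    show "xc (xl i) = Own i" if "even i" for i
    proof (cases "i < m")
      case False
      then obtain j where j: "i = m + j" using le_Suc_ex not_less by blast
      then have "\<not> K j" using that by (simp add: K_def)
      moreover have "\<not> xl i < m" using xl_m j by simp
      ultimately show ?thesis using j ix_xl[of j] tokq by (simp add: xc_def)
    qed (simp add: xl_less xc_def)
    show "even i \<and> xl i \<le> s" if "even s" "xc s = Own i" for s i using xc_Own[OF that] .
    show "xr (xl n) s = own n (xc s)" if "odd n" "even s" "s < xl n" for n s
    proof (cases "n < m")
      case True then show ?thesis using that by (simp add: xl_less xr_def xc_def)
    next
      case False
      then obtain j where j: "n = m + j" using le_Suc_ex not_less by blast
      then have Kj: "K j" using that by (simp add: K_def)
      have "\<not> xl n < m" using xl_m j by simp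
      then have e: "xr (xl n) s = (if s < m + 2 * start j then own n (xc s) else RC False)"
        using j ix_xl[of j] tokq Kj by (simp add: xr_def)
      show ?thesis
      proof (cases "s < m + 2 * start j")
        case True then show ?thesis using e by simp
      next
        case sF: False
        then have ms: "m \<le> s" "start j \<le> ix s" by (auto simp: ix_def)
        have "ix s \<le> q j" 
          using that(3) pos_split[OF ms(1)] mod_less_divisor[of 2 j] unfolding j xl_m by linarith
        then consider "ix s = q j" | "ix s < q j" by linarith
        then have "xc s = CC False"
        proof cases
          case 1 then show ?thesis using tokq Kj ms by (simp add: xc_def)
        next
          case 2
          then obtain l where "l \<in> F (K j) (start j)" "tok (ix s) = Some l" using gap ms by blast
          then show ?thesis using Kj ms by (auto simp: xc_def F_def row_letters_def)
        qed
        then show ?thesis using e sF by simp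
      qed
    qed
    show "odd j \<and> even i \<and> i < j \<and> xl j \<le> t"
      if h: "odd t" "even s" "s < t" "xr t s = Par j i" for t s j i
    proof (cases "t < m")
      case True then show ?thesis using h by (simp add: xr_def xl_less)
    next
      case False
      show ?thesis
      proof (cases "tok (ix t)")
        case None
        let ?b = "blk (ix t)"
        have b: "K ?b" "s < m + 2 * start ?b" "own (m + ?b) (xc s) = Par j i"
          using h False None by (auto simp: xr_def split: if_splits)
        then have j: "j = m + ?b" and i: "xc s = Own i" by (cases "xc s"; simp)+
        have "odd j" using b j by (simp add: K_def)
        moreover have "xl j \<le> t" unfolding j using False None h \<open>odd j\<close> j by (intro xl_le) auto
        ultimately show ?thesis using xc_Own[OF h(2) i] xc_before[OF b(2) i] j by simp
      next
        case (Some l)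
        then have "Par j i \<in> rents m" using tok_letters[OF Some, of s] h False by (simp add: xr_def)
        then show ?thesis using False by (simp add: Par_in_rents xl_less)
      qed
    qed
  qed
  then have XN: "X \<in> fixing m" by (simp add: fixing_def X_sel xl_less)
  moreover have "\<chi> (X \<otimes> Z) = c" if Z: "Z \<in> fixing m" for Z
  proof -
    have vZ: "valid Z" using Z fixing_valid by blast
    obtain n where n: "lv Z m = m + n" using fixing_lv_ge[OF Z] le_Suc_ex by blast
    have en: "even n" using valid_parity[OF vZ, of m] n by auto
    \<comment> \<open>The substitution that produces the initial segment of
      \<open>X \<otimes> Z\<close>: a row letter is the row \<open>m + j\<close> of \<open>Z\<close>
      read through the columns of \<open>X\<close>. At odd \<open>s\<close> and beyond the start the
      value \<open>RC False\<close> keeps it in \<open>row_letters\<close>.\<close>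
    define a where "a j = (if K j then (CC False, \<lambda>s. if s < m + 2 * start j \<and> even s
        then case xc s of CC b \<Rightarrow> RC b | Own i \<Rightarrow> ro Z (m + j) i else RC False)
      else (co Z (m + j), \<lambda>_. RC False))" for j
    have aF: "a j \<in> F (K j) (start j)" if "j < n" for j
    proof (cases "K j")
      case True
      have "(if s < m + 2 * start j \<and> even s
        then case xc s of CC b \<Rightarrow> RC b | Own i \<Rightarrow> ro Z (m + j) i else RC False) \<in> rents m" for s
      proof (cases "s < m + 2 * start j \<and> even s")
        case s: True
        show ?thesis
        proof (cases "xc s")
          case (Own i)
          then have "even i" "i < m + j" using xc_Own xc_before s by blast+
          then have "ro Z (m + j) i \<in> rents m"
            using True that n by (intro ro_in_rents[OF vZ]) (auto simp: K_def)
          then show ?thesis using s Own by simp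
        qed (use s in simp)
      qed (use RC_in_rents in auto)
      then show ?thesis using True by (auto simp: F_def a_def row_letters_def)
    next
      case False
      then have "co Z (m + j) \<in> cents m" using that n by (intro co_in_cents[OF vZ]) (auto simp: K_def)
      then show ?thesis using False by (simp add: F_def a_def column_letters_def)
    qed
    define w where "w = map (\<lambda>k. case_option (a (blk k)) id (tok k)) [0..<q n]"
    have fw: "f w = c" unfolding w_def using hom aF en by (simp add: K_def)
    have lw: "length w = q n" by (simp add: w_def)
    have blk_n: "blk k < n" if "k < q n" "tok k = None" for k
    proof -
      have "q (blk k) < q n" using first that by (meson le_less_trans)
      then show ?thesis using q by (simp add: strict_mono_less)
    qed
    have wn: "w ! k = case_option (a (blk k)) id (tok k)" if "k < q n" for k
      using that by (simp add: w_def split: option.splits)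
    have "w ! k \<in> ?L" if "k < q n" for k
    proof (cases "tok k")
      case None
      then show ?thesis using wn[OF that] aF[OF blk_n[OF that None]] F3 by auto
    qed (use wn[OF that] tokL in auto)
    then have wL: "w \<in> lists ?L" using lw by (metis in_listsI in_set_conv_nth)
    have xln: "xl (m + n) = m + 2 * q n" using en by (simp add: xl_m)
    have ag: "agree m (X \<otimes> Z) (word_pmat m w)"
      unfolding agree_def
    proof (intro conjI allI impI)
      fix i assume "i \<le> m"
      then consider "i < m" | "i = m" by linarith
      then show "lv (X \<otimes> Z) i = lv (word_pmat m w) i"
      proof cases
        case 1 then show ?thesis using Z by (simp add: pcomp_sel X_sel word_pmat_def fixing_def xl_less)
      next
        case 2 then show ?thesis using n xln lw by (simp add: pcomp_sel X_sel word_pmat_def)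
      qed
    next
      fix s assume s: "s < lv (X \<otimes> Z) m" "even s"
      then have sq: "s < m + 2 * q n" using n xln by (simp add: pcomp_sel X_sel)
      show "co (X \<otimes> Z) s = co (word_pmat m w) s"
      proof (cases "s < m")
        case True
        then show ?thesis using s fixing_co[OF Z] by (simp add: pcomp_sel X_sel xc_def word_pmat_def word_co_def)
      next
        case False
        then have k: "ix s < q n" using sq by (auto simp: ix_def)
        have R: "co (word_pmat m w) s = fst (w ! ix s)"
          using False sq lw by (simp add: word_pmat_def word_co_def ix_def)
        show ?thesis
        proof (cases "tok (ix s)")
          case None
          then show ?thesis using False R wn[OF k] by (simp add: pcomp_sel X_sel xc_def a_def)
        next
          case (Some l)
          then have l: "fst l \<in> cents m" using tok_letters by blast
          have "co (X \<otimes> Z) s = (case fst l of CC b \<Rightarrow> CC b | Own i \<Rightarrow> co Z i)"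
            using False Some by (simp add: pcomp_sel X_sel xc_def)
          also have "\<dots> = fst l" using l fixing_co[OF Z] by (cases "fst l") (auto simp: Own_in_cents)
          finally show ?thesis using R wn[OF k] Some by simp
        qed
      qed
    next
      fix t s assume t: "t < lv (X \<otimes> Z) m" "s < t" "odd t" "even s"
      then have tq: "t < m + 2 * q n" using n xln by (simp add: pcomp_sel X_sel)
      show "ro (X \<otimes> Z) t s = ro (word_pmat m w) t s"
      proof (cases "t < m")
        case True
        then show ?thesis using t fixing_ro[OF Z] by (simp add: pcomp_sel X_sel xr_def word_pmat_def)
      next
        case False
        then have k: "ix t < q n" using tq by (auto simp: ix_def)
        have R: "ro (word_pmat m w) t s = snd (w ! ix t) s"
          using False tq lw by (simp add: word_pmat_def ix_def)
        show ?thesis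
        proof (cases "tok (ix t)")
          case None
          then show ?thesis using False R wn[OF k] t
            by (cases "xc s") (auto simp: pcomp_sel X_sel xr_def a_def)
        next
          case (Some l)
          then have l: "snd l s \<in> rents m" using tok_letters by blast
          have "ro (X \<otimes> Z) t s = (case snd l s of RC b \<Rightarrow> RC b | Par j i \<Rightarrow> ro Z j i)"
            using False Some by (simp add: pcomp_sel X_sel xr_def)
          also have "\<dots> = snd l s" using l fixing_ro[OF Z] by (cases "snd l s") (auto simp: Par_in_rents)
          finally show ?thesis using R wn[OF k] Some by simp
        qed
      qed
    qed
    have "\<chi> (X \<otimes> Z) = \<chi> (word_pmat m w)"
      using loc valid_comp[OF valX vZ] valid_word_pmat[OF wL] ag by (simp add: local_def)
    then show ?thesis using fw by (simp add: f_def)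
  qed
  ultimately show ?thesis by blast
qed

section \<open>Ramsey theorem for parameter matrices\<close>

definition trunc_co :: "nat \<Rightarrow> pmat \<Rightarrow> nat \<Rightarrow> centry" where
  "trunc_co d P s = (if odd s then CC False else if s < lv P d then co P s else Own (s - lv P d + d))"

text \<open>The canonical representative of an initial segment: from level \<open>d\<close> on,
  every position is a level. Meaningless entries get fixed values, so that agreeing matrices have
  equal truncations.\<close>

definition trunc :: "nat \<Rightarrow> pmat \<Rightarrow> pmat" where
  "trunc d P = \<lparr>lv = (\<lambda>i. if i \<le> d then lv P i else lv P d + (i - d)),
     co = trunc_co d P,
     ro = (\<lambda>t s. if even t \<or> odd s \<or> t \<le> s then RC False else if t < lv P d then ro P t s
        else own (t - lv P d + d) (trunc_co d P s))\<rparr>"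

definition tail_co :: "nat \<Rightarrow> pmat \<Rightarrow> nat \<Rightarrow> centry" where
  "tail_co d P s = (if s \<le> lv P d then Own s else
     case co P s of CC b \<Rightarrow> CC b | Own i \<Rightarrow> Own (lv (trunc d P) i))"

text \<open>The left cofactor of the truncation: parameter \<open>i\<close> of \<open>P\<close> is
  renamed to the position that level \<open>i\<close> has in \<open>trunc d P\<close>.\<close>

definition tail :: "nat \<Rightarrow> pmat \<Rightarrow> pmat" where
  "tail d P = \<lparr>lv = (\<lambda>i. if i \<le> lv P d then i else lv P (i - lv P d + d)),
     co = tail_co d P,
     ro = (\<lambda>t s. if t \<le> lv P d then Par t s
        else if t \<in> range (lv P) then own (lv (trunc d P) (inv (lv P) t)) (tail_co d P s)
        else case ro P t s of RC b \<Rightarrow> RC b | Par j i \<Rightarrow> Par (lv (trunc d P) j) (lv (trunc d P) i))\<rparr>"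

lemma trunc_cong:
  assumes "agree d P P'" shows "trunc d P = trunc d P'"
proof -
  have lv: "lv P i = lv P' i" if "i \<le> d" for i using assms that by (simp add: agree_def)
  have "trunc_co d P s = trunc_co d P' s" for s
    using assms lv[of d] by (auto simp: trunc_co_def agree_def)
  then have co: "trunc_co d P = trunc_co d P'" by blast
  have ro: "ro P t s = ro P' t s" if "t < lv P d" "odd t" "even s" "s < t" for t s
    using assms that by (simp add: agree_def)
  have l: "(\<lambda>i. if i \<le> d then lv P i else lv P d + (i - d)) = (\<lambda>i. if i \<le> d then lv P' i else lv P' d + (i - d))"
    using lv by auto
  have r: "(\<lambda>t s. if even t \<or> odd s \<or> t \<le> s then RC False else if t < lv P d then ro P t s
        else own (t - lv P d + d) (trunc_co d P s)) =
      (\<lambda>t s. if even t \<or> odd s \<or> t \<le> s then RC False else if t < lv P' d then ro P' t s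
        else own (t - lv P' d + d) (trunc_co d P' s))"
    using ro lv[of d] co by (intro ext) auto
  show ?thesis unfolding trunc_def l r using co by simp
qed

lemma trunc_lv:
  "lv (trunc d P) i = (if i \<le> d then lv P i else lv P d + (i - d))"
  by (simp add: trunc_def)

lemma trunc_lv_add: "lv (trunc d P) (d + k) = lv P d + k"
  by (simp add: trunc_lv)

lemma trunc_agree: "agree d (trunc d P) P"
  by (auto simp: agree_def trunc_def trunc_co_def)

lemma trunc_lv_mono: assumes "valid P" "i < j" shows "lv (trunc d P) i < lv (trunc d P) j"
proof -
  have "lv P i < lv P j" "i \<le> d \<Longrightarrow> lv P i \<le> lv P d" using assms by (auto simp: valid_lv_less valid_lv_le)
  then show ?thesis using assms by (auto simp: trunc_lv)
qed

lemma trunc_parity: assumes "valid P" shows "even (lv (trunc d P) i) \<longleftrightarrow> even i"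
  using valid_parity[OF assms] by (auto simp: trunc_lv)

lemma trunc_co_Own:
  assumes P: "valid P" and s: "trunc_co d P s = Own i"
  shows "even i \<and> lv (trunc d P) i \<le> s"
proof (cases "s < lv P d")
  case True
  then have "even i" "lv P i \<le> s" using s valid_co[OF P, of s i] by (auto simp: trunc_co_def split: if_splits)
  moreover from this have "i \<le> d" using True valid_lv_less[OF P, of i d] by simp
  ultimately show ?thesis by (simp add: trunc_lv)
next
  case False
  then obtain k where k: "s = lv P d + k" using le_Suc_ex not_less by blast
  then have "even s" "i = d + k" using s by (auto simp: trunc_co_def split: if_splits)
  then show ?thesis using k valid_parity[OF P, of d] by (simp add: trunc_lv_add)
qed

lemma valid_trunc: assumes P: "valid P" shows "valid (trunc d P)"
proof (rule validI)
  let ?Q = "trunc d P"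
  have Q_co: "co ?Q = trunc_co d P" by (simp add: trunc_def)
  show "strict_mono (lv ?Q)" using trunc_lv_mono[OF P] by (simp add: strict_mono_def)
  show "even (lv ?Q i) \<longleftrightarrow> even i" for i by (rule trunc_parity[OF P])
  show "co ?Q (lv ?Q i) = Own i" if "even i" for i
  proof (cases "i < d")
    case True
    then show ?thesis using that valid_lv_less[OF P, of i d] valid_parity[OF P, of i] valid_co_lv[OF P that]
      by (simp add: Q_co trunc_co_def trunc_lv)
  next
    case False
    then obtain k where k: "i = d + k" using le_Suc_ex not_less by blast
    have "even (lv ?Q i)" using that trunc_parity[OF P] by blast
    then show ?thesis using k trunc_lv_add[of d P k] by (simp add: Q_co trunc_co_def)
  qed
  show "even i \<and> lv ?Q i \<le> s" if "even s" "co ?Q s = Own i" for s i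
    using trunc_co_Own[OF P] that Q_co by simp
  show "ro ?Q (lv ?Q n) s = own n (co ?Q s)" if "odd n" "even s" "s < lv ?Q n" for n s
  proof (cases "n < d")
    case True
    then have "lv P n < lv P d" using valid_lv_less[OF P] by simp
    then show ?thesis using True that valid_ro_lv[OF P that(1,2)] valid_parity[OF P, of n]
      by (simp add: trunc_def trunc_co_def)
  next
    case False
    then obtain k where k: "n = d + k" using le_Suc_ex not_less by blast
    have n: "odd (lv ?Q n)" using that trunc_parity[OF P, of d n] by simp
    have n': "lv ?Q n = lv P d + k" unfolding k by (rule trunc_lv_add)
    have "ro ?Q t s = own (t - lv P d + d) (co ?Q s)" if "odd t" "s < t" "lv P d \<le> t" for t
      using that \<open>even s\<close> by (simp add: trunc_def)
    from this[of "lv ?Q n"] show ?thesis using that n n' k by (simp add: add.commute)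
  qed
  show "odd j \<and> even i \<and> i < j \<and> lv ?Q j \<le> t"
    if h: "odd t" "even s" "s < t" "ro ?Q t s = Par j i" for t s j i
  proof (cases "t < lv P d")
    case True
    then have "ro P t s = Par j i" using h by (simp add: trunc_def)
    then have j: "odd j" "even i" "i < j" "lv P j \<le> t" using valid_ro[OF P h(1-3)] by auto
    then have "j < d" using True valid_lv_less[OF P, of j d] by simp
    then show ?thesis using j by (simp add: trunc_lv)
  next
    case False
    then have "own (t - lv P d + d) (trunc_co d P s) = Par j i" using h by (simp add: trunc_def)
    then have c: "trunc_co d P s = Own i" "j = t - lv P d + d" by (cases "trunc_co d P s"; simp)+
    obtain k where "t = lv P d + k" using False le_Suc_ex not_less by blast
    then have lvj: "lv ?Q j = t" using c trunc_lv_add[of d P k] by (simp add: add.commute)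
    then have "odd j" using h trunc_parity[OF P, of d j] by simp
    have i: "even i" "lv ?Q i \<le> s" using trunc_co_Own[OF P c(1)] by auto
    have "i < j"
    proof (rule ccontr)
      assume "\<not> i < j"
      then have "lv ?Q j \<le> lv ?Q i" using trunc_lv_mono[OF P, of j i d] by (cases "i = j") auto
      then show False using lvj i h by simp
    qed
    then show ?thesis using i lvj \<open>odd j\<close> by simp
  qed
qed

text \<open>Such a truncation is determined by its first levels and its entries below
  \<open>m\<close>, which come from \<open>cents d\<close> and \<open>rents d\<close>.\<close>

lemma finite_truncs: "finite {trunc d P |P. valid P \<and> lv P d = m}" (is "finite ?T")
proof -
  let ?D = "\<lambda>Q. (restrict (lv Q) {..d}, restrict (co Q) {..<m}, restrict (\<lambda>(t, s). ro Q t s) ({..<m} \<times> {..<m}))"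
  let ?B = "({..d} \<rightarrow>\<^sub>E {..m}) \<times> ({..<m} \<rightarrow>\<^sub>E cents d) \<times> ({..<m} \<times> {..<m} \<rightarrow>\<^sub>E rents d)"
  have "?D ` ?T \<subseteq> ?B"
  proof (rule image_subsetI)
    fix Q assume "Q \<in> ?T"
    then obtain P where P: "valid P" "lv P d = m" and Q: "Q = trunc d P" by blast
    have "lv Q i \<le> m" if "i \<le> d" for i using that P valid_lv_le[OF P(1)] by (auto simp: Q trunc_lv)
    moreover have "co Q s \<in> cents d" if "s < m" for s
      using that P co_in_cents[OF P(1), of s d] by (simp add: Q trunc_def trunc_co_def)
    moreover have "ro Q t s \<in> rents d" if "t < m" for t s
      using that P ro_in_rents[OF P(1), of t s d] by (simp add: Q trunc_def)
    ultimately show "?D Q \<in> ?B" by auto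
  qed
  moreover have "finite ?B" by (intro finite_cartesian_product finite_PiE) (auto simp: finite_cents finite_rents)
  ultimately have "finite (?D ` ?T)" by (rule finite_subset)
  moreover have "inj_on ?D ?T"
  proof (rule inj_onI)
    fix Q Q' assume Q: "Q \<in> ?T" and Q': "Q' \<in> ?T" and eq: "?D Q = ?D Q'"
    have trunc_id: "trunc d R = R \<and> lv R d = m" if "R \<in> ?T" for R
      using that trunc_cong[OF trunc_agree] by (auto simp: trunc_lv)
    have "lv Q i = lv Q' i" if "i \<le> d" for i
      using fun_cong[OF arg_cong[OF eq, of fst], of i] that by simp
    moreover have "co Q i = co Q' i" if "i < m" for i
      using fun_cong[OF arg_cong[OF eq, of "\<lambda>D. fst (snd D)"], of i] that by simp
    moreover have "ro Q i j = ro Q' i j" if "i < m" "j < m" for i j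
      using fun_cong[OF arg_cong[OF eq, of "\<lambda>D. snd (snd D)"], of "(i, j)"] that by simp
    ultimately have "agree d Q Q'" using trunc_id[OF Q] by (simp add: agree_def)
    then show "Q = Q'" using trunc_cong trunc_id[OF Q] trunc_id[OF Q'] by metis
  qed
  ultimately show ?thesis by (rule finite_imageD)
qed

lemma tail_lv_trunc: assumes "valid P" shows "lv (tail d P) (lv (trunc d P) i) = lv P i"
  using valid_lv_le[OF assms, of i d] by (auto simp: trunc_lv tail_def)

lemma tail_lv_less: assumes P: "valid P" and "i < j" shows "lv (tail d P) i < lv (tail d P) j"
proof -
  have "lv P d < lv P (j - lv P d + d)" if "lv P d < j" using that by (simp add: valid_lv_less[OF P])
  moreover have "lv P (i - lv P d + d) < lv P (j - lv P d + d)" if "lv P d < i"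
    using that assms(2) by (simp add: valid_lv_less[OF P])
  ultimately show ?thesis using assms(2) by (auto simp: tail_def)
qed

lemma tail_co_Own:
  assumes P: "valid P" and s: "even s" "tail_co d P s = Own i"
  shows "even i \<and> lv (tail d P) i \<le> s"
proof (cases "s \<le> lv P d")
  case True then show ?thesis using s by (auto simp: tail_co_def tail_def)
next
  case False
  then obtain i' where i': "co P s = Own i'" "i = lv (trunc d P) i'"
    using s by (auto simp: tail_co_def split: centry.splits)
  then have "even i'" "lv P i' \<le> s" using valid_co[OF P s(1)] by auto
  then show ?thesis using i' tail_lv_trunc[OF P] trunc_parity[OF P] by simp
qed

lemma tail_fixing: assumes P: "valid P" shows "tail d P \<in> fixing (Suc (lv P d))"
proof -
  let ?Z = "tail d P" and ?Q = "trunc d P" and ?m = "lv P d"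
  have inv: "inv (lv P) (lv P i) = i" for i
    using valid_lv_eq[OF P] by (intro inv_f_f injI) simp
  have surj: "\<exists>i. n = lv ?Q i \<and> d < i" if "?m < n" for n
    using that by (intro exI[of _ "n - ?m + d"]) (simp add: trunc_lv)
  have "valid ?Z"
  proof (rule validI)
    show "strict_mono (lv ?Z)" using tail_lv_less[OF P] by (simp add: strict_mono_def)
    show "even (lv ?Z n) \<longleftrightarrow> even n" for n
    proof (cases "n \<le> ?m")
      case False
      then obtain i where i: "n = lv ?Q i" using surj[of n] by auto
      then show ?thesis using tail_lv_trunc[OF P] trunc_parity[OF P] valid_parity[OF P] by simp
    qed (simp add: tail_def)
    show "co ?Z (lv ?Z n) = Own n" if "even n" for n
    proof (cases "n \<le> ?m")
      case False
      then obtain i where i: "n = lv ?Q i" "d < i" using surj[of n] by auto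
      then have "even i" using that trunc_parity[OF P] by simp
      moreover have "?m < lv P i" using i valid_lv_less[OF P] by simp
      ultimately show ?thesis unfolding i tail_lv_trunc[OF P]
        using valid_co_lv[OF P] by (simp add: tail_def tail_co_def)
    qed (simp add: tail_def tail_co_def)
    show "even i \<and> lv ?Z i \<le> s" if "even s" "co ?Z s = Own i" for s i
      using tail_co_Own[OF P that(1)] that(2) by (simp add: tail_def)
    show "ro ?Z (lv ?Z n) s = own n (co ?Z s)" if "odd n" "even s" "s < lv ?Z n" for n s
    proof (cases "n \<le> ?m")
      case True then show ?thesis using that by (simp add: tail_def tail_co_def)
    next
      case False
      then obtain i where i: "n = lv ?Q i" "d < i" using surj[of n] by auto
      then have "?m < lv P i" using valid_lv_less[OF P] by simp
      then show ?thesis unfolding i tail_lv_trunc[OF P] by (simp add: tail_def inv)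
    qed
    show "odd j \<and> even i \<and> i < j \<and> lv ?Z j \<le> t"
      if h: "odd t" "even s" "s < t" "ro ?Z t s = Par j i" for t s j i
    proof -
      consider "t \<le> ?m" | k where "?m < t" "t = lv P k" | "?m < t" "t \<notin> range (lv P)"
        by (meson not_le rangeE)
      then show ?thesis
      proof cases
        case 1 then show ?thesis using h by (simp add: tail_def)
      next
        case 2
        then have "own (lv ?Q k) (tail_co d P s) = Par j i" using h by (simp add: tail_def inv)
        then have c: "tail_co d P s = Own i" "j = lv ?Q k" by (cases "tail_co d P s"; simp)+
        then have i: "even i" "lv ?Z i \<le> s" using tail_co_Own[OF P h(2)] by auto
        have lvj: "lv ?Z j = t" using c 2 tail_lv_trunc[OF P] by simp
        have "odd j" using c 2 h trunc_parity[OF P] valid_parity[OF P] by simp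
        have "i < j"
        proof (rule ccontr)
          assume "\<not> i < j"
          then have "lv ?Z j \<le> lv ?Z i" using tail_lv_less[OF P, of j i d] by (cases "i = j") auto
          then show False using lvj i h by simp
        qed
        then show ?thesis using i lvj \<open>odd j\<close> by simp
      next
        case 3
        then obtain j' i' where j: "ro P t s = Par j' i'" "j = lv ?Q j'" "i = lv ?Q i'"
          using h by (auto simp: tail_def split: rentry.splits)
        then have "odd j'" "even i'" "i' < j'" "lv P j' \<le> t" using valid_ro[OF P h(1-3)] by auto
        then show ?thesis using j trunc_parity[OF P] trunc_lv_mono[OF P] tail_lv_trunc[OF P] by simp
      qed
    qed
  qed
  then show ?thesis by (simp add: fixing_def tail_def)
qed

text \<open>At its levels the truncation carries the parameters themselves, so substituting it
  undoes the renaming in the tail. As \<open>e\<close> is arbitrary, the whole matrix is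
  recovered.\<close>

lemma tail_trunc: assumes P: "valid P" shows "agree e P (tail d P \<otimes> trunc d P)"
  unfolding agree_def
proof (intro conjI allI impI)
  let ?Z = "tail d P" and ?Q = "trunc d P" and ?m = "lv P d"
  have Q: "valid ?Q" by (rule valid_trunc[OF P])
  show "lv P i = lv (?Z \<otimes> ?Q) i" for i by (simp add: pcomp_sel tail_lv_trunc[OF P])
  have lvd: "co P ?m = Own d" if "even ?m" using that valid_co_lv[OF P] valid_parity[OF P] by simp
  have Qco: "co ?Q s = co P s" if "s \<le> ?m" "even s" for s
  proof (cases "s = ?m")
    case True then show ?thesis using that lvd by (simp add: trunc_def trunc_co_def)
  qed (use that in \<open>simp add: trunc_def trunc_co_def\<close>)
  have Qro: "ro ?Q t s = ro P t s" if "t \<le> ?m" "odd t" "even s" "s < t" for t s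
  proof (cases "t = ?m")
    case True
    then have "ro P t s = own d (co P s)" using that valid_ro_lv[OF P, of d s] valid_parity[OF P, of d] by simp
    then show ?thesis using that True by (simp add: trunc_def trunc_co_def)
  qed (use that in \<open>simp add: trunc_def\<close>)
  show co: "co P s = co (?Z \<otimes> ?Q) s" if "even s" for s
  proof (cases "s \<le> ?m")
    case True then show ?thesis using Qco that by (simp add: pcomp_sel tail_def tail_co_def)
  next
    case False
    show ?thesis
    proof (cases "co P s")
      case (Own i)
      then have "even i" using valid_co[OF P that] by blast
      then show ?thesis using False Own valid_co_lv[OF Q] by (simp add: pcomp_sel tail_def tail_co_def)
    qed (use False in \<open>simp add: pcomp_sel tail_def tail_co_def\<close>)
  qed
  show "ro P t s = ro (?Z \<otimes> ?Q) t s" if h: "s < t" "odd t" "even s" for t s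
  proof -
    consider "t \<le> ?m" | k where "?m < t" "t = lv P k" | "?m < t" "t \<notin> range (lv P)"
      by (meson not_le rangeE)
    then show ?thesis
    proof cases
      case 1 then show ?thesis using Qro h by (simp add: pcomp_sel tail_def)
    next
      case 2
      then have k: "odd k" using h valid_parity[OF P] by simp
      have vZ: "valid ?Z" using tail_fixing[OF P] fixing_valid by blast
      have "ro (?Z \<otimes> ?Q) (lv (?Z \<otimes> ?Q) k) s = own k (co (?Z \<otimes> ?Q) s)"
        using h k 2 by (intro valid_ro_lv[OF valid_comp[OF vZ Q]]) (simp_all add: pcomp_sel tail_lv_trunc[OF P])
      moreover have "ro P t s = own k (co P s)" using valid_ro_lv[OF P k h(3)] 2 h by simp
      ultimately show ?thesis using co[OF h(3)] 2 by (simp add: pcomp_sel(1) tail_lv_trunc[OF P])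
    next
      case 3
      show ?thesis
      proof (cases "ro P t s")
        case (Par j i)
        then have j: "odd j" "even i" "i < j" using valid_ro[OF P h(2,3,1)] by auto
        then have "lv ?Q i < lv ?Q j" using trunc_lv_mono[OF P] by blast
        then have "ro ?Q (lv ?Q j) (lv ?Q i) = own j (co ?Q (lv ?Q i))"
          using j trunc_parity[OF P] by (intro valid_ro_lv[OF Q]) auto
        then show ?thesis using 3 Par j valid_co_lv[OF Q] by (simp add: pcomp_sel tail_def)
      qed (use 3 in \<open>simp add: pcomp_sel tail_def\<close>)
    qed
  qed
qed

text \<open>For fixed \<open>m\<close> there are finitely many truncations. Colour a left factor by
  the function that gives the colour for each of them; once this function is constant, the colour of
  \<open>X \<otimes> P\<close> depends only on the truncation of \<open>P\<close>.\<close>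

lemma local_step_at:
  fixes \<chi> :: "pmat \<Rightarrow> 'c"
  assumes loc: "local (Suc d) \<chi>" and fin: "finite (\<chi> ` Collect valid)"
  shows "\<exists>X\<in>fixing (Suc m). \<forall>P P'. valid P \<longrightarrow> valid P' \<longrightarrow> lv P d = m \<longrightarrow> agree d P P' \<longrightarrow>
    \<chi> (X \<otimes> P) = \<chi> (X \<otimes> P')"
proof -
  define T where "T = {trunc d P |P. valid P \<and> lv P d = m}"
  define f where "f Z = restrict (\<lambda>Q. \<chi> (Z \<otimes> Q)) T" for Z
  have TQ: "valid Q \<and> lv Q (Suc d) = Suc m" if "Q \<in> T" for Q
    using that valid_trunc by (auto simp: T_def trunc_lv)
  \<comment> \<open>In these truncations level \<open>Suc d\<close> is at \<open>Suc m\<close>, so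
    \<open>Suc d\<close> levels of the product depend on only \<open>Suc m\<close> levels of the
    left factor.\<close>
  have "local (Suc m) f" unfolding local_def
  proof (intro allI impI)
    fix Z Z' assume Z: "valid Z" "valid Z'" "agree (Suc m) Z Z'"
    have "\<chi> (Z \<otimes> Q) = \<chi> (Z' \<otimes> Q)" if "Q \<in> T" for Q
    proof -
      have "agree (Suc d) (Z \<otimes> Q) (Z' \<otimes> Q)" using TQ[OF that] Z by (intro agree_comp_left) auto
      then show ?thesis using loc Z TQ[OF that] valid_comp by (simp add: local_def)
    qed
    then show "f Z = f Z'" unfolding f_def by (rule restrict_ext)
  qed
  moreover have "finite (f ` Collect valid)"
  proof (rule finite_subset)
    show "f ` Collect valid \<subseteq> T \<rightarrow>\<^sub>E (\<chi> ` Collect valid)"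
      using TQ valid_comp by (auto simp: f_def)
    show "finite (T \<rightarrow>\<^sub>E (\<chi> ` Collect valid))"
      using finite_truncs fin unfolding T_def by (intro finite_PiE) auto
  qed
  ultimately obtain X c where X: "X \<in> fixing (Suc m)" "\<And>Z. Z \<in> fixing (Suc m) \<Longrightarrow> f (X \<otimes> Z) = c"
    using pigeonhole[of "Suc m" f] by blast
  have key: "\<chi> (X \<otimes> P) = c (trunc d P)" if P: "valid P" "lv P d = m" for P
  proof -
    let ?Z = "tail d P" and ?Q = "trunc d P"
    have Z: "?Z \<in> fixing (Suc m)" using tail_fixing[OF P(1), of d] P(2) by simp
    have Q: "?Q \<in> T" using P by (auto simp: T_def)
    have vX: "valid X" and vZ: "valid ?Z" using X(1) Z fixing_valid by auto
    have "agree (Suc d) (X \<otimes> P) (X \<otimes> (?Z \<otimes> ?Q))"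
      by (rule agree_comp_right[OF vX P(1) tail_trunc[OF P(1)]])
    then have "\<chi> (X \<otimes> P) = \<chi> (X \<otimes> (?Z \<otimes> ?Q))"
      using loc vX P(1) vZ valid_trunc[OF P(1)] valid_comp by (simp add: local_def)
    also have "\<dots> = f (X \<otimes> ?Z) ?Q" using Q by (simp add: f_def pcomp_assoc)
    finally show ?thesis using X(2)[OF Z] by simp
  qed
  have "\<chi> (X \<otimes> P) = \<chi> (X \<otimes> P')" if "valid P" "valid P'" "lv P d = m" "agree d P P'" for P P'
  proof -
    have "lv P' d = m" using that(3,4) by (simp add: agree_def)
    then show ?thesis using key[OF that(1,3)] key[OF that(2)] trunc_cong[OF that(4)] by simp
  qed
  then show ?thesis using X(1) by blast
qed

section \<open>Fusion and induction on the number of levels\<close>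

definition id_pmat :: pmat where
  "id_pmat = \<lparr>lv = id, co = Own, ro = Par\<rparr>"

lemma valid_id_pmat: "valid id_pmat"
  by (rule validI) (auto simp: id_pmat_def strict_mono_def)

lemma agree_fixing:
  assumes W: "valid W" and X: "X \<in> fixing (Suc m)" shows "agree m W (W \<otimes> X)"
  unfolding agree_def
proof (intro conjI allI impI)
  show "lv W i = lv (W \<otimes> X) i" if "i \<le> m" for i using that X by (simp add: pcomp_sel fixing_def)
  show "co W s = co (W \<otimes> X) s" if s: "s < lv W m" "even s" for s
  proof (cases "co W s")
    case (Own i)
    then have i: "even i" "lv W i \<le> s" using valid_co[OF W] s by auto
    then have "i < m" using s valid_lv_less[OF W, of i m] by simp
    then show ?thesis using Own i fixing_co[OF X] by (simp add: pcomp_sel)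
  qed (simp add: pcomp_sel)
  show "ro W t s = ro (W \<otimes> X) t s" if t: "t < lv W m" "s < t" "odd t" "even s" for t s
  proof (cases "ro W t s")
    case (Par j i)
    then have i: "odd j" "even i" "i < j" "lv W j \<le> t" using valid_ro[OF W t(3,4,2)] by auto
    then have "j < m" using t valid_lv_less[OF W, of j m] by simp
    then show ?thesis using Par i fixing_ro[OF X] by (simp add: pcomp_sel)
  qed (simp add: pcomp_sel)
qed

text \<open>Level \<open>Suc s\<close> lies beyond position \<open>s\<close>, so every entry is
  settled after finitely many stages and the diagonal is a limit.\<close>

lemma limit_pmat:
  assumes V: "\<And>n. valid (W n)" and ag: "\<And>n. agree n (W n) (W (Suc n))"
  shows "\<exists>L. valid L \<and> (\<forall>n. agree n L (W n))"
proof -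
  have ag': "agree n (W n) (W n')" if "n \<le> n'" for n n'
    using that
  proof (induction n' rule: dec_induct)
    case (step n')
    then show ?case using ag agree_mono[OF ag[of n'], of n] V agree_trans by simp
  qed (rule agree_refl)
  define L where "L = \<lparr>lv = (\<lambda>i. lv (W i) i), co = (\<lambda>s. co (W (Suc s)) s), ro = (\<lambda>t s. ro (W (Suc t)) t s)\<rparr>"
  have lv: "lv L i = lv (W n) i" if "i \<le> n" for i n
    using ag'[OF that] by (simp add: L_def agree_def)
  have co: "co L s = co (W n) s" if "s < lv (W n) n" "even s" for s n
  proof (cases "Suc s \<le> n")
    case True
    have "s < lv (W (Suc s)) (Suc s)" using valid_lv_ge[OF V, of "Suc s" "Suc s"] by simp
    then show ?thesis using ag'[OF True] that by (simp add: L_def agree_def)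
  next
    case False
    then show ?thesis using ag'[of n "Suc s"] that by (simp add: L_def agree_def)
  qed
  have ro: "ro L t s = ro (W n) t s" if "t < lv (W n) n" "s < t" "odd t" "even s" for t s n
  proof (cases "Suc t \<le> n")
    case True
    have "t < lv (W (Suc t)) (Suc t)" using valid_lv_ge[OF V, of "Suc t" "Suc t"] by simp
    then show ?thesis using ag'[OF True] that by (simp add: L_def agree_def)
  next
    case False
    then show ?thesis using ag'[of n "Suc t"] that by (simp add: L_def agree_def)
  qed
  have "valid L"
  proof (rule validI)
    show "strict_mono (lv L)"
      unfolding strict_mono_Suc_iff using lv valid_lv_less[OF V] by (metis le_Suc_eq lessI order_refl)
    show "even (lv L i) \<longleftrightarrow> even i" for i using lv[of i i] valid_parity[OF V] by simp
    show "co L (lv L i) = Own i" if "even i" for i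
    proof -
      have "lv (W (Suc i)) i < lv (W (Suc i)) (Suc i)" using valid_lv_less[OF V] by simp
      then show ?thesis using lv[of i "Suc i"] co[of "lv L i" "Suc i"] that valid_co_lv[OF V] valid_parity[OF V] by simp
    qed
    show "even i \<and> lv L i \<le> s" if h: "even s" "co L s = Own i" for s i
    proof -
      have "co (W (Suc s)) s = Own i" using h by (simp add: L_def)
      then have i: "even i" "lv (W (Suc s)) i \<le> s" using valid_co[OF V h(1)] by auto
      then have "i \<le> Suc s" using valid_lv_ge[OF V, of i "Suc s"] by simp
      then show ?thesis using lv[of i "Suc s"] i by simp
    qed
    show "ro L (lv L n) s = own n (co L s)" if "odd n" "even s" "s < lv L n" for n s
    proof -
      have l: "lv L n = lv (W (Suc n)) n" using lv by simp
      have "lv (W (Suc n)) n < lv (W (Suc n)) (Suc n)" using valid_lv_less[OF V] by simp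
      then show ?thesis using l that co[of s "Suc n"] ro[of "lv L n" "Suc n" s] valid_ro_lv[OF V that(1,2)]
          valid_parity[OF V] by simp
    qed
    show "odd j \<and> even i \<and> i < j \<and> lv L j \<le> t"
      if h: "odd t" "even s" "s < t" "ro L t s = Par j i" for t s j i
    proof -
      have "ro (W (Suc t)) t s = Par j i" using h by (simp add: L_def)
      then have i: "odd j" "even i" "i < j" "lv (W (Suc t)) j \<le> t" using valid_ro[OF V h(1-3)] by auto
      then have "j \<le> Suc t" using valid_lv_ge[OF V, of j "Suc t"] by simp
      then show ?thesis using lv[of j "Suc t"] i by simp
    qed
  qed
  moreover have "agree n L (W n)" for n
    unfolding agree_def using lv[of _ n] co[of _ n] ro[of _ n] by auto
  ultimately show ?thesis by blast
qed

text \<open>Fusion: stage \<open>m\<close> treats the matrices with level \<open>d\<close> at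
  \<open>m\<close>, by a correction that fixes all levels up to \<open>m\<close>. Later corrections
  fix these levels as well, so the products converge and no stage is undone.\<close>

lemma local_step:
  fixes \<chi> :: "pmat \<Rightarrow> 'c"
  assumes loc: "local (Suc d) \<chi>" and fin: "finite (\<chi> ` Collect valid)"
  shows "\<exists>W. valid W \<and> local d (\<lambda>P. \<chi> (W \<otimes> P))"
proof -
  define good where "good m W X \<longleftrightarrow> X \<in> fixing (Suc m) \<and> (\<forall>P P'. valid P \<longrightarrow> valid P' \<longrightarrow> lv P d = m \<longrightarrow>
      agree d P P' \<longrightarrow> \<chi> (W \<otimes> (X \<otimes> P)) = \<chi> (W \<otimes> (X \<otimes> P')))" for m W X
  have ex: "\<exists>X. good m W X" if W: "valid W" for m W
  proof -
    have "(\<lambda>P. \<chi> (W \<otimes> P)) ` Collect valid \<subseteq> \<chi> ` Collect valid" using valid_comp[OF W] by auto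
    then have "finite ((\<lambda>P. \<chi> (W \<otimes> P)) ` Collect valid)" using fin by (rule finite_subset)
    then show ?thesis using local_step_at[OF local_comp[OF loc W], of m] unfolding good_def by blast
  qed
  define ch where "ch m W = (SOME X. good m W X)" for m W
  have ch: "good m W (ch m W)" if "valid W" for m W
    unfolding ch_def using someI_ex[OF ex[OF that]] .
  define W where "W = rec_nat id_pmat (\<lambda>m V. V \<otimes> ch m V)"
  have W0: "W 0 = id_pmat" and WS: "W (Suc m) = W m \<otimes> ch m (W m)" for m by (simp_all add: W_def)
  have V: "valid (W n)" for n
  proof (induction n)
    case (Suc n)
    then have "ch n (W n) \<in> fixing (Suc n)" using ch good_def by blast
    then show ?case using Suc valid_comp fixing_valid by (simp add: WS)
  qed (simp add: W0 valid_id_pmat)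
  have chN: "ch n (W n) \<in> fixing (Suc n)" for n using ch[OF V] good_def by blast
  have "agree n (W n) (W (Suc n))" for n unfolding WS by (rule agree_fixing[OF V chN])
  from limit_pmat[of W, OF V this] obtain L where L: "valid L" "\<And>n. agree n L (W n)" by blast
  have later: "\<exists>Y\<in>fixing (Suc m). W n = W (Suc m) \<otimes> Y" if "Suc m < n" for m n
    using that
  proof (induction n)
    case (Suc n)
    have c: "ch n (W n) \<in> fixing (Suc m)" using chN[of n] fixing_mono[of "Suc m" "Suc n"] Suc.prems by auto
    show ?case
    proof (cases "Suc m < n")
      case True
      then obtain Y where "Y \<in> fixing (Suc m)" "W n = W (Suc m) \<otimes> Y" using Suc by blast
      then show ?thesis using c fixing_comp[of Y "Suc m" "ch n (W n)"] by (auto simp: WS pcomp_assoc)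
    next
      case False
      then have "n = Suc m" using Suc.prems by simp
      then show ?thesis using c by (auto simp: WS)
    qed
  qed simp
  have "\<chi> (L \<otimes> P) = \<chi> (L \<otimes> P')" if P: "valid P" "valid P'" "agree d P P'" for P P'
  proof -
    define m where "m = lv P d"
    \<comment> \<open>Beyond stage \<open>m\<close>, and large enough that \<open>L\<close> may be
      replaced by \<open>W n\<close> in both products as far as level \<open>Suc d\<close>.\<close>
    define n where "n = Suc (Suc m) + lv P (Suc d) + lv P' (Suc d)"
    have LW: "\<chi> (L \<otimes> R) = \<chi> (W n \<otimes> R)" if "valid R" "lv R (Suc d) \<le> n" for R
    proof -
      have "agree (Suc d) (L \<otimes> R) (W n \<otimes> R)"
        using agree_mono[OF L(2)[of n] that(2) L(1)] that(1) by (rule agree_comp_left)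
      then show ?thesis using loc L(1) V that(1) valid_comp by (simp add: local_def)
    qed
    \<comment> \<open>The corrections \<open>Y\<close> made after stage \<open>m\<close> are
      absorbed into \<open>P\<close>: they fix \<open>m\<close>, so \<open>Y \<otimes> P\<close>
      still has level \<open>d\<close> at \<open>m\<close>.\<close>
    obtain Y where Y: "Y \<in> fixing (Suc m)" "W n = W (Suc m) \<otimes> Y" using later[of m n] by (auto simp: n_def)
    have vY: "valid Y" using Y fixing_valid by blast
    have "lv (Y \<otimes> P) d = m" using Y(1) by (simp add: pcomp_sel m_def fixing_def)
    moreover have "agree d (Y \<otimes> P) (Y \<otimes> P')" by (rule agree_comp_right[OF vY P(1,3)])
    ultimately have "\<chi> (W m \<otimes> (ch m (W m) \<otimes> (Y \<otimes> P))) = \<chi> (W m \<otimes> (ch m (W m) \<otimes> (Y \<otimes> P')))"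
      using ch[OF V, of m m] valid_comp[OF vY] P(1,2) unfolding good_def by blast
    then have "\<chi> (W n \<otimes> P) = \<chi> (W n \<otimes> P')" by (simp add: Y(2) WS pcomp_assoc)
    then show ?thesis using LW[of P] LW[of P'] P by (simp add: n_def)
  qed
  then show ?thesis using L(1) by (auto simp: local_def)
qed

theorem pmat_Ramsey:
  fixes \<chi> :: "pmat \<Rightarrow> 'c"
  assumes "local d \<chi>" "finite (\<chi> ` Collect valid)"
  shows "\<exists>W c. valid W \<and> (\<forall>P. valid P \<longrightarrow> \<chi> (W \<otimes> P) = c)"
  using assms
proof (induction d arbitrary: \<chi>)
  case 0
  then show ?case using pigeonhole[of 0 \<chi>] by (auto simp: fixing_def)
next
  case (Suc d)
  then obtain W where W: "valid W" "local d (\<lambda>P. \<chi> (W \<otimes> P))" using local_step by blast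
  have "(\<lambda>P. \<chi> (W \<otimes> P)) ` Collect valid \<subseteq> \<chi> ` Collect valid" using valid_comp[OF W(1)] by auto
  then have "finite ((\<lambda>P. \<chi> (W \<otimes> P)) ` Collect valid)" using Suc.prems(2) by (rule finite_subset)
  from Suc.IH[OF W(2) this] obtain W' c where "valid W'" "\<forall>P. valid P \<longrightarrow> \<chi> (W \<otimes> (W' \<otimes> P)) = c" by blast
  then show ?case using W(1) valid_comp by (intro exI[of _ "W \<otimes> W'"] exI[of _ c]) (simp add: pcomp_assoc)
qed

section \<open>Vertices and envelopes\<close>

text \<open>A vertex \<open>(i, n, C)\<close> has the column \<open>i\<close> and the row \<open>n\<close>; \<open>C\<close> lists the pairs of a row and
  a column below \<open>n\<close> with which it forms hyperedges.\<close>

type_synonym vert = "nat \<times> nat \<times> (nat \<times> nat) set"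

definition verts :: "vert set" where
  "verts = {(i, n, C). even i \<and> odd n \<and> i < n \<and> C \<subseteq> {(t, s). odd t \<and> even s \<and> s < t \<and> t < n}}"

definition act :: "pmat \<Rightarrow> vert \<Rightarrow> vert" where
  "act P v = (case v of (i, n, C) \<Rightarrow> (lv P i, lv P n,
     {(t, s). odd t \<and> even s \<and> s < t \<and> t < lv P n \<and>
       (case ro P t s of RC b \<Rightarrow> b | Par j i \<Rightarrow> (j, i) \<in> C)}))"

lemma act_simps [simp]:
  "fst (act P v) = lv P (fst v)" "fst (snd (act P v)) = lv P (fst (snd v))"
  by (simp_all add: act_def case_prod_beta)

lemma act_verts:
  assumes "valid P" "v \<in> verts" shows "act P v \<in> verts"
  using assms(2) valid_parity[OF assms(1)] valid_lv_less[OF assms(1)] by (auto simp: verts_def act_def)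

lemma act_comp:
  assumes W: "valid W" shows "act (W \<otimes> P) v = act W (act P v)"
proof -
  obtain i n C where v: "v = (i, n, C)" by (cases v)
  define S where "S = snd (snd (act P v))"
  have "(case ro (W \<otimes> P) t s of RC b \<Rightarrow> b | Par j i \<Rightarrow> (j, i) \<in> C) \<longleftrightarrow>
      (case ro W t s of RC b \<Rightarrow> b | Par j i \<Rightarrow> (j, i) \<in> S)"
    if t: "odd t" "even s" "s < t" "t < lv W (lv P n)" for t s
  proof (cases "ro W t s")
    case (Par j i)
    then have j: "odd j" "even i" "i < j" "lv W j \<le> t" using valid_ro[OF W t(1-3)] by auto
    then have "j < lv P n" using t valid_lv_less[OF W, of j "lv P n"] by simp
    then show ?thesis using Par j by (simp add: pcomp_sel act_def v S_def)
  qed (simp add: pcomp_sel)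
  moreover have "act P v = (lv P i, lv P n, S)" by (simp add: prod_eq_iff v S_def)
  ultimately show ?thesis by (auto simp: act_def[of "W \<otimes> P"] act_def[of W] v pcomp_sel(1))
qed

text \<open>The matrix of a vertex with row \<open>n\<close> is computed from the rows of
  \<open>P\<close> before level \<open>n\<close>.\<close>

lemma act_agree:
  assumes "agree d P P'" "valid P" "v \<in> verts" "fst (snd v) \<le> d" shows "act P v = act P' v"
proof -
  obtain i n C where v: "v = (i, n, C)" by (cases v)
  have n: "i < n" "n \<le> d" using assms v by (auto simp: verts_def)
  have "lv P n \<le> lv P d" using n valid_lv_le[OF assms(2)] by simp
  then have "ro P t s = ro P' t s" if "odd t" "even s" "s < t" "t < lv P n" for t s
    using that assms(1) by (simp add: agree_def)
  moreover have "lv P i = lv P' i" "lv P n = lv P' n" using n assms(1) by (auto simp: agree_def)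
  ultimately show ?thesis by (auto simp: act_def v)
qed

text \<open>Where a row level crosses a column level the entry of \<open>P\<close> is the parameter
  \<open>Par j i\<close> itself. Hence \<open>act P\<close> keeps the old matrix as a submatrix,
  which gives injectivity and the embedding property.\<close>

lemma act_mem:
  assumes P: "valid P" and "v \<in> verts" and "odd j" "even i" "i < j" "j < fst (snd v)"
  shows "(lv P j, lv P i) \<in> snd (snd (act P v)) \<longleftrightarrow> (j, i) \<in> snd (snd v)"
proof -
  have "lv P i < lv P j" "lv P j < lv P (fst (snd v))" using assms valid_lv_less[OF P] by auto
  moreover from this have "ro P (lv P j) (lv P i) = Par j i"
    using assms valid_ro_lv[OF P, of j "lv P i"] valid_parity[OF P] valid_co_lv[OF P] by simp
  ultimately show ?thesis using assms valid_parity[OF P] by (simp add: act_def case_prod_beta)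
qed

lemma act_inj: assumes P: "valid P" shows "inj_on (act P) verts"
proof (rule inj_onI)
  fix v v' assume v: "v \<in> verts" "v' \<in> verts" "act P v = act P v'"
  have n: "fst v = fst v'" "fst (snd v) = fst (snd v')"
    using arg_cong[OF v(3), of fst] arg_cong[OF v(3), of "\<lambda>v. fst (snd v)"] valid_lv_eq[OF P] by auto
  have "(j, i) \<in> snd (snd v) \<longleftrightarrow> (j, i) \<in> snd (snd v')"
    if "odd j" "even i" "i < j" "j < fst (snd v)" for j i
    using act_mem[OF P v(1) that] act_mem[OF P v(2) that(1-3)] that(4) n v(3) by simp
  then have "snd (snd v) = snd (snd v')" using v(1,2) n by (auto simp: verts_def)
  then show "v = v'" using n by (simp add: prod_eq_iff)
qed

text \<open>For \<open>p\<close> vertices: at most \<open>2 ^ p\<close> rows for the sets of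
  vertices sharing a pair and \<open>p\<close> rows of the vertices, one column for each subset of
  these rows times the vertices, and the \<open>p\<close> columns of the vertices.\<close>

definition env_bound :: "nat \<Rightarrow> nat" where
  "env_bound p = (2 ^ p + p) + 2 ^ ((2 ^ p + p) * p) + p"

text \<open>The levels needed to express finitely many vertices: one row for each set of vertices that
  share a pair, and one column for each pattern seen on the chosen rows. Rows and columns use
  disjoint residues modulo 4, so that the row next to a chosen column is empty.\<close>

lemma envelope:
  fixes C :: "'a \<Rightarrow> (nat \<times> nat) set" and k :: "'a \<Rightarrow> nat"
  assumes fin: "finite I"
    and C: "\<And>a t s. a \<in> I \<Longrightarrow> (t, s) \<in> C a \<Longrightarrow> t mod 4 = 3 \<and> s mod 4 = 0 \<and> s < t \<and> t < 4 * k a + 3"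
  shows "\<exists>P D. valid P \<and> (\<forall>a\<in>I. D a \<in> verts \<and> fst (snd (D a)) \<le> 2 * env_bound (card I) \<and>
    act P (D a) = (4 * k a, 4 * k a + 3, C a))"
proof -
  define Pos where "Pos = {ts. \<exists>a\<in>I. ts \<in> C a}"
  define pat where "pat ts = {a \<in> I. ts \<in> C a}" for ts
  \<comment> \<open>Least representatives never come after the position that refers to them, as
    validity requires; \<open>cr\<close> is least for the same reason.\<close>
  define rt where "rt q = (LEAST t. \<exists>s. (t, s) \<in> Pos \<and> pat (t, s) = q)" for q
  define rs where "rs q = (SOME s. (rt q, s) \<in> Pos \<and> pat (rt q, s) = q)" for q
  define R where "R = rt ` pat ` Pos \<union> (\<lambda>a. 4 * k a + 3) ` I"
  define cp where "cp s = {(t, a). t \<in> R \<and> a \<in> I \<and> (t, s) \<in> C a}" for s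
  define cr where "cr s = (LEAST s'. cp s' = cp s)" for s
  define Cs where "Cs = {s. cp s \<noteq> {}}"
  \<comment> \<open>Levels alternate in parity, so positions \<open>2 * x\<close> and
    \<open>2 * x + 1\<close> become levels together. \<open>Ks\<close> numbers these pairs, whence
    the factor 2 in the bound.\<close>
  define Ks where "Ks = (\<lambda>t. t div 2) ` R \<union> (\<lambda>s. s div 2) ` cr ` Cs \<union> (\<lambda>a. 2 * k a) ` I"
  have rt_ex: "\<exists>s. (rt q, s) \<in> Pos \<and> pat (rt q, s) = q" and rt_le: "rt q \<le> t"
    if "(t, s) \<in> Pos" "pat (t, s) = q" for t s q
    unfolding rt_def
    by (rule LeastI_ex, use that in blast, rule Least_le, use that in blast)
  have rs: "(rt q, rs q) \<in> Pos \<and> pat (rt q, rs q) = q" if "(t, s) \<in> Pos" "pat (t, s) = q" for t s q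
    unfolding rs_def by (rule someI_ex, rule rt_ex[OF that])
  have cr_eq: "cp (cr s) = cp s" and cr_le: "cr s \<le> s" for s
    unfolding cr_def by (rule LeastI[of _ s], simp, rule Least_le, simp)
  have Pos_mod: "t mod 4 = 3 \<and> s mod 4 = 0 \<and> s < t" if "(t, s) \<in> Pos" for t s
    using that C by (auto simp: Pos_def)
  have R_mod: "t mod 4 = 3" if "t \<in> R" for t
  proof -
    consider ts where "ts \<in> Pos" "t = rt (pat ts)" | a where "t = 4 * k a + 3" using \<open>t \<in> R\<close> by (auto simp: R_def)
    then show ?thesis
    proof cases
      case 1
      then have "(t, rs (pat ts)) \<in> Pos" using rs[of "fst ts" "snd ts"] by simp
      then show ?thesis using Pos_mod by blast
    next
      case 2
      then show ?thesis by presburger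
    qed
  qed
  have Cs_mod: "s mod 4 = 0" if "s \<in> Cs" for s using that C by (auto simp: Cs_def cp_def)
  have cr_Cs: "cr s \<in> Cs" if "s \<in> Cs" for s using that cr_eq by (simp add: Cs_def)
  have pat_Pow: "pat ` Pos \<subseteq> Pow I" by (auto simp: pat_def)
  have finR: "finite R" unfolding R_def using pat_Pow fin by (simp add: finite_subset[of _ "Pow I"])
  have cardR: "card R \<le> 2 ^ card I + card I"
  proof -
    have "card (rt ` pat ` Pos) \<le> card (pat ` Pos)"
      using pat_Pow fin by (intro card_image_le) (simp add: finite_subset[of _ "Pow I"])
    also have "\<dots> \<le> 2 ^ card I" using card_mono[OF _ pat_Pow] fin by (simp add: card_Pow)
    finally have "card (rt ` pat ` Pos) \<le> 2 ^ card I" .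
    moreover have "card ((\<lambda>a. 4 * k a + 3) ` I) \<le> card I" using fin by (rule card_image_le)
    ultimately show ?thesis unfolding R_def using card_Un_le[of "rt ` pat ` Pos" "(\<lambda>a. 4 * k a + 3) ` I"] by linarith
  qed
  have cr_img: "cr ` Cs \<subseteq> (\<lambda>q. LEAST s'. cp s' = q) ` Pow (R \<times> I)"
    unfolding cr_def by (auto simp: cp_def)
  have finP: "finite (Pow (R \<times> I))" using finR fin by simp
  have fin_cr: "finite (cr ` Cs)" using finite_subset[OF cr_img] finP by simp
  have "card (cr ` Cs) \<le> card (Pow (R \<times> I))"
    using card_mono[OF _ cr_img] card_image_le[OF finP, of "\<lambda>q. LEAST s'. cp s' = q"] finP by simp
  also have "\<dots> = 2 ^ (card R * card I)" using finR fin by (simp add: card_Pow card_cartesian_product)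
  also have "\<dots> \<le> 2 ^ ((2 ^ card I + card I) * card I)" using cardR by (intro power_increasing mult_right_mono) auto
  finally have card_cr: "card (cr ` Cs) \<le> 2 ^ ((2 ^ card I + card I) * card I)" .
  have finK: "finite Ks" unfolding Ks_def using finR fin_cr fin by simp
  have cardK: "card Ks \<le> env_bound (card I)"
  proof -
    have "card Ks \<le> card ((\<lambda>t. t div 2) ` R) + card ((\<lambda>s. s div 2) ` cr ` Cs) + card ((\<lambda>a. 2 * k a) ` I)"
      unfolding Ks_def using card_Un_le by (meson add_le_mono1 le_trans)
    moreover have "card ((\<lambda>t. t div 2) ` R) \<le> card R" by (rule card_image_le[OF finR])
    moreover have "card ((\<lambda>s. s div 2) ` cr ` Cs) \<le> card (cr ` Cs)" by (rule card_image_le[OF fin_cr])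
    moreover have "card ((\<lambda>a. 2 * k a) ` I) \<le> card I" by (rule card_image_le[OF fin])
    ultimately show ?thesis using cardR card_cr unfolding env_bound_def by linarith
  qed
  define M where "M = Max (insert 0 Ks)"
  \<comment> \<open>Infinitely many levels are required; beyond \<open>M\<close> every pair is
    taken.\<close>
  define Kinf where "Kinf = Ks \<union> {M<..}"
  have KM: "x \<le> M" if "x \<in> Ks" for x unfolding M_def using that finK by simp
  have infK: "infinite Kinf" unfolding Kinf_def by (simp add: infinite_Ioi)
  define e where "e = enumerate Kinf"
  have e_mono: "strict_mono e" unfolding e_def using infK by (rule strict_mono_enumerate)
  have e_range: "range e = Kinf" unfolding e_def using infK by (rule range_enumerate)
  have e_inj: "inj e" using e_mono by (rule strict_mono_imp_inj_on)
  define ix where "ix = inv e"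
  have e_ix: "e (ix x) = x" if "x \<in> Kinf" for x unfolding ix_def using that e_range by (intro f_inv_into_f) simp
  have ix_e: "ix (e i) = i" for i unfolding ix_def using e_inj by simp
  have ix_less: "ix x < card Ks" if x: "x \<in> Ks" for x
  proof -
    have xe: "e (ix x) = x" using x e_ix by (simp add: Kinf_def)
    have "e ` {..ix x} \<subseteq> Ks"
    proof (rule image_subsetI)
      fix i assume "i \<in> {..ix x}"
      then have "e i \<le> e (ix x)" using e_mono by (simp add: strict_mono_less_eq)
      then have "e i \<le> M" using xe KM[OF x] by simp
      moreover have "e i \<in> Kinf" using e_range by blast
      ultimately show "e i \<in> Ks" by (auto simp: Kinf_def)
    qed
    then have "card (e ` {..ix x}) \<le> card Ks" using finK by (rule_tac card_mono)
    moreover have "card (e ` {..ix x}) = Suc (ix x)" using e_inj by (subst card_image) (auto intro: inj_on_subset)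
    ultimately show ?thesis by simp
  qed
  define l where "l i = 2 * e (i div 2) + i mod 2" for i
  define lx where "lx t = 2 * ix (t div 2) + t mod 2" for t
  have l_lx: "l (lx t) = t" if "t div 2 \<in> Kinf" for t using e_ix[OF that] by (simp add: l_def lx_def)
  have lx_l: "lx (l i) = i" for i by (simp add: l_def lx_def ix_e)
  have l_Kinf: "l i div 2 \<in> Kinf" for i using e_range by (auto simp: l_def)
  have l_even: "even (l i) \<longleftrightarrow> even i" for i by (simp add: l_def)
  have lx_even: "even (lx i) \<longleftrightarrow> even i" for i by (simp add: lx_def)
  have l_mono: "strict_mono l" unfolding strict_mono_Suc_iff
  proof
    fix i
    show "l i < l (Suc i)"
    proof (cases "even i")
      case True
      then have "Suc i div 2 = i div 2" "i mod 2 = 0" "Suc i mod 2 = 1" by presburger+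
      then show ?thesis by (simp add: l_def)
    next
      case False
      then have "Suc i div 2 = Suc (i div 2)" "i mod 2 = 1" by presburger+
      moreover have "e (i div 2) < e (Suc (i div 2))" using e_mono by (simp add: strict_mono_less)
      ultimately show ?thesis by (simp add: l_def)
    qed
  qed
  have l_less: "l i < l j \<longleftrightarrow> i < j" for i j using l_mono by (simp add: strict_mono_less)
  have lx_less: "lx t < lx t'" if "t < t'" "t div 2 \<in> Kinf" "t' div 2 \<in> Kinf" for t t'
    using that l_less[of "lx t" "lx t'"] l_lx by simp
  have RK: "t div 2 \<in> Ks" "t div 2 \<in> Kinf" if "t \<in> R" for t using that by (auto simp: Ks_def Kinf_def)
  have CK: "cr s div 2 \<in> Kinf" if "s \<in> Cs" for s using that by (auto simp: Ks_def Kinf_def)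
  \<comment> \<open>A column outside the levels copies the chosen column with the same pattern on
    \<open>R\<close>; a row outside the levels refers, entry by entry, to the chosen pair lying in
    the same sets \<open>C a\<close>.\<close>
  define xc where "xc s = (if s div 2 \<in> Kinf then Own (lx s) else if s \<in> Cs then Own (lx (cr s)) else CC False)" for s
  define xr where "xr t s = (if t div 2 \<in> Kinf then own (lx t) (xc s)
      else if (t, s) \<in> Pos then Par (lx (rt (pat (t, s)))) (lx (cr (rs (pat (t, s))))) else RC False)" for t s
  define P where "P = \<lparr>lv = l, co = xc, ro = xr\<rparr>"
  have P_sel: "lv P = l" "co P = xc" "ro P = xr" by (simp_all add: P_def)
  have xc_Own: "even i \<and> l i \<le> s" if "even s" "xc s = Own i" for s i
  proof (cases "s div 2 \<in> Kinf")
    case True then show ?thesis using that l_lx[OF True] lx_even[of s] by (auto simp: xc_def)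
  next
    case False
    then have "s \<in> Cs" "i = lx (cr s)" using that by (auto simp: xc_def split: if_splits)
    moreover from this have "cr s mod 4 = 0" using cr_Cs Cs_mod by blast
    then have "even (cr s)" by presburger
    ultimately show ?thesis using l_lx CK cr_le lx_even by simp
  qed
  have pos_rep: "rt q \<in> R \<and> odd (rt q) \<and> rs q \<in> Cs \<and> rs q < rt q \<and> rt q \<le> t"
    if "(t, s) \<in> Pos" "q = pat (t, s)" for t s q
  proof -
    have p: "(rt q, rs q) \<in> Pos" "rt q \<le> t" using rs rt_le that by blast+
    have r: "rt q \<in> R" using that by (auto simp: R_def)
    then have "rt q mod 4 = 3" by (rule R_mod)
    then have "odd (rt q)" by presburger
    moreover obtain a where "a \<in> I" "(rt q, rs q) \<in> C a" using p by (auto simp: Pos_def)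
    then have "(rt q, a) \<in> cp (rs q)" using r by (simp add: cp_def)
    then have "rs q \<in> Cs" by (auto simp: Cs_def)
    ultimately show ?thesis using r p Pos_mod by blast
  qed
  have valP: "valid P"
  proof (rule validI, unfold P_sel)
    show "strict_mono l" by (rule l_mono)
    show "even (l i) \<longleftrightarrow> even i" for i by (rule l_even)
    show "xc (l i) = Own i" if "even i" for i by (simp add: xc_def l_Kinf lx_l)
    show "even i \<and> l i \<le> s" if "even s" "xc s = Own i" for s i by (rule xc_Own[OF that])
    show "xr (l n) s = own n (xc s)" if "odd n" "even s" "s < l n" for n s by (simp add: xr_def l_Kinf lx_l)
    show "odd j \<and> even i \<and> i < j \<and> l j \<le> t"
      if h: "odd t" "even s" "s < t" "xr t s = Par j i" for t s j i
    proof (cases "t div 2 \<in> Kinf")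
      case True
      then have "own (lx t) (xc s) = Par j i" using h by (simp add: xr_def)
      then have j: "j = lx t" "xc s = Own i" by (cases "xc s"; simp)+
      then have "even i" "l i \<le> s" using xc_Own[OF h(2)] by auto
      moreover have "l j = t" using j l_lx[OF True] by simp
      ultimately show ?thesis using h j lx_even l_less[of i j] by simp
    next
      case False
      then have p: "(t, s) \<in> Pos" and j: "j = lx (rt (pat (t, s)))" "i = lx (cr (rs (pat (t, s))))"
        using h by (auto simp: xr_def split: if_splits)
      let ?q = "pat (t, s)"
      have q: "rt ?q \<in> R" "odd (rt ?q)" "rs ?q \<in> Cs" "rs ?q < rt ?q" "rt ?q \<le> t" using pos_rep[OF p] by auto
      have "cr (rs ?q) mod 4 = 0" using cr_Cs[OF q(3)] Cs_mod by blast
      then have "even (cr (rs ?q))" by presburger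
      moreover have "cr (rs ?q) < rt ?q" using cr_le[of "rs ?q"] q(4) by simp
      ultimately show ?thesis using j q lx_even lx_less[OF _ CK[OF q(3)] RK(2)[OF q(1)]] l_lx[OF RK(2)[OF q(1)]] by simp
    qed
  qed
  define D where "D a = (lx (4 * k a), lx (4 * k a + 3),
      {(j, i). odd j \<and> even i \<and> i < j \<and> j < lx (4 * k a + 3) \<and> (l j, l i) \<in> C a})" for a
  have aK: "4 * k a div 2 \<in> Ks" "(4 * k a + 3) div 2 \<in> Ks" if "a \<in> I" for a
  proof -
    have "4 * k a div 2 = 2 * k a" by simp
    then show "4 * k a div 2 \<in> Ks" using that by (auto simp: Ks_def)
    have "4 * k a + 3 \<in> R" using that by (auto simp: R_def)
    then show "(4 * k a + 3) div 2 \<in> Ks" by (rule RK)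
  qed
  have "D a \<in> verts \<and> fst (snd (D a)) \<le> 2 * env_bound (card I) \<and> act P (D a) = (4 * k a, 4 * k a + 3, C a)"
    if a: "a \<in> I" for a
  proof -
    let ?n = "4 * k a + 3"
    have K: "4 * k a div 2 \<in> Kinf" "?n div 2 \<in> Kinf" using aK[OF a] by (auto simp: Kinf_def)
    have D_mem: "(lx t, lx s) \<in> snd (snd (D a)) \<longleftrightarrow> (t, s) \<in> C a"
      if "odd t" "even s" "s < t" "t < ?n" "t div 2 \<in> Kinf" "s div 2 \<in> Kinf" for t s
      using that lx_less[of s t] lx_less[of t ?n] K lx_even l_lx by (simp add: D_def)
    have "lx (4 * k a) < lx ?n" using lx_less[OF _ K] by simp
    moreover have "even (lx (4 * k a))" "odd (lx ?n)" using lx_even[of "4 * k a"] lx_even[of ?n] by simp_all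
    ultimately have v: "D a \<in> verts" by (auto simp: D_def verts_def)
    have "ix (?n div 2) < env_bound (card I)" using ix_less[OF aK(2)[OF a]] cardK by linarith
    then have b: "fst (snd (D a)) \<le> 2 * env_bound (card I)"
      using mod_less_divisor[of 2 ?n] unfolding D_def lx_def fst_conv snd_conv by linarith
    have main: "(case xr t s of RC b \<Rightarrow> b | Par j i \<Rightarrow> (j, i) \<in> snd (snd (D a))) \<longleftrightarrow> (t, s) \<in> C a"
      if ts: "odd t" "even s" "s < t" "t < ?n" for t s
    proof (cases "t div 2 \<in> Kinf")
      case True
      have e: "xr t s = own (lx t) (xc s)" using True by (simp add: xr_def)
      have crs: "cr s div 2 \<in> Kinf" "even (cr s)" "cr s < t" if "s \<in> Cs"
      proof -
        show "cr s div 2 \<in> Kinf" using CK that by blast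
        have "cr s mod 4 = 0" using cr_Cs[OF that] Cs_mod by blast
        then show "even (cr s)" by presburger
        show "cr s < t" using cr_le[of s] ts by simp
      qed
      have val: "(case xr t s of RC b \<Rightarrow> b | Par j i \<Rightarrow> (j, i) \<in> snd (snd (D a))) \<longleftrightarrow>
          (if s div 2 \<in> Kinf then (t, s) \<in> C a else if s \<in> Cs then (t, cr s) \<in> C a else False)"
        using e D_mem[OF ts(1) _ _ ts(4) True] ts crs by (simp add: xc_def)
      \<comment> \<open>A row of residue 1 carries no entry of \<open>C a\<close>. A row level of
        residue 3 before \<open>?n\<close> stems from an odd member of \<open>Ks\<close>, hence from
        \<open>R\<close>, and there the columns \<open>s\<close> and \<open>cr s\<close> look
        alike.\<close>
      show ?thesis
      proof (cases "t mod 4 = 3")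
        case False
        then show ?thesis using val C[OF a] by auto
      next
        case t3: True
        have "t div 2 \<le> ?n div 2" using ts(4) by (simp add: div_le_mono)
        also have "\<dots> \<le> M" using KM aK(2)[OF a] by blast
        finally have "t div 2 \<in> Ks" using True by (auto simp: Kinf_def)
        moreover have "odd (t div 2)" using t3 by presburger
        moreover have "even (cr s' div 2)" if "s' \<in> Cs" for s'
        proof -
          have "cr s' mod 4 = 0" using cr_Cs[OF that] Cs_mod by blast
          then show ?thesis by presburger
        qed
        ultimately obtain t' where t': "t' \<in> R" "t div 2 = t' div 2" by (fastforce simp: Ks_def)
        have "t = 2 * (t div 2) + 1" "t' = 2 * (t' div 2) + 1" using t3 R_mod[OF t'(1)] by presburger+
        then have tR: "t \<in> R" using t' by simp
        have "(t, a) \<in> cp (cr s) \<longleftrightarrow> (t, a) \<in> cp s" using cr_eq by simp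
        then have "(t, cr s) \<in> C a \<longleftrightarrow> (t, s) \<in> C a" using tR a by (simp add: cp_def)
        moreover have "(t, s) \<notin> C a" if "s \<notin> Cs" using that tR a by (auto simp: Cs_def cp_def)
        ultimately show ?thesis using val by auto
      qed
    next
      case False
      show ?thesis
      proof (cases "(t, s) \<in> Pos")
        case True
        let ?q = "pat (t, s)"
        have q: "rt ?q \<in> R" "odd (rt ?q)" "rs ?q \<in> Cs" "rs ?q < rt ?q" "rt ?q \<le> t" using pos_rep[OF True] by auto
        have "cr (rs ?q) mod 4 = 0" using cr_Cs[OF q(3)] Cs_mod by blast
        then have ev: "even (cr (rs ?q))" by presburger
        have lt: "cr (rs ?q) < rt ?q" using cr_le[of "rs ?q"] q(4) by simp
        have "xr t s = Par (lx (rt ?q)) (lx (cr (rs ?q)))" using False True by (simp add: xr_def)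
        then have "(case xr t s of RC b \<Rightarrow> b | Par j i \<Rightarrow> (j, i) \<in> snd (snd (D a))) \<longleftrightarrow> (rt ?q, cr (rs ?q)) \<in> C a"
          using D_mem[OF q(2) ev lt _ RK(2)[OF q(1)] CK[OF q(3)]] q(5) ts(4) by simp
        also have "\<dots> \<longleftrightarrow> (rt ?q, a) \<in> cp (cr (rs ?q))" using q(1) a by (simp add: cp_def)
        also have "\<dots> \<longleftrightarrow> (rt ?q, rs ?q) \<in> C a" unfolding cr_eq using q(1) a by (simp add: cp_def)
        also have "\<dots> \<longleftrightarrow> a \<in> pat (rt ?q, rs ?q)" using a by (simp add: pat_def)
        also have "\<dots> \<longleftrightarrow> (t, s) \<in> C a" using rs[OF True refl] a by (simp add: pat_def)
        finally show ?thesis .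
      next
        case nP: False
        then show ?thesis using False a by (auto simp: xr_def Pos_def)
      qed
    qed
    have D1: "fst (D a) = lx (4 * k a)" "fst (snd (D a)) = lx ?n" by (simp_all add: D_def)
    have "snd (snd (act P (D a))) = C a"
    proof (rule set_eqI, clarify)
      fix t s
      have "(t, s) \<in> snd (snd (act P (D a))) \<longleftrightarrow> odd t \<and> even s \<and> s < t \<and> t < ?n \<and>
          (case xr t s of RC b \<Rightarrow> b | Par j i \<Rightarrow> (j, i) \<in> snd (snd (D a)))"
        using l_lx[OF K(2)] D1 by (simp add: act_def case_prod_beta P_sel)
      also have "\<dots> \<longleftrightarrow> (t, s) \<in> C a"
      proof
        assume "(t, s) \<in> C a"
        then have c: "t mod 4 = 3 \<and> s mod 4 = 0 \<and> s < t \<and> t < ?n" using C[OF a] by blast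
        then have "odd t" "even s" by presburger+
        then show "odd t \<and> even s \<and> s < t \<and> t < ?n \<and>
          (case xr t s of RC b \<Rightarrow> b | Par j i \<Rightarrow> (j, i) \<in> snd (snd (D a)))" using main c \<open>(t, s) \<in> C a\<close> by blast
      qed (use main in blast)
      finally show "(t, s) \<in> snd (snd (act P (D a))) \<longleftrightarrow> (t, s) \<in> C a" .
    qed
    then have "act P (D a) = (4 * k a, ?n, C a)"
      using l_lx[OF K(1)] l_lx[OF K(2)] D1 act_simps[of P "D a"] by (simp add: prod_eq_iff P_sel)
    then show ?thesis using v b by blast
  qed
  then show ?thesis using valP by blast
qed

section \<open>Hypergraphs\<close>

lemma restrict_embedding:
  assumes "\<And>x. x \<in> vertices A \<Longrightarrow> f x \<in> vertices B" "inj_on f (vertices A)"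
    and "\<And>e. e \<subseteq> vertices A \<Longrightarrow> e \<in> hyperedges A \<longleftrightarrow> f ` e \<in> hyperedges B"
  shows "restrict f (vertices A) \<in> embeddings A B"
proof -
  have "restrict f (vertices A) ` e = f ` e" if "e \<subseteq> vertices A" for e using that by auto
  then show ?thesis using assms unfolding embeddings_def by (auto simp: inj_on_restrict_eq)
qed

lemma embeddingD:
  assumes "f \<in> embeddings A B"
  shows "x \<in> vertices A \<Longrightarrow> f x \<in> vertices B" "inj_on f (vertices A)"
    "e \<subseteq> vertices A \<Longrightarrow> e \<in> hyperedges A \<longleftrightarrow> f ` e \<in> hyperedges B"
    "f \<in> extensional (vertices A)"
  using assms by (auto simp: embeddings_def PiE_def)

lemma compose_embeddings:
  assumes f: "f \<in> embeddings A B" and g: "g \<in> embeddings B C"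
  shows "restrict (\<lambda>x. g (f x)) (vertices A) \<in> embeddings A C"
proof (rule restrict_embedding)
  show "g (f x) \<in> vertices C" if "x \<in> vertices A" for x
    using that embeddingD(1)[OF f] embeddingD(1)[OF g] by blast
  show "inj_on (\<lambda>x. g (f x)) (vertices A)"
    using embeddingD(1,2)[OF f] embeddingD(2)[OF g] by (simp add: inj_on_def)
  show "e \<in> hyperedges A \<longleftrightarrow> (\<lambda>x. g (f x)) ` e \<in> hyperedges C" if "e \<subseteq> vertices A" for e
  proof -
    have "f ` e \<subseteq> vertices B" using that embeddingD(1)[OF f] by blast
    then show ?thesis using embeddingD(3)[OF f that] embeddingD(3)[OF g, of "f ` e"] by (simp add: image_image)
  qed
qed

lemma embedding_induced:
  assumes "h \<in> embeddings A (induced H S)"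
  shows "h \<in> embeddings A H" "x \<in> vertices A \<Longrightarrow> h x \<in> S"
proof -
  show S: "h x \<in> S" if "x \<in> vertices A" for x using embeddingD(1)[OF assms that] by (simp add: induced_def)
  have "h ` e \<subseteq> S" if "e \<subseteq> vertices A" for e using that S by blast
  then have "e \<in> hyperedges A \<longleftrightarrow> h ` e \<in> hyperedges H" if "e \<subseteq> vertices A" for e
    using that embeddingD(3)[OF assms that] by (simp add: induced_def)
  then have "restrict h (vertices A) \<in> embeddings A H"
    using embeddingD(1,2)[OF assms] by (intro restrict_embedding) (auto simp: induced_def)
  then show "h \<in> embeddings A H" using embeddingD(4)[OF assms] by (simp add: extensional_restrict)
qed

lemma universal_countable:
  assumes "universal H" "countable (vertices G)" "three_uniform G"
  shows "embeddings G H \<noteq> {}"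
proof -
  let ?V = "vertices G" and ?c = "to_nat_on (vertices G)"
  let ?G = "\<lparr>vertices = ?c ` ?V, hyperedges = (`) ?c ` hyperedges G\<rparr>"
  have inj: "inj_on ?c ?V" using assms(2) by (rule inj_on_to_nat_on)
  have sub: "e \<subseteq> ?V" "card e = 3" if "e \<in> hyperedges G" for e using that assms(3) by (auto simp: three_uniform_def)
  have "three_uniform ?G"
    using sub inj by (auto simp: three_uniform_def card_image inj_on_subset)
  then obtain g where g: "g \<in> embeddings ?G H" using assms(1) by (auto simp: universal_def)
  have "restrict ?c ?V \<in> embeddings G ?G"
  proof (rule restrict_embedding)
    show "e \<in> hyperedges G \<longleftrightarrow> ?c ` e \<in> hyperedges ?G" if "e \<subseteq> ?V" for e
      using that sub(1) inj_on_image_eq_iff[OF inj] by (auto simp: image_iff)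
  qed (use inj in auto)
  then show ?thesis using compose_embeddings[OF _ g] by blast
qed

text \<open>This hypergraph and \<open>H\<close> need only embed into each other, so vertices
  sharing a row may be left without common hyperedges.\<close>

definition matrix_graph :: "vert hypergraph" where
  "matrix_graph = \<lparr>vertices = verts, hyperedges = {{a, b, c} |a b c. a \<in> verts \<and> b \<in> verts \<and> c \<in> verts \<and>
     fst (snd a) < fst (snd b) \<and> fst (snd b) < fst (snd c) \<and> (fst (snd b), fst a) \<in> snd (snd c)}\<rparr>"

lemma matrix_graph_sel [simp]: "vertices matrix_graph = verts" by (simp add: matrix_graph_def)

lemma matrix_edgeI:
  assumes "a \<in> verts" "b \<in> verts" "c \<in> verts" "fst (snd a) < fst (snd b)" "fst (snd b) < fst (snd c)"
    "(fst (snd b), fst a) \<in> snd (snd c)"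
  shows "{a, b, c} \<in> hyperedges matrix_graph"
  using assms unfolding matrix_graph_def hypergraph.simps by blast

lemma matrix_edgeE:
  assumes "e \<in> hyperedges matrix_graph"
  obtains a b c where "e = {a, b, c}" "a \<in> verts" "b \<in> verts" "c \<in> verts" "fst (snd a) < fst (snd b)"
    "fst (snd b) < fst (snd c)" "(fst (snd b), fst a) \<in> snd (snd c)"
  using assms unfolding matrix_graph_def by auto

lemma three_uniform_matrix_graph: "three_uniform matrix_graph"
  unfolding three_uniform_def
proof
  fix e assume "e \<in> hyperedges matrix_graph"
  then obtain a b c where e: "e = {a, b, c}" "a \<in> verts" "b \<in> verts" "c \<in> verts"
    and lt: "fst (snd a) < fst (snd b)" "fst (snd b) < fst (snd c)" by (rule matrix_edgeE)
  have "a \<noteq> b" "b \<noteq> c" "a \<noteq> c" using lt by auto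
  then show "e \<subseteq> vertices matrix_graph \<and> card e = 3" using e by simp
qed

lemma countable_verts: "countable verts"
proof (rule countable_subset)
  show "verts \<subseteq> UNIV \<times> UNIV \<times> {C. finite C}"
  proof
    fix v :: vert assume "v \<in> verts"
    then have "snd (snd v) \<subseteq> {..<fst (snd v)} \<times> {..<fst (snd v)}" by (auto simp: verts_def)
    then have "finite (snd (snd v))" by (rule finite_subset) simp
    then show "v \<in> UNIV \<times> UNIV \<times> {C. finite C}" by (cases v) simp
  qed
  show "countable (UNIV \<times> UNIV \<times> {C. finite C} :: vert set)"
    using countable_Collect_finite by (intro countable_SIGMA) auto
qed

lemma act_embedding:
  assumes P: "valid P" shows "restrict (act P) verts \<in> embeddings matrix_graph matrix_graph"
proof -
  have "restrict (act P) (vertices matrix_graph) \<in> embeddings matrix_graph matrix_graph"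
  proof (rule restrict_embedding)
    show "act P v \<in> vertices matrix_graph" if "v \<in> vertices matrix_graph" for v using that act_verts[OF P] by simp
    show "inj_on (act P) (vertices matrix_graph)" using act_inj[OF P] by simp
    have mem: "(fst (snd (act P b)), fst (act P a)) \<in> snd (snd (act P c)) \<longleftrightarrow> (fst (snd b), fst a) \<in> snd (snd c)"
      if "a \<in> verts" "b \<in> verts" "c \<in> verts" "fst (snd a) < fst (snd b)" "fst (snd b) < fst (snd c)" for a b c
      using that act_mem[OF P that(3), of "fst (snd b)" "fst a"] by (auto simp: verts_def)
    fix e assume e: "e \<subseteq> vertices matrix_graph"
    show "e \<in> hyperedges matrix_graph \<longleftrightarrow> act P ` e \<in> hyperedges matrix_graph"
    proof
      assume "e \<in> hyperedges matrix_graph"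
      then obtain a b c where abc: "e = {a, b, c}" "a \<in> verts" "b \<in> verts" "c \<in> verts" "fst (snd a) < fst (snd b)"
        "fst (snd b) < fst (snd c)" "(fst (snd b), fst a) \<in> snd (snd c)" by (rule matrix_edgeE)
      have "{act P a, act P b, act P c} \<in> hyperedges matrix_graph"
        using abc mem[OF abc(2-6)] act_verts[OF P] valid_lv_less[OF P] by (intro matrix_edgeI) simp_all
      then show "act P ` e \<in> hyperedges matrix_graph" using abc(1) by simp
    next
      assume "act P ` e \<in> hyperedges matrix_graph"
      then obtain a' b' c' where abc': "act P ` e = {a', b', c'}" "fst (snd a') < fst (snd b')"
        "fst (snd b') < fst (snd c')" "(fst (snd b'), fst a') \<in> snd (snd c')" by (rule matrix_edgeE)
      then have "a' \<in> act P ` e" "b' \<in> act P ` e" "c' \<in> act P ` e" by simp_all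
      then obtain a b c where abc: "a \<in> e" "b \<in> e" "c \<in> e" "a' = act P a" "b' = act P b" "c' = act P c"
        by (elim imageE)
      have v: "a \<in> verts" "b \<in> verts" "c \<in> verts" using abc e by auto
      have "act P ` e = act P ` {a, b, c}" using abc' abc by simp
      then have e3: "e = {a, b, c}" using e v inj_on_image_eq_iff[OF act_inj[OF P], of e "{a, b, c}"] by simp
      have "fst (snd a) < fst (snd b)" "fst (snd b) < fst (snd c)" using abc' abc valid_lv_less[OF P] by auto
      then show "e \<in> hyperedges matrix_graph" unfolding e3 using v mem abc' abc by (intro matrix_edgeI) auto
    qed
  qed
  then show ?thesis by simp
qed

section \<open>Coding \<open>H\<close> by matrices along an enumeration\<close>

definition row_code :: "'h hypergraph \<Rightarrow> 'h \<Rightarrow> (nat \<times> nat) set" where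
  "row_code H z = {(4 * to_nat_on (vertices H) y + 3, 4 * to_nat_on (vertices H) x) |x y.
     x \<in> vertices H \<and> y \<in> vertices H \<and> to_nat_on (vertices H) x < to_nat_on (vertices H) y \<and>
     to_nat_on (vertices H) y < to_nat_on (vertices H) z \<and> {x, y, z} \<in> hyperedges H}"

text \<open>With columns at \<open>4 * k\<close> and rows at \<open>4 * k + 3\<close>, no pair
  \<open>2 * x\<close>, \<open>2 * x + 1\<close> contains two used positions. In an envelope the
  partner of a chosen position is then empty.\<close>

definition vertex_code :: "'h hypergraph \<Rightarrow> 'h \<Rightarrow> vert" where
  "vertex_code H z = (4 * to_nat_on (vertices H) z, 4 * to_nat_on (vertices H) z + 3, row_code H z)"

lemma row_code_mod:
  assumes "(t, s) \<in> row_code H z"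
  shows "t mod 4 = 3 \<and> s mod 4 = 0 \<and> s < t \<and> t < 4 * to_nat_on (vertices H) z + 3"
proof -
  obtain x y where "t = 4 * to_nat_on (vertices H) y + 3" "s = 4 * to_nat_on (vertices H) x"
    "to_nat_on (vertices H) x < to_nat_on (vertices H) y" "to_nat_on (vertices H) y < to_nat_on (vertices H) z"
    using assms by (auto simp: row_code_def)
  then show ?thesis by presburger
qed

lemma vertex_code_embedding:
  assumes cH: "countable (vertices H)" and uH: "three_uniform H"
  shows "restrict (vertex_code H) (vertices H) \<in> embeddings H matrix_graph"
proof (rule restrict_embedding)
  let ?V = "vertices H" and ?k = "to_nat_on (vertices H)"
  have inj: "inj_on ?k ?V" using cH by (rule inj_on_to_nat_on)
  have n: "fst (vertex_code H z) = 4 * ?k z" "fst (snd (vertex_code H z)) = 4 * ?k z + 3"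
    "snd (snd (vertex_code H z)) = row_code H z" for z by (simp_all add: vertex_code_def)
  have v: "vertex_code H z \<in> verts" for z
  proof -
    have "odd t \<and> even s \<and> s < t \<and> t < 4 * ?k z + 3" if "(t, s) \<in> row_code H z" for t s
      using row_code_mod[OF that] by presburger
    then show ?thesis by (auto simp: vertex_code_def verts_def)
  qed
  then show "vertex_code H x \<in> vertices matrix_graph" for x by simp
  show injv: "inj_on (vertex_code H) ?V"
    using inj by (auto simp: inj_on_def vertex_code_def)
  fix e assume e: "e \<subseteq> ?V"
  show "e \<in> hyperedges H \<longleftrightarrow> vertex_code H ` e \<in> hyperedges matrix_graph"
  proof
    assume eH: "e \<in> hyperedges H"
    have ord: "vertex_code H ` {x, y, z} \<in> hyperedges matrix_graph"
      if "{x, y, z} \<in> hyperedges H" "?k x < ?k y" "?k y < ?k z" for x y z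
    proof -
      have "x \<in> ?V" "y \<in> ?V" using that(1) uH by (auto simp: three_uniform_def)
      then have "(4 * ?k y + 3, 4 * ?k x) \<in> row_code H z" using that unfolding row_code_def by blast
      then show ?thesis using matrix_edgeI[OF v v v, of x y z] that(2,3) by (simp add: n)
    qed
    obtain x y z where xyz: "e = {x, y, z}" "x \<noteq> y" "y \<noteq> z" "x \<noteq> z"
      using eH uH unfolding three_uniform_def by (metis card_3_iff)
    then have "?k x \<noteq> ?k y" "?k y \<noteq> ?k z" "?k x \<noteq> ?k z" using e inj_onD[OF inj] by auto
    then consider "?k x < ?k y \<and> ?k y < ?k z" | "?k x < ?k z \<and> ?k z < ?k y" | "?k y < ?k x \<and> ?k x < ?k z"
      | "?k y < ?k z \<and> ?k z < ?k x" | "?k z < ?k x \<and> ?k x < ?k y" | "?k z < ?k y \<and> ?k y < ?k x" by linarith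
    then show "vertex_code H ` e \<in> hyperedges matrix_graph"
      using eH xyz(1) ord[of x y z] ord[of x z y] ord[of y x z] ord[of y z x] ord[of z x y] ord[of z y x]
      by cases (simp_all add: insert_commute)
  next
    assume "vertex_code H ` e \<in> hyperedges matrix_graph"
    then obtain a b c where abc: "vertex_code H ` e = {a, b, c}" "fst (snd a) < fst (snd b)"
      "fst (snd b) < fst (snd c)" "(fst (snd b), fst a) \<in> snd (snd c)" by (rule matrix_edgeE)
    then have "a \<in> vertex_code H ` e" "b \<in> vertex_code H ` e" "c \<in> vertex_code H ` e" by simp_all
    then obtain x y z where xyz: "x \<in> e" "y \<in> e" "z \<in> e" "a = vertex_code H x" "b = vertex_code H y" "c = vertex_code H z"
      by (elim imageE)
    have "vertex_code H ` e = vertex_code H ` {x, y, z}" using abc(1) xyz by simp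
    then have e3: "e = {x, y, z}" using e xyz inj_on_image_eq_iff[OF injv, of e "{x, y, z}"] by blast
    have "(4 * ?k y + 3, 4 * ?k x) \<in> row_code H z" using abc xyz by (simp add: n)
    then obtain x' y' where xy: "x' \<in> ?V" "y' \<in> ?V" "?k y = ?k y'" "?k x = ?k x'" "{x', y', z} \<in> hyperedges H"
      by (auto simp: row_code_def)
    then have "x' = x" "y' = y" using inj_onD[OF inj] xyz e by auto
    then show "e \<in> hyperedges H" using xy e3 by simp
  qed
qed

section \<open>Transfer of colourings to \<open>H\<close>\<close>

lemma finite_small_verts: "finite {v \<in> verts. fst (snd v) \<le> d}"
proof (rule finite_subset)
  show "{v \<in> verts. fst (snd v) \<le> d} \<subseteq> {..d} \<times> {..d} \<times> Pow ({..d} \<times> {..d})"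
    by (auto simp: verts_def)
qed simp

text \<open>By envelopes each copy of \<open>A\<close> in the image of \<open>f\<close> is given by
  a parameter matrix and one of finitely many maps in \<open>DD\<close>. Once the colour is
  independent of the matrix, each map contributes a single colour.\<close>

lemma finite_big_Ramsey_bound:
  fixes H :: "'h hypergraph" and A :: "'a hypergraph"
  assumes cH: "countable (vertices H)" and uH: "three_uniform H" and univ: "universal H"
    and fA: "finite (vertices A)"
  shows "\<exists>l :: nat. \<forall>k :: nat. \<forall>\<chi> \<in> embeddings A H \<rightarrow> {..<k}.
     \<exists>f \<in> embeddings H H. card (\<chi> ` embeddings A (induced H (f ` vertices H))) \<le> l"
proof -
  let ?V = "vertices H" and ?I = "vertices A"
  define d where "d = 2 * env_bound (card ?I)"
  define DD where "DD = (?I \<rightarrow>\<^sub>E {v \<in> verts. fst (snd v) \<le> d})"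
  have finD: "finite DD" unfolding DD_def using fA finite_small_verts by (rule finite_PiE)
  have "embeddings matrix_graph H \<noteq> {}"
    using countable_verts three_uniform_matrix_graph by (intro universal_countable[OF univ]) auto
  then obtain \<theta> where \<theta>: "\<theta> \<in> embeddings matrix_graph H" by blast
  have "\<exists>f \<in> embeddings H H. card (\<chi> ` embeddings A (induced H (f ` ?V))) \<le> card DD"
    if \<chi>: "\<chi> \<in> embeddings A H \<rightarrow> {..<k}" for k :: nat and \<chi>
  proof -
    define \<Xi> where "\<Xi> P D = restrict (\<lambda>a. \<theta> (act P (D a))) ?I" for P and D :: "'a \<Rightarrow> vert"
    \<comment> \<open>All maps in \<open>DD\<close> are recorded at once. The value 0 is a default
      for those \<open>D\<close> where \<open>\<Xi> P D\<close> is no embedding and has no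
      colour.\<close>
    define F where "F P = restrict (\<lambda>D. if \<Xi> P D \<in> embeddings A H then \<chi> (\<Xi> P D) else 0) DD" for P
    have "local d F" unfolding local_def
    proof (intro allI impI)
      fix P P' assume P: "valid P" "valid P'" "agree d P P'"
      have "\<Xi> P D = \<Xi> P' D" if "D \<in> DD" for D
      proof -
        have "act P (D a) = act P' (D a)" if "a \<in> ?I" for a
          using that \<open>D \<in> DD\<close> by (intro act_agree[OF P(3,1)]) (auto simp: DD_def)
        then show ?thesis unfolding \<Xi>_def by (intro restrict_ext) simp
      qed
      then show "F P = F P'" unfolding F_def by (intro restrict_ext) simp
    qed
    moreover have "finite (F ` Collect valid)"
    proof (rule finite_subset)
      show "F ` Collect valid \<subseteq> DD \<rightarrow>\<^sub>E insert 0 {..<k}" using \<chi> by (auto simp: F_def)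
      show "finite (DD \<rightarrow>\<^sub>E insert 0 {..<k})" using finD by (intro finite_PiE) auto
    qed
    ultimately obtain W c where W: "valid W" "\<And>P. valid P \<Longrightarrow> F (W \<otimes> P) = c" using pmat_Ramsey[of d F] by blast
    \<comment> \<open>Code \<open>H\<close> by matrices, act by \<open>W\<close>, and return through
      \<open>\<theta>\<close>; copies of \<open>A\<close> in the image then have the form
      \<open>\<Xi> (W \<otimes> P) D\<close>.\<close>
    define f where "f = restrict (\<lambda>x. \<theta> (act W (vertex_code H x))) ?V"
    have "restrict (\<lambda>x. restrict (act W) verts (restrict (vertex_code H) ?V x)) ?V \<in> embeddings H matrix_graph"
      using compose_embeddings[OF vertex_code_embedding[OF cH uH] act_embedding[OF W(1)]] .
    from compose_embeddings[OF this \<theta>]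
    have "restrict (\<lambda>x. \<theta> (restrict (\<lambda>x. restrict (act W) verts (restrict (vertex_code H) ?V x)) ?V x)) ?V \<in> embeddings H H" .
    moreover have "restrict (\<lambda>x. \<theta> (restrict (\<lambda>x. restrict (act W) verts (restrict (vertex_code H) ?V x)) ?V x)) ?V = f"
      unfolding f_def using embeddingD(1)[OF vertex_code_embedding[OF cH uH]] by (intro restrict_ext) simp
    ultimately have f: "f \<in> embeddings H H" by simp
    have "\<chi> ` embeddings A (induced H (f ` ?V)) \<subseteq> c ` DD"
    proof (rule image_subsetI)
      fix h assume h: "h \<in> embeddings A (induced H (f ` ?V))"
      have "\<forall>a\<in>?I. \<exists>x\<in>?V. h a = f x" using embedding_induced(2)[OF h] by blast
      then obtain x where x: "\<And>a. a \<in> ?I \<Longrightarrow> x a \<in> ?V \<and> h a = f (x a)" by metis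
      have "\<exists>P D. valid P \<and> (\<forall>a\<in>?I. D a \<in> verts \<and> fst (snd (D a)) \<le> d \<and>
          act P (D a) = (4 * to_nat_on ?V (x a), 4 * to_nat_on ?V (x a) + 3, row_code H (x a)))"
        unfolding d_def by (rule envelope[OF fA]) (rule row_code_mod)
      then obtain P D where PD: "valid P" "\<forall>a\<in>?I. D a \<in> verts \<and> fst (snd (D a)) \<le> d \<and>
          act P (D a) = (4 * to_nat_on ?V (x a), 4 * to_nat_on ?V (x a) + 3, row_code H (x a))"
        by (elim exE conjE)
      define D' where "D' = restrict D ?I"
      have D': "D' \<in> DD" unfolding D'_def DD_def using PD(2) by auto
      have "\<Xi> (W \<otimes> P) D' = h"
      proof (rule extensionalityI[of _ ?I])
        show "\<Xi> (W \<otimes> P) D' \<in> extensional ?I" by (simp add: \<Xi>_def)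
        show "h \<in> extensional ?I" using embeddingD(4)[OF h] .
        fix a assume a: "a \<in> ?I"
        have "act (W \<otimes> P) (D' a) = act W (vertex_code H (x a))"
          using a PD(2) by (simp add: D'_def act_comp[OF W(1)] vertex_code_def)
        then show "\<Xi> (W \<otimes> P) D' a = h a" using a x[OF a] by (simp add: \<Xi>_def f_def)
      qed
      then have "F (W \<otimes> P) D' = \<chi> h" using D' embedding_induced(1)[OF h] by (simp add: F_def)
      then show "\<chi> h \<in> c ` DD" using W(2)[OF PD(1)] D' by (metis imageI)
    qed
    then have "card (\<chi> ` embeddings A (induced H (f ` ?V))) \<le> card DD"
      using finD by (meson card_image_le card_mono finite_imageI le_trans)
    then show ?thesis using f by blast
  qed
  then show ?thesis by blast
qed

theorem theorem1p1:
  fixes H :: "'h hypergraph" and A :: "'a hypergraph"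
  assumes "universal_homogeneous H"
    and "three_uniform A" and "finite (vertices A)"
  shows "big_Ramsey_degree H A < \<infinity> \<and>
    (\<exists>l :: nat. \<forall>k :: nat. \<forall>\<chi> \<in> embeddings A H \<rightarrow> {..<k}.
       \<exists>f \<in> embeddings H H. card (\<chi> ` embeddings A (induced H (f ` vertices H))) \<le> l)"
proof -
  have "\<exists>l :: nat. \<forall>k :: nat. \<forall>\<chi> \<in> embeddings A H \<rightarrow> {..<k}.
     \<exists>f \<in> embeddings H H. card (\<chi> ` embeddings A (induced H (f ` vertices H))) \<le> l"
    using assms by (intro finite_big_Ramsey_bound) (auto simp: universal_homogeneous_def)
  then obtain l :: nat where l: "\<forall>k :: nat. \<forall>\<chi> \<in> embeddings A H \<rightarrow> {..<k}.
     \<exists>f \<in> embeddings H H. card (\<chi> ` embeddings A (induced H (f ` vertices H))) \<le> l" by blast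
  then have "big_Ramsey_degree H A \<le> enat l"
    unfolding big_Ramsey_degree_def by (intro Least_le) simp
  also have "\<dots> < \<infinity>" by simp
  finally show ?thesis using l by blast
qed

end
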